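(* Let $u$ be a weight on the unit disc $\mathbb{D}$ satisfying condition $B_2$, with $\mu=u\,dA$ a probability measure, and let $\nu$ be a Borel probability measure on $\mathbb{D}$. Then the following are equivalent: (a) the Toeplitz operator $T_\nu$ is compact on $A^2(u)$; (b) $\tilde\nu(a)\to 0$ as $|a|\to1^-$, where $\tilde\nu$ is the Berezin transform of $\nu$; (c) $\nu$ is a $\mu$-vanishing Carleson measure.
   Context: $\mathbb{D}$ is the open unit disc in $\mathbb{C}$ and $dA$ is Lebesgue area measure on $\mathbb{D}$ normalized so that $A(\mathbb{D})=1$. A weight is an integrable function $u\in L^1(\mathbb{D},dA)$ with $u>0$ a.e. $A^2(u)$ is the Hilbert space of analytic functions $f$ on $\mathbb{D}$ with $\|f\|_{A^2(u)}^2=\int_{\mathbb{D}}|f|^2u\,dA<\infty$, with inner product $\langle f,g\rangle_{A^2(u)}=\int_{\mathbb{D}} f\overline{g}\,u\,dA$. Condition $B_2$ (Bekollé–Bonami): there is a constant $C>0$ such that for every interval (arc) $I\subset\partial\mathbb{D}$, $$\frac{1}{A(S(I))^2}\int_{S(I)}u\,dA\int_{S(I)}\frac1u\,dA\le C,$$ where $S(I)=\{\rho e^{it}: e^{it}\in I,\ 1-\frac{|I|}{2\pi}\le \rho<1\}$ and $|I|$ is the arc length of $I$. If $u$ satisfies $B_2$, point evaluations are bounded on $A^2(u)$, and $K_u(\cdot,a)\in A^2(u)$ denotes the reproducing kernel at $a\in\mathbb{D}$: $f(a)=\langle f,K_u(\cdot,a)\rangle_{A^2(u)}$ for all $f\in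 A^2(u)$. The Toeplitz operator $T_\nu$ is defined on polynomials $p$ by $T_\nu p(z)=\int_{\mathbb{D}}K_u(z,w)p(w)\,d\nu(w)$. It is bounded on $A^2(u)$ if it extends to a bounded linear operator on $A^2(u)$ given by the same formula: for every $f\in A^2(u)$ and $z\in\mathbb{D}$ the integral $T_\nu f(z)=\int_{\mathbb{D}}K_u(z,w)f(w)\,d\nu(w)$ converges absolutely, $T_\nu f\in A^2(u)$, and $\|T_\nu f\|_{A^2(u)}\le C\|f\|_{A^2(u)}$ with $C$ independent of $f$. It is compact if it is bounded in this sense and the resulting operator on $A^2(u)$ is compact. For $a\in\mathbb{D}$ let $B_a(z)=\frac{1}{(1-\overline{a}z)^2}$. The Berezin transform of $\nu$ is $$\tilde\nu(a)=\frac{1}{\|B_a\|_{A^2(u)}^2}\int_{\mathbb{D}}|B_a(z)|^2\,d\nu(z),\qquad a\in\mathbb{D}.$$ $\nu$ is a $\mu$-vanishing Carleson measure if the inclusion operator $i:A^2(u)\to L^2(\nu)$ is (well defined and) compact. *)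

theory Defs
  imports "HOL-Complex_Analysis.Complex_Analysis" "HOL-Probability.Probability"
begin

abbreviation unit_disc :: "complex set" where
  "unit_disc \<equiv> ball 0 1"

definition dA :: "complex measure" where
  "dA = scale_measure (ennreal (1 / pi)) (lebesgue_on unit_disc)"

definition weight :: "(complex \<Rightarrow> real) \<Rightarrow> bool" where
  "weight u \<longleftrightarrow> integrable dA u \<and> (AE z in dA. u z > 0)"

text \<open>The box over a subset \<open>I\<close> of the unit circle; \<open>l\<close> is the arc length of \<open>I\<close>.\<close>

definition carleson_box :: "complex set \<Rightarrow> real \<Rightarrow> complex set" where
  "carleson_box I l = {of_real \<rho> * \<zeta> | \<rho> \<zeta>. \<zeta> \<in> I \<and> 1 - l / (2 * pi) \<le> \<rho> \<and> \<rho> < 1}"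

text \<open>
  Every nondegenerate arc is the image under \<open>cis\<close> of an interval \<open>J\<close> (open, closed or half-open)
  whose length lies in \<open>]0, 2 \<pi>]\<close>, and that length is the arc length. An unbounded \<open>J\<close>
  has \<open>measure lborel J = 0\<close> and is thereby excluded.
  The integrals take values in \<open>[0, \<infinity>]\<close>, so the condition forces \<open>1 / u\<close> to be integrable.
\<close>

definition B2_condition :: "(complex \<Rightarrow> real) \<Rightarrow> bool" where
  "B2_condition u \<longleftrightarrow>
     (\<exists>C::real. C > 0 \<and>
       (\<forall>J::real set. is_interval J \<and> 0 < measure lborel J \<and> measure lborel J \<le> 2 * pi \<longrightarrow>
         (let S = carleson_box (cis ` J) (measure lborel J) in
           1 / (emeasure dA S)\<^sup>2 * (\<integral>\<^sup>+z\<in>S. ennreal (u z) \<partial>dA) * (\<integral>\<^sup>+z\<in>S. ennreal (1 / u z) \<partial>dA)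
             \<le> ennreal C)))"

text \<open>
  Elements of \<open>A2 u\<close> are total functions of which only the values on the disc matter:
  functions that agree on the disc represent the same element.
\<close>

definition A2 :: "(complex \<Rightarrow> real) \<Rightarrow> (complex \<Rightarrow> complex) set" where
  "A2 u = {f. f holomorphic_on unit_disc \<and> integrable dA (\<lambda>z. (cmod (f z))\<^sup>2 * u z)}"

definition A2_inner ::
    "(complex \<Rightarrow> real) \<Rightarrow> (complex \<Rightarrow> complex) \<Rightarrow> (complex \<Rightarrow> complex) \<Rightarrow> complex" where
  "A2_inner u f g = (\<integral>z. f z * cnj (g z) * of_real (u z) \<partial>dA)"

definition A2_norm :: "(complex \<Rightarrow> real) \<Rightarrow> (complex \<Rightarrow> complex) \<Rightarrow> real" where
  "A2_norm u f = sqrt (\<integral>z. (cmod (f z))\<^sup>2 * u z \<partial>dA)"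

definition L2 :: "complex measure \<Rightarrow> (complex \<Rightarrow> complex) set" where
  "L2 \<nu> = {f. f \<in> borel_measurable \<nu> \<and> integrable \<nu> (\<lambda>z. (cmod (f z))\<^sup>2)}"

definition L2_norm :: "complex measure \<Rightarrow> (complex \<Rightarrow> complex) \<Rightarrow> real" where
  "L2_norm \<nu> f = sqrt (\<integral>z. (cmod (f z))\<^sup>2 \<partial>\<nu>)"

text \<open>
  For \<open>a\<close> in the disc the choice is unique up to values off the disc, which are never used.
\<close>

definition repr_kernel :: "(complex \<Rightarrow> real) \<Rightarrow> complex \<Rightarrow> complex \<Rightarrow> complex" where
  "repr_kernel u z a = (SOME k. k \<in> A2 u \<and> (\<forall>f\<in>A2 u. f a = A2_inner u f k)) z"

definition toeplitz ::
    "(complex \<Rightarrow> real) \<Rightarrow> complex measure \<Rightarrow> (complex \<Rightarrow> complex) \<Rightarrow> complex \<Rightarrow> complex" where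
  "toeplitz u \<nu> f z = (\<integral>w. repr_kernel u z w * f w \<partial>\<nu>)"

definition toeplitz_bounded :: "(complex \<Rightarrow> real) \<Rightarrow> complex measure \<Rightarrow> bool" where
  "toeplitz_bounded u \<nu> \<longleftrightarrow>
     (\<forall>f\<in>A2 u. \<forall>z\<in>unit_disc. integrable \<nu> (\<lambda>w. repr_kernel u z w * f w)) \<and>
     (\<forall>f\<in>A2 u. toeplitz u \<nu> f \<in> A2 u) \<and>
     (\<exists>C. \<forall>f\<in>A2 u. A2_norm u (toeplitz u \<nu> f) \<le> C * A2_norm u f)"

text \<open>
  Compactness of a linear map between function spaces \<open>X\<close>, \<open>Y\<close> with (semi)norms
  \<open>nX\<close>, \<open>nY\<close>: bounded sequences have images with norm-convergent subsequences.
\<close>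

definition compact_operator ::
    "('a \<Rightarrow> complex) set \<Rightarrow> (('a \<Rightarrow> complex) \<Rightarrow> real) \<Rightarrow>
     ('b \<Rightarrow> complex) set \<Rightarrow> (('b \<Rightarrow> complex) \<Rightarrow> real) \<Rightarrow>
     (('a \<Rightarrow> complex) \<Rightarrow> 'b \<Rightarrow> complex) \<Rightarrow> bool" where
  "compact_operator X nX Y nY T \<longleftrightarrow>
     T ` X \<subseteq> Y \<and>
     (\<forall>f :: nat \<Rightarrow> 'a \<Rightarrow> complex. (\<forall>n. f n \<in> X) \<and> (\<exists>M. \<forall>n. nX (f n) \<le> M) \<longrightarrow>
       (\<exists>g\<in>Y. \<exists>r :: nat \<Rightarrow> nat. strict_mono r \<and>
          (\<lambda>n. nY (\<lambda>x. T (f (r n)) x - g x)) \<longlonglongrightarrow> 0))"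

definition toeplitz_compact :: "(complex \<Rightarrow> real) \<Rightarrow> complex measure \<Rightarrow> bool" where
  "toeplitz_compact u \<nu> \<longleftrightarrow>
     toeplitz_bounded u \<nu> \<and>
     compact_operator (A2 u) (A2_norm u) (A2 u) (A2_norm u) (toeplitz u \<nu>)"

definition vanishing_Carleson :: "(complex \<Rightarrow> real) \<Rightarrow> complex measure \<Rightarrow> bool" where
  "vanishing_Carleson u \<nu> \<longleftrightarrow>
     compact_operator (A2 u) (A2_norm u) (L2 \<nu>) (L2_norm \<nu>) (\<lambda>f. f)"

definition B_fun :: "complex \<Rightarrow> complex \<Rightarrow> complex" where
  "B_fun a z = 1 / (1 - cnj a * z)\<^sup>2"

definition berezin :: "(complex \<Rightarrow> real) \<Rightarrow> complex measure \<Rightarrow> complex \<Rightarrow> real" where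
  "berezin u \<nu> a = 1 / (A2_norm u (B_fun a))\<^sup>2 * (\<integral>z. (cmod (B_fun a z))\<^sup>2 \<partial>\<nu>)"

end

theory Submission imports Defs begin

text \<open>
  Write \<open>\<mu> = u dA\<close> and \<open>\<sigma> = dA / u\<close>. Condition \<open>B\<^sub>2\<close> says that \<open>\<mu>(E) \<sigma>(E)\<close> is at most of order \<open>s\<^sup>4\<close> for the
  part \<open>E\<close> of the disc within distance \<open>s\<close> of a boundary point, and together with the Cauchy-Schwarz
  inequality it makes \<open>\<sigma>(E)\<close> grow geometrically when \<open>s\<close> is doubled. Summing over dyadic annuli,
  \<open>\<parallel>B\<^sub>a\<parallel>\<^sup>2\<close> is comparable to the reciprocal of the \<open>\<sigma>\<close>-measure of a disc around \<open>a\<close> of radius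
  comparable to \<open>1 - \<bar>a\<bar>\<close>. The mean value property and the Cauchy-Schwarz inequality bound
  \<open>\<bar>f(z)\<bar>\<^sup>2\<close> by the \<open>\<mu>\<close>-integral of \<open>\<bar>f\<bar>\<^sup>2\<close> over a disc around \<open>z\<close>, times the \<open>\<sigma>\<close>-measure of that disc over
  its squared area, so that a Berezin transform vanishing at the boundary makes the \<open>\<nu>\<close>-integral of
  \<open>\<bar>f\<bar>\<^sup>2\<close> near the boundary uniformly small on the unit ball of \<open>A\<^sup>2(u)\<close>; with Montel's theorem the inclusion
  \<open>i\<close> into \<open>L\<^sup>2(\<nu>)\<close> is compact. Conversely, compactness is tested on the functions \<open>B\<^sub>a / \<parallel>B\<^sub>a\<parallel>\<close>, which tend to \<open>0\<close>
  pointwise.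

  The Toeplitz operator is \<open>i\<^sup>* i\<close>, so it inherits compactness from \<open>i\<close>. If \<open>T\<^sub>\<nu>\<close> is only known to be bounded,
  the identity \<open>\<langle>T\<^sub>\<nu> f, g\<rangle>\<^sub>\<mu> = \<langle>f, g\<rangle>\<^sub>\<nu>\<close> is immediate for \<open>g\<close> in the span of the reproducing kernels, and it
  extends to all of \<open>A\<^sup>2(u)\<close> by approximation and Fatou's lemma; it then gives compactness of \<open>i\<close> from that of \<open>T\<^sub>\<nu>\<close>.
\<close>

section \<open>The mean value property on discs\<close>

text \<open>The hypothesis is spent unevenly. Bounding f pointwise takes only Cauchy-Schwarz and the
  finiteness of \<sigma>; the strength of B2 at all scales goes into the matching upper bound for
  the norm of B_a. There is no formula for the kernel K_u, so T_\<nu> is accessible only through the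
  reproducing property. Compactness is handled by bounded sequences in A2 that tend to 0 locally
  uniformly: Montel's theorem supplies them, and they are weakly null in L2 of any finite measure on
  the disc in which they stay bounded. The delicate direction starts from T_\<nu>. Its boundedness
  gives integrability of f against single kernels only, so the inclusion into L2(\<nu>) has to be
  derived before inner products in L2(\<nu>) of general elements of A2 make sense.\<close>

lemma circle_mean_value:
  assumes "g holomorphic_on cball 0 1"
  shows "((\<lambda>t. g (exp (2 * of_real pi * \<i> * of_real t))) has_integral g 0) {0..1}"
proof -
  have "((\<lambda>u. g u / (u - 0)) has_contour_integral (2 * of_real pi * \<i> * g 0)) (circlepath 0 1)"
    by (rule Cauchy_integral_circlepath_simple) (use assms in auto)
  then have "((\<lambda>t. 2 * of_real pi * \<i> * g (exp (2 * of_real pi * \<i> * of_real t)))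
      has_integral (2 * of_real pi * \<i> * g 0)) {0..1}"
    unfolding has_contour_integral_def
  proof (rule has_integral_eq[rotated])
    fix t :: real assume "t \<in> {0..1}"
    then show "g (circlepath 0 1 t) / (circlepath 0 1 t - 0) * vector_derivative (circlepath 0 1) (at t within {0..1})
      = 2 * of_real pi * \<i> * g (exp (2 * of_real pi * \<i> * of_real t))"
      by (subst vector_derivative_circlepath01) (auto simp: circlepath)
  qed
  from has_integral_mult_right[OF this, of "1 / (2 * of_real pi * \<i>)"]
  show ?thesis by simp
qed

no_notation fps_nth (infixl "$" 75)

text \<open>Transports the invariance of Lebesgue measure under orthogonal maps from
  \<open>real^2\<close> to the complex plane. The coordinate map pulls boxes back to boxes of the
  same size, and boxes determine the measure.\<close>

lemma lborel_complex_eq_distr: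
  "(lborel :: complex measure) = distr lborel borel (\<lambda>x :: real^2. Complex (x $ 1) (x $ 2))"
proof (rule lborel_eqI)
  have [measurable]: "(\<lambda>x :: real^2. Complex (x $ 1) (x $ 2)) \<in> borel_measurable borel"
    by (intro borel_measurable_continuous_onI) (simp add: Complex_eq, intro continuous_intros)
  fix l u :: complex
  assume le: "\<And>b. b \<in> Basis \<Longrightarrow> l \<bullet> b \<le> u \<bullet> b"
  have le': "Re l \<le> Re u" "Im l \<le> Im u"
    using le[of 1] le[of \<i>] by (auto simp: Basis_complex_def)
  let ?l = "vector [Re l, Im l] :: real^2" and ?u = "vector [Re u, Im u] :: real^2"
  have "(\<lambda>x :: real^2. Complex (x $ 1) (x $ 2)) -` box l u = box ?l ?u"
    by (auto simp: mem_box_cart forall_2 in_box_complex_iff)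
  then have "emeasure (distr lborel borel (\<lambda>x :: real^2. Complex (x $ 1) (x $ 2))) (box l u)
      = emeasure lborel (box ?l ?u)"
    by (subst emeasure_distr) auto
  also have "\<dots> = ennreal (\<Prod>b\<in>Basis. (?u - ?l) \<bullet> b)"
    using le' proof (intro emeasure_lborel_box)
    have *: "?l $ i \<le> ?u $ i" for i :: 2
      using le' exhaust_2[of i] by auto
    fix b :: "real^2" assume "b \<in> Basis"
    then show "?l \<bullet> b \<le> ?u \<bullet> b"
      using * by (auto simp: Basis_vec_def inner_axis)
  qed
  also have "(\<Prod>b\<in>Basis. (?u - ?l) \<bullet> b) = (\<Prod>b\<in>Basis. (u - l) \<bullet> b)"
  proof -
    have B: "(Basis :: (real^2) set) = {axis 1 1, axis 2 1}"
      by (auto simp: Basis_vec_def) (metis exhaust_2)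
    have ne: "axis 1 1 \<noteq> (axis 2 1 :: real^2)"
      by (simp add: axis_eq_axis)
    show ?thesis
      unfolding B Basis_complex_def by (simp add: ne inner_axis inner_diff_left)
  qed
  finally show "emeasure (distr lborel borel (\<lambda>x :: real^2. Complex (x $ 1) (x $ 2))) (box l u)
      = ennreal (\<Prod>b\<in>Basis. (u - l) \<bullet> b)" .
qed simp

text \<open>In real coordinates multiplication by \<open>\<omega>\<close> is the rotation
  \<open>?R\<close> with inverse \<open>?R'\<close>. The preimage of a box is therefore an image
  under \<open>?R'\<close>, and orthogonal maps preserve the measure of images.\<close>

lemma lborel_distr_rotation:
  assumes "cmod \<omega> = 1"
  shows "distr lborel borel (\<lambda>z. \<omega> * z) = (lborel :: complex measure)"
proof (rule lborel_eqI[symmetric])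
  let ?T = "\<lambda>x :: real^2. Complex (x $ 1) (x $ 2)"
  have T: "?T \<in> borel_measurable borel"
    by (intro borel_measurable_continuous_onI) (simp add: Complex_eq, intro continuous_intros)
  fix l u :: complex
  assume le: "\<And>b. b \<in> Basis \<Longrightarrow> l \<bullet> b \<le> u \<bullet> b"
  let ?R = "\<lambda>x :: real^2. vector [Re \<omega> * x $ 1 - Im \<omega> * x $ 2, Re \<omega> * x $ 2 + Im \<omega> * x $ 1] :: real^2"
  let ?R' = "\<lambda>x :: real^2. vector [Re \<omega> * x $ 1 + Im \<omega> * x $ 2, Re \<omega> * x $ 2 - Im \<omega> * x $ 1] :: real^2"
  have om: "(Re \<omega>)\<^sup>2 + (Im \<omega>)\<^sup>2 = 1"
    using assms by (simp add: cmod_power2[symmetric])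
  have TR: "\<omega> * ?T x = ?T (?R x)" for x
    by (simp add: complex_eq_iff)
  have lin: "linear ?R'"
    by (rule linearI) (simp_all add: vec_eq_iff forall_2 algebra_simps)
  have orth: "orthogonal_transformation ?R'"
    unfolding orthogonal_transformation
  proof (intro conjI allI lin)
    fix v :: "real^2"
    have "(norm (?R' v))\<^sup>2 = ((Re \<omega>)\<^sup>2 + (Im \<omega>)\<^sup>2) * ((v $ 1)\<^sup>2 + (v $ 2)\<^sup>2)"
      unfolding norm_vec_def L2_set_def sum_2
      by (subst real_sqrt_pow2) (simp, simp add: power2_eq_square algebra_simps)
    also have "\<dots> = (norm v)\<^sup>2"
      unfolding om norm_vec_def L2_set_def sum_2 by (simp add: sum_nonneg)
    finally show "norm (?R' v) = norm v"
      using power2_eq_iff_nonneg[of "norm (?R' v)" "norm v"] by simp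
  qed
  have RR': "?R' (?R x) = x" "?R (?R' x) = x" for x
  proof -
    have *: "Re \<omega> * (Re \<omega> * a) + Im \<omega> * (Im \<omega> * a) = a" for a
      using om by (metis distrib_right mult.assoc mult_1 power2_eq_square)
    show "?R' (?R x) = x" "?R (?R' x) = x"
      using *[of "x$1"] *[of "x$2"] by (simp_all add: vec_eq_iff forall_2 algebra_simps)
  qed
  have [measurable]: "(\<lambda>z. \<omega> * z) \<in> borel_measurable borel" by simp
  let ?S = "?T -` box l u"
  have S: "?S \<in> sets borel" using T measurable_sets[of ?T borel borel "box l u"] by simp
  have pre: "?T -` ((\<lambda>z. \<omega> * z) -` box l u) = ?R' ` ?S"
  proof (intro set_eqI iffI)
    fix x assume "x \<in> ?T -` ((\<lambda>z. \<omega> * z) -` box l u)"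
    then have "?R x \<in> ?S" by (simp only: vimage_eq TR)
    then show "x \<in> ?R' ` ?S" using RR'(1)[of x, symmetric] by (rule image_eqI[rotated])
  next
    fix x assume "x \<in> ?R' ` ?S"
    then obtain y where "y \<in> ?S" "x = ?R' y" by blast
    then show "x \<in> ?T -` ((\<lambda>z. \<omega> * z) -` box l u)" by (simp only: vimage_eq TR RR')
  qed
  have preb: "(\<lambda>z. \<omega> * z) -` box l u \<in> sets borel"
    using measurable_sets[of "\<lambda>z. \<omega> * z" borel borel "box l u"] by simp
  then have "?T -` ((\<lambda>z. \<omega> * z) -` box l u) \<in> sets borel"
    using T measurable_sets[of ?T borel borel] by simp
  then have imb: "?R' ` ?S \<in> sets borel" unfolding pre .
  have ebox: "emeasure lborel (box l u) = emeasure lborel ?S"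
    by (subst lborel_complex_eq_distr, subst emeasure_distr) (use T in auto)
  then have "emeasure lborel ?S < \<infinity>"
    using emeasure_lborel_box_finite by (metis infinity_ennreal_def)
  then have lm: "?S \<in> lmeasurable"
    using S by (simp add: fmeasurable_def)
  have "emeasure (distr lborel borel (\<lambda>z. \<omega> * z)) (box l u)
      = emeasure lborel ((\<lambda>z. \<omega> * z) -` box l u)"
    by (subst emeasure_distr) auto
  also have "\<dots> = emeasure lborel (?R' ` ?S)"
    by (subst lborel_complex_eq_distr, subst emeasure_distr) (use T preb pre in auto)
  also have "\<dots> = emeasure lebesgue (?R' ` ?S)" using imb by simp
  also have "\<dots> = ennreal (measure lebesgue (?R' ` ?S))"
    using measurable_orthogonal_image[OF orth lm] by (simp add: emeasure_eq_measure2 fmeasurableD2)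
  also have "\<dots> = ennreal (measure lebesgue ?S)"
    by (simp only: measure_orthogonal_image[OF orth lm])
  also have "\<dots> = emeasure lborel ?S"
    using emeasure_eq_measure2[OF lm] S by simp
  also have "\<dots> = ennreal (\<Prod>b\<in>Basis. (u - l) \<bullet> b)"
    unfolding ebox[symmetric] using le by (simp add: emeasure_lborel_box)
  finally show "emeasure (distr lborel borel (\<lambda>z. \<omega> * z)) (box l u)
      = ennreal (\<Prod>b\<in>Basis. (u - l) \<bullet> b)" .
qed simp

lemma emeasure_ball_complex:
  "r \<ge> 0 \<Longrightarrow> emeasure lborel (ball c r :: complex set) = ennreal (pi * r\<^sup>2)"
  by (simp add: emeasure_ball eval_unit_ball_vol)

text \<open>Rotations take the place of polar coordinates. For each \<open>w\<close> the mean of |f|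
  over the circle around \<open>c\<close> through \<open>c + w\<close> dominates |f(c)|; integrating
  over \<open>w\<close> and exchanging the order by Tonelli leaves, for each angle, an integral that
  rotation invariance makes independent of the angle.\<close>

lemma ball_sub_mean_value:
  assumes "f holomorphic_on cball c r" "r > 0"
  shows "ennreal (cmod (f c)) * ennreal (pi * r\<^sup>2) \<le> (\<integral>\<^sup>+z\<in>ball c r. ennreal (cmod (f z)) \<partial>lborel)"
proof -
  define e where "e t = exp (2 * of_real pi * \<i> * of_real t)" for t :: real
  have norm_e: "cmod (e t) = 1" for t
    by (simp add: e_def)
  \<comment> \<open>Extended by zero beyond the disc, so that the invariance of
    \<open>lborel\<close> on the whole plane applies.\<close>
  define F where "F z = ennreal (cmod (indicator (ball c r) z *\<^sub>R f z))" for z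
  have F_eq: "F z = ennreal (cmod (f z)) * indicator (ball c r) z" for z
    by (simp add: F_def indicator_def)
  have [measurable]: "F \<in> borel_measurable borel"
    unfolding F_def
  proof -
    have "(\<lambda>z. indicator (ball c r) z *\<^sub>R f z) \<in> borel_measurable borel"
      using assms by (intro borel_measurable_continuous_on_indicator
          holomorphic_on_imp_continuous_on[OF holomorphic_on_subset[OF assms(1) ball_subset_cball]]) simp
    then show "(\<lambda>z. ennreal (cmod (indicator (ball c r) z *\<^sub>R f z))) \<in> borel_measurable borel"
      by measurable
  qed
  have [measurable]: "e \<in> borel_measurable borel"
    unfolding e_def by (intro borel_measurable_continuous_onI continuous_intros)
  have circle: "ennreal (cmod (f c)) \<le> (\<integral>\<^sup>+t. F (c + e t * w) * indicator {0..1} t \<partial>lborel)"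
    if w: "w \<in> ball 0 r" for w
  proof -
    have sub: "c + w * \<zeta> \<in> ball c r" if "cmod \<zeta> \<le> 1" for \<zeta>
      using w that by (simp add: dist_norm norm_mult) (meson le_less_trans mult_left_le norm_ge_zero)
    have hol: "(\<lambda>\<zeta>. f (c + w * \<zeta>)) holomorphic_on cball 0 1"
      by (rule holomorphic_on_compose_gen[OF _ assms(1), unfolded o_def])
        (use sub in \<open>auto intro!: holomorphic_intros simp: less_imp_le\<close>)
    have cont: "continuous_on {0..1} (\<lambda>t. f (c + w * e t))"
      by (rule continuous_on_compose2[OF holomorphic_on_imp_continuous_on[OF hol]])
        (auto simp: norm_e e_def intro!: continuous_intros)
    have int: "((\<lambda>t. f (c + w * e t)) has_integral f c) {0..1}"
      using circle_mean_value[OF hol] by (simp add: e_def)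
    have "cmod (f c) \<le> integral {0..1} (\<lambda>t. cmod (f (c + w * e t)))"
      unfolding integral_unique[OF int, symmetric]
      by (rule integral_norm_bound_integral)
        (auto intro!: integrable_continuous_interval continuous_intros cont)
    also have "ennreal \<dots> = (\<integral>\<^sup>+t. ennreal (cmod (f (c + w * e t))) * indicator {0..1} t \<partial>lborel)"
      by (rule nn_integral_has_integral_lebesgue'[symmetric]) 
        (auto intro!: integrable_continuous_interval integrable_integral continuous_intros cont)
    also have "\<dots> = (\<integral>\<^sup>+t. F (c + e t * w) * indicator {0..1} t \<partial>lborel)"
      using sub[of "e _"] by (intro nn_integral_cong) (simp add: F_eq norm_e mult.commute[of "e _"])
    finally show ?thesis by (simp add: ennreal_leI)
  qed
  have rot: "(\<integral>\<^sup>+w. F (c + e t * w) \<partial>lborel) = (\<integral>\<^sup>+z. F z \<partial>lborel)" for t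
  proof -
    have "(\<integral>\<^sup>+z. F z \<partial>lborel) = (\<integral>\<^sup>+z. F z \<partial>distr lborel borel ((+) c))"
      by (simp add: lborel_distr_plus)
    also have "\<dots> = (\<integral>\<^sup>+z. F (c + z) \<partial>lborel)"
      by (subst nn_integral_distr) auto
    also have "\<dots> = (\<integral>\<^sup>+z. F (c + z) \<partial>distr lborel borel (\<lambda>z. e t * z))"
      by (simp add: lborel_distr_rotation norm_e)
    also have "\<dots> = (\<integral>\<^sup>+w. F (c + e t * w) \<partial>lborel)"
      by (subst nn_integral_distr) auto
    finally show ?thesis ..
  qed
  have "ennreal (cmod (f c)) * ennreal (pi * r\<^sup>2)
      = (\<integral>\<^sup>+w. ennreal (cmod (f c)) * indicator (ball 0 r) w \<partial>(lborel :: complex measure))"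
    using assms(2) by (simp add: nn_integral_cmult_indicator emeasure_ball_complex)
  also have "\<dots> \<le> (\<integral>\<^sup>+w. (\<integral>\<^sup>+t. F (c + e t * w) * indicator {0..1} t \<partial>lborel) \<partial>lborel)"
    using circle by (intro nn_integral_mono) (auto simp: indicator_def)
  also have "\<dots> = (\<integral>\<^sup>+t. (\<integral>\<^sup>+w. F (c + e t * w) * indicator {0..1} t \<partial>lborel) \<partial>lborel)"
    by (intro pair_sigma_finite.Fubini'[symmetric] pair_sigma_finite.intro sigma_finite_lborel) simp
  also have "\<dots> = (\<integral>\<^sup>+t. (\<integral>\<^sup>+z. F z \<partial>lborel) * indicator {0..1} t \<partial>(lborel :: real measure))"
    by (intro nn_integral_cong) (simp add: nn_integral_multc rot)
  also have "\<dots> = (\<integral>\<^sup>+z. F z \<partial>lborel)"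
    by (simp add: nn_integral_cmult_indicator)
  finally show ?thesis by (simp add: F_eq)
qed

section \<open>Discs and normalised area\<close>

lemma ball_subset_unit_disc:
  assumes "cmod z + r \<le> 1"
  shows "ball z r \<subseteq> unit_disc"
proof
  fix w assume "w \<in> ball z r"
  then show "w \<in> unit_disc"
    using norm_triangle_ineq[of "w - z" z] assms by (simp add: dist_norm norm_minus_commute)
qed

lemma cball_subset_unit_disc:
  assumes "cmod z + r < 1"
  shows "cball z r \<subseteq> unit_disc"
proof
  fix w assume "w \<in> cball z r"
  then show "w \<in> unit_disc"
    using norm_triangle_ineq[of "w - z" z] assms by (simp add: dist_norm norm_minus_commute)
qed

lemma space_dA [simp]: "space dA = unit_disc"
  by (simp add: dA_def space_scale_measure)

lemma sets_dA: "sets dA = sets (lebesgue_on unit_disc)"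
  by (simp add: dA_def)

lemma borel_imp_sets_dA [measurable]: "B \<in> sets borel \<Longrightarrow> B \<inter> unit_disc \<in> sets dA"
  by (auto simp: sets_dA sets_restrict_space)

lemma measurable_dA_ident [measurable]: "(\<lambda>z. z) \<in> measurable dA borel"
proof (rule measurableI)
  fix A :: "complex set" assume "A \<in> sets borel"
  then show "(\<lambda>z. z) -` A \<inter> space dA \<in> sets dA"
    using borel_imp_sets_dA by simp
qed simp

lemma borel_measurable_dA: "f \<in> measurable borel N \<Longrightarrow> f \<in> measurable dA N"
  using measurable_compose[OF measurable_dA_ident] .

lemma holomorphic_measurable_dA: "f holomorphic_on unit_disc \<Longrightarrow> f \<in> borel_measurable dA"
  using continuous_imp_measurable_on_sets_lebesgue[of unit_disc f]
  by (simp add: measurable_cong_sets[OF sets_dA refl] holomorphic_on_imp_continuous_on)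

lemma nn_integral_dA:
  assumes [measurable]: "F \<in> borel_measurable borel"
  shows "(\<integral>\<^sup>+z. F z \<partial>dA) = ennreal (1 / pi) * (\<integral>\<^sup>+z\<in>unit_disc. F z \<partial>lborel)"
proof -
  have "F \<in> borel_measurable (lebesgue_on unit_disc)"
    using borel_measurable_dA[OF assms] by (simp add: measurable_cong_sets[OF sets_dA refl])
  then show ?thesis
    by (simp add: dA_def nn_integral_scale_measure nn_integral_restrict_space nn_integral_completion)
qed

lemma emeasure_dA:
  assumes [measurable]: "B \<in> sets borel"
  shows "emeasure dA (B \<inter> unit_disc) = ennreal (1 / pi) * emeasure lborel (B \<inter> unit_disc)"
proof -
  have "emeasure dA (B \<inter> unit_disc) = (\<integral>\<^sup>+z. indicator B z \<partial>dA)"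
  proof -
    have "(\<integral>\<^sup>+z. indicator B z \<partial>dA) = (\<integral>\<^sup>+z. indicator (B \<inter> unit_disc) z \<partial>dA)"
      by (intro nn_integral_cong) (auto simp: indicator_def)
    then show ?thesis using borel_imp_sets_dA[OF assms] by simp
  qed
  also have "\<dots> = ennreal (1 / pi) * emeasure lborel (B \<inter> unit_disc)"
    by (subst nn_integral_dA) (auto simp: indicator_inter_arith[symmetric])
  finally show ?thesis .
qed

lemma emeasure_dA_ball:
  assumes "ball c r \<subseteq> unit_disc" "r \<ge> 0"
  shows "emeasure dA (ball c r) = ennreal (r\<^sup>2)"
proof -
  have "emeasure dA (ball c r) = ennreal (1 / pi) * ennreal (pi * r\<^sup>2)"
    using emeasure_dA[of "ball c r"] assms by (simp add: Int_absorb2 emeasure_ball_complex)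
  then show ?thesis by (simp add: ennreal_mult[symmetric])
qed

lemma emeasure_dA_ball_le:
  assumes "r \<ge> 0"
  shows "emeasure dA (ball c r \<inter> unit_disc) \<le> ennreal (r\<^sup>2)"
proof -
  have "emeasure dA (ball c r \<inter> unit_disc) \<le> ennreal (1 / pi) * emeasure lborel (ball c r)"
    by (subst emeasure_dA) (auto intro!: mult_left_mono emeasure_mono)
  also have "\<dots> = ennreal (r\<^sup>2)"
    using assms by (simp add: emeasure_ball_complex ennreal_mult[symmetric])
  finally show ?thesis .
qed

lemma emeasure_dA_disc: "emeasure dA unit_disc = 1"
  using emeasure_dA_ball[of 0 1] by simp

lemma finite_measure_dA: "finite_measure dA"
  by standard (simp add: emeasure_dA_disc)

lemma sub_mean_value_dA:
  assumes "f holomorphic_on unit_disc" "cball c r \<subseteq> unit_disc" "r > 0"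
  shows "ennreal (cmod (f c)) * ennreal (r\<^sup>2) \<le> (\<integral>\<^sup>+z\<in>ball c r. ennreal (cmod (f z)) \<partial>dA)"
proof -
  let ?F = "\<lambda>z. ennreal (cmod (indicator (ball c r) z *\<^sub>R f z))"
  have hol: "f holomorphic_on cball c r"
    using assms holomorphic_on_subset by blast
  have "(\<lambda>z. indicator (ball c r) z *\<^sub>R f z) \<in> borel_measurable borel"
    by (intro borel_measurable_continuous_on_indicator
        holomorphic_on_imp_continuous_on[OF holomorphic_on_subset[OF hol ball_subset_cball]]) simp
  then have F: "?F \<in> borel_measurable borel"
    by measurable
  have "ennreal (cmod (f c)) * ennreal (r\<^sup>2)
      = ennreal (1 / pi) * (ennreal (cmod (f c)) * ennreal (pi * r\<^sup>2))"
    by (simp add: ennreal_mult[symmetric])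
  also have "\<dots> \<le> ennreal (1 / pi) * (\<integral>\<^sup>+z\<in>ball c r. ennreal (cmod (f z)) \<partial>lborel)"
    by (intro mult_left_mono ball_sub_mean_value hol assms) simp
  also have "(\<integral>\<^sup>+z\<in>ball c r. ennreal (cmod (f z)) \<partial>lborel) = (\<integral>\<^sup>+z\<in>unit_disc. ?F z \<partial>lborel)"
    using subsetD[OF assms(2)] by (intro nn_integral_cong) (force simp: indicator_def less_imp_le)
  also have "ennreal (1 / pi) * \<dots> = (\<integral>\<^sup>+z. ?F z \<partial>dA)"
    by (rule nn_integral_dA[OF F, symmetric])
  also have "\<dots> = (\<integral>\<^sup>+z\<in>ball c r. ennreal (cmod (f z)) \<partial>dA)"
    by (intro nn_integral_cong) (auto simp: indicator_def)
  finally show ?thesis .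
qed

section \<open>Carleson boxes compared with discs centred on the circle\<close>

lemma cis_minus_one_le: "cmod (cis t - 1) \<le> \<bar>t\<bar>"
  using dist_exp_i_1[of t] abs_sin_x_le_abs_x[of "t / 2"] by (simp add: cis_conv_exp mult.commute)

text \<open>The arc of half length \<open>pi * s\<close> gives a box of height \<open>s\<close>. Its
  points lie within \<open>s\<close> of the arc radially, and the arc lies within
  \<open>pi * s\<close> of \<open>cis t0\<close>; \<open>pi < 4\<close> gives the factor 5.\<close>

lemma carleson_box_subset_ball:
  assumes "0 < s" "s \<le> 1"
  shows "carleson_box (cis ` {t0 - pi * s..t0 + pi * s}) (2 * pi * s) \<subseteq> ball (cis t0) (5 * s) \<inter> unit_disc"
proof
  fix z assume "z \<in> carleson_box (cis ` {t0 - pi * s..t0 + pi * s}) (2 * pi * s)"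
  then obtain \<rho> t where z: "z = of_real \<rho> * cis t" and t: "\<bar>t - t0\<bar> \<le> pi * s"
    and \<rho>: "1 - s \<le> \<rho>" "\<rho> < 1"
    unfolding carleson_box_def using assms by (auto simp: abs_le_iff)
  have "cmod (cis t - cis t0) = cmod (cis t0 * (cis (t - t0) - 1))"
    by (simp add: algebra_simps cis_mult)
  also have "\<dots> \<le> pi * s"
    using cis_minus_one_le[of "t - t0"] t by (simp add: norm_mult)
  finally have 1: "cmod (cis t - cis t0) \<le> pi * s" .
  have "z - cis t = - (of_real (1 - \<rho>) * cis t)"
    by (simp add: z algebra_simps)
  then have "cmod (z - cis t) = 1 - \<rho>"
    using \<rho> by (simp add: norm_mult del: of_real_diff)
  then have "cmod (z - cis t0) \<le> s + pi * s"
    using norm_triangle_ineq[of "z - cis t" "cis t - cis t0"] 1 \<rho> by simp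
  also have "\<dots> < s + 4 * s"
    using pi_less_4 assms by simp
  finally have "z \<in> ball (cis t0) (5 * s)"
    by (simp add: dist_norm norm_minus_commute)
  moreover have "z \<in> unit_disc"
    using \<rho> assms by (simp add: z norm_mult)
  ultimately show "z \<in> ball (cis t0) (5 * s) \<inter> unit_disc" by simp
qed

text \<open>Radial projection to the circle at most doubles the distance to \<open>cis t0\<close>,
  and the principal logarithm at most doubles it once more. The angle thus differs from
  \<open>t0\<close> by less than \<open>s\<close>, which is where the factor 4 comes from.\<close>

lemma ball_subset_carleson_box:
  assumes "0 < s" "s \<le> 1"
  shows "ball (cis t0) (s / 4) \<inter> unit_disc \<subseteq> carleson_box (cis ` {t0 - pi * s..t0 + pi * s}) (2 * pi * s)"
proof
  fix z assume "z \<in> ball (cis t0) (s / 4) \<inter> unit_disc"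
  then have z: "cmod (z - cis t0) < s / 4" "cmod z < 1"
    by (auto simp: dist_norm norm_minus_commute)
  have low: "cmod z \<ge> 1 - cmod (z - cis t0)"
    using norm_triangle_ineq2[of "cis t0" "z"] by (simp add: norm_minus_commute)
  then have z0: "cmod z > 0" using z assms by linarith
  \<comment> \<open>The radial projection of \<open>z\<close>, rotated so that \<open>cis t0\<close>
    becomes 1: close to 1 the principal logarithm is controlled.\<close>
  define w where "w = sgn z * cis (- t0)"
  have sgn: "sgn z = z / of_real (cmod z)" by (simp add: sgn_eq)
  have nw: "cmod w = 1" using z0 by (simp add: w_def norm_mult norm_sgn)
  have "cmod (sgn z - z) = 1 - cmod z"
  proof -
    have "sgn z - z = of_real (1 - cmod z) * sgn z"
      using z0 by (simp add: sgn field_simps)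
    then show ?thesis using z z0 by (simp add: norm_mult norm_sgn del: of_real_diff)
  qed
  then have "cmod (sgn z - cis t0) \<le> 2 * cmod (z - cis t0)"
    using norm_triangle_ineq[of "sgn z - z" "z - cis t0"] low by simp
  moreover have "w - 1 = cis (- t0) * (sgn z - cis t0)"
    by (simp add: w_def algebra_simps cis_mult)
  ultimately have w1: "cmod (w - 1) \<le> 2 * cmod (z - cis t0)"
    by (simp add: norm_mult)
  then have "cmod (w - 1) < 1 / 2" using z assms by linarith
  from norm_Ln_le[OF this] have "cmod (Ln w) \<le> 2 * cmod (w - 1)" by simp
  then have "\<bar>Im (Ln w)\<bar> \<le> 4 * cmod (z - cis t0)"
    using abs_Im_le_cmod[of "Ln w"] w1 by linarith
  also have "\<dots> < 1 * s" using z by simp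
  also have "\<dots> \<le> pi * s" using assms pi_gt3 by (intro mult_right_mono) auto
  finally have Im: "\<bar>Im (Ln w)\<bar> < pi * s" .
  have "w = cis (Im (Ln w))"
  proof -
    have "w = exp (Ln w)" using nw by (subst exp_Ln) auto
    also have "\<dots> = cis (Im (Ln w))" 
    proof (subst exp_eq_polar)
      have "w \<noteq> 0" using nw by auto
      then show "of_real (exp (Re (Ln w))) * cis (Im (Ln w)) = cis (Im (Ln w))"
        using nw by simp
    qed
    finally show ?thesis .
  qed
  then have "cis t0 * w = cis t0 * cis (Im (Ln w))"
    by (rule arg_cong)
  also have "\<dots> = cis (t0 + Im (Ln w))"
    by (rule cis_mult)
  finally have "cis t0 * w = cis (t0 + Im (Ln w))" .
  moreover have "cis t0 * w = sgn z"
    by (simp add: w_def cis_mult mult.left_commute)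
  ultimately have "sgn z = cis (t0 + Im (Ln w))" by simp
  moreover have "z = of_real (cmod z) * sgn z" using z0 by (simp add: sgn)
  ultimately have "z = of_real (cmod z) * cis (t0 + Im (Ln w))" by simp
  moreover have "t0 + Im (Ln w) \<in> {t0 - pi * s..t0 + pi * s}" using Im by auto
  moreover have "1 - 2 * pi * s / (2 * pi) \<le> cmod z" using low z assms by simp
  ultimately show "z \<in> carleson_box (cis ` {t0 - pi * s..t0 + pi * s}) (2 * pi * s)"
    unfolding carleson_box_def using z by blast
qed

text \<open>The case \<open>s = 1\<close>, in which the box has height 1. For it condition B2 bounds
  the product of the total masses of u and 1/u.\<close>

lemma carleson_box_full: "carleson_box (cis ` {t0 - pi..t0 + pi}) (2 * pi) = unit_disc"
proof (intro set_eqI iffI)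
  fix z assume "z \<in> unit_disc"
  define t where "t = Arg (z * cis (- t0))"
  have "z * cis (- t0) = of_real (cmod z) * cis t"
    unfolding t_def using Arg_eq[of "z * cis (- t0)"]
    by (cases "z = 0") (auto simp: cis_conv_exp norm_mult)
  then have "z * cis (- t0) * cis t0 = of_real (cmod z) * cis (t0 + t)"
    by (simp add: cis_mult mult.assoc add.commute)
  then have "z = of_real (cmod z) * cis (t0 + t)"
    by (simp add: cis_mult mult.assoc)
  moreover have "t0 + t \<in> {t0 - pi..t0 + pi}"
    using Arg_bounded[of "z * cis (- t0)"] by (auto simp: t_def)
  ultimately show "z \<in> carleson_box (cis ` {t0 - pi..t0 + pi}) (2 * pi)"
    unfolding carleson_box_def using \<open>z \<in> unit_disc\<close> by (auto intro!: exI[of _ "cmod z"])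
qed (auto simp: carleson_box_def norm_mult)

section \<open>Bekolle-Bonami weights\<close>

locale B2_weight =
  fixes u :: "complex \<Rightarrow> real"
  assumes weight: "weight u" and B2: "B2_condition u"
begin

definition \<mu> :: "complex measure" where
  "\<mu> = density dA (\<lambda>z. ennreal (u z))"

definition \<sigma> :: "complex measure" where
  "\<sigma> = density dA (\<lambda>z. ennreal (1 / u z))"

lemma u_measurable [measurable]: "u \<in> borel_measurable dA"
  using weight by (auto simp: weight_def)

lemma sets_\<mu> [measurable_cong]: "sets \<mu> = sets dA"
  and space_\<mu> [simp]: "space \<mu> = unit_disc"
  and sets_\<sigma> [measurable_cong]: "sets \<sigma> = sets dA"
  and space_\<sigma> [simp]: "space \<sigma> = unit_disc"
  by (simp_all add: \<mu>_def \<sigma>_def)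

lemma AE_u_pos: "AE z in dA. 0 < u z"
  using weight by (simp add: weight_def)

lemma nn_integral_\<mu>:
  "F \<in> borel_measurable dA \<Longrightarrow> (\<integral>\<^sup>+z. F z \<partial>\<mu>) = (\<integral>\<^sup>+z. ennreal (u z) * F z \<partial>dA)"
  unfolding \<mu>_def by (rule nn_integral_density) simp_all

text \<open>Cauchy-Schwarz for the factorisation of \<open>g\<close> into \<open>g * sqrt u\<close>
  and \<open>1 / sqrt u\<close>; this is how \<open>\<sigma>\<close> enters as the dual
  weight.\<close>

lemma weighted_Cauchy_Schwarz:
  assumes [measurable]: "g \<in> borel_measurable dA" "E \<in> sets dA"
    and nonneg: "\<And>z. 0 \<le> g z"
  shows "(\<integral>\<^sup>+z\<in>E. ennreal (g z) \<partial>dA)\<^sup>2 \<le> (\<integral>\<^sup>+z\<in>E. ennreal ((g z)\<^sup>2) \<partial>\<mu>) * emeasure \<sigma> E"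
proof -
  let ?f = "\<lambda>z. ennreal (g z * sqrt (u z)) * indicator E z" and ?h = "\<lambda>z. ennreal (sqrt (1 / u z)) * indicator E z"
  have "(\<integral>\<^sup>+z\<in>E. ennreal (g z) \<partial>dA) = (\<integral>\<^sup>+z. ?f z * ?h z \<partial>dA)"
    by (rule nn_integral_cong_AE, use AE_u_pos in eventually_elim)
      (use nonneg in \<open>auto simp: indicator_def ennreal_mult[symmetric] real_sqrt_divide\<close>)
  also have "\<dots>\<^sup>2 \<le> (\<integral>\<^sup>+z. (?f z)\<^sup>2 \<partial>dA) * (\<integral>\<^sup>+z. (?h z)\<^sup>2 \<partial>dA)"
    by (rule Cauchy_Schwarz_nn_integral) simp_all
  also have "(\<integral>\<^sup>+z. (?f z)\<^sup>2 \<partial>dA) = (\<integral>\<^sup>+z. ennreal (u z) * (ennreal ((g z)\<^sup>2) * indicator E z) \<partial>dA)"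
    by (rule nn_integral_cong_AE, use AE_u_pos in eventually_elim)
      (use nonneg in \<open>auto simp: indicator_def ennreal_mult[symmetric] ennreal_power power_mult_distrib mult.commute\<close>)
  also have "\<dots> = (\<integral>\<^sup>+z\<in>E. ennreal ((g z)\<^sup>2) \<partial>\<mu>)"
    by (subst nn_integral_\<mu>) simp_all
  also have "(\<integral>\<^sup>+z. (?h z)\<^sup>2 \<partial>dA) = (\<integral>\<^sup>+z\<in>E. ennreal (1 / u z) \<partial>dA)"
    by (rule nn_integral_cong_AE, use AE_u_pos in eventually_elim)
      (auto simp: indicator_def ennreal_power real_sqrt_divide power_divide)
  also have "\<dots> = emeasure \<sigma> E"
    by (simp add: \<sigma>_def emeasure_density)
  finally show ?thesis .
qed

text \<open>The converse of the inequality in B2, valid on every measurable set: B2 says that on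
  boxes it is sharp up to a constant.\<close>

lemma area_Cauchy_Schwarz:
  assumes [measurable]: "E \<in> sets dA"
  shows "(emeasure dA E)\<^sup>2 \<le> emeasure \<mu> E * emeasure \<sigma> E"
  using weighted_Cauchy_Schwarz[of "\<lambda>_. 1" E] by (simp add: sets_\<mu>)

text \<open>Carleson boxes enter only through measurable sets below and above them, so they need not be shown to be
  measurable themselves.\<close>

lemma B2_between:
  obtains C where "C > 0"
    "\<And>t0 s E F. \<lbrakk>0 < s; s \<le> 1; E \<in> sets dA; F \<in> sets dA;
        E \<subseteq> carleson_box (cis ` {t0 - pi * s..t0 + pi * s}) (2 * pi * s);
        carleson_box (cis ` {t0 - pi * s..t0 + pi * s}) (2 * pi * s) \<subseteq> F\<rbrakk>
      \<Longrightarrow> emeasure \<mu> E * emeasure \<sigma> E \<le> ennreal C * (emeasure dA F)\<^sup>2"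
proof -
  obtain C where C: "C > 0" and box: "\<And>J. is_interval J \<Longrightarrow> 0 < measure lborel J \<Longrightarrow> measure lborel J \<le> 2 * pi \<Longrightarrow>
      1 / (emeasure dA (carleson_box (cis ` J) (measure lborel J)))\<^sup>2
        * (\<integral>\<^sup>+z\<in>carleson_box (cis ` J) (measure lborel J). ennreal (u z) \<partial>dA)
        * (\<integral>\<^sup>+z\<in>carleson_box (cis ` J) (measure lborel J). ennreal (1 / u z) \<partial>dA) \<le> ennreal C"
    using B2 unfolding B2_condition_def Let_def by blast
  have "emeasure \<mu> E * emeasure \<sigma> E \<le> ennreal C * (emeasure dA F)\<^sup>2"
    if s: "0 < s" "s \<le> 1" and [measurable]: "E \<in> sets dA" "F \<in> sets dA"
    and E: "E \<subseteq> carleson_box (cis ` {t0 - pi * s..t0 + pi * s}) (2 * pi * s)"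
    and F: "carleson_box (cis ` {t0 - pi * s..t0 + pi * s}) (2 * pi * s) \<subseteq> F" for t0 s E F
  proof -
    define S where "S = carleson_box (cis ` {t0 - pi * s..t0 + pi * s}) (2 * pi * s)"
    define a where "a = (emeasure dA S)\<^sup>2"
    have meas: "measure lborel {t0 - pi * s..t0 + pi * s} = 2 * pi * s"
      using s by simp
    have "0 < measure lborel {t0 - pi * s..t0 + pi * s}"
      unfolding meas using s by simp
    moreover have "measure lborel {t0 - pi * s..t0 + pi * s} \<le> 2 * pi"
      unfolding meas using s by simp
    ultimately have
      "1 / a * (\<integral>\<^sup>+z\<in>S. ennreal (u z) \<partial>dA) * (\<integral>\<^sup>+z\<in>S. ennreal (1 / u z) \<partial>dA) \<le> ennreal C"
      using box[OF is_interval_cc, of "t0 - pi * s" "t0 + pi * s"] unfolding a_def S_def meas by blast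
    moreover have "emeasure \<mu> E \<le> (\<integral>\<^sup>+z\<in>S. ennreal (u z) \<partial>dA)"
      using E by (auto simp: \<mu>_def emeasure_density S_def indicator_def intro!: nn_integral_mono)
    moreover have "emeasure \<sigma> E \<le> (\<integral>\<^sup>+z\<in>S. ennreal (1 / u z) \<partial>dA)"
      using E by (auto simp: \<sigma>_def emeasure_density S_def indicator_def intro!: nn_integral_mono)
    ultimately have le: "1 / a * (emeasure \<mu> E * emeasure \<sigma> E) \<le> ennreal C"
      unfolding mult.assoc by (blast intro: order.trans mult_left_mono mult_mono zero_le)
    have "emeasure dA S \<le> emeasure dA F"
      unfolding S_def using F by (rule emeasure_mono) simp
    then have aF: "a \<le> (emeasure dA F)\<^sup>2"
      unfolding a_def by (intro power_mono) auto
    moreover have "emeasure dA F < top"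
      using finite_measure.emeasure_finite[OF finite_measure_dA, of F] by (simp add: less_top)
    ultimately have a: "a < top"
      by (auto simp: power_less_top_ennreal elim: le_less_trans)
    have "emeasure \<mu> E * emeasure \<sigma> E \<le> ennreal C * a"
    proof (cases "a = 0")
      \<comment> \<open>\<open>1 / 0\<close> is \<open>top\<close> in \<open>ennreal\<close>, so the
        bound forces the product to vanish. A box outside the sigma-algebra would have measure 0 by
        default and fall under this case.\<close>
      case True
      then have "top * (emeasure \<mu> E * emeasure \<sigma> E) \<le> ennreal C"
        using le by simp
      then have "emeasure \<mu> E * emeasure \<sigma> E = 0"
        by (metis ennreal_less_top ennreal_top_mult leD)
      then show ?thesis by auto
    next
      case False
      have "emeasure \<mu> E * emeasure \<sigma> E = a * (1 / a * (emeasure \<mu> E * emeasure \<sigma> E))"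
        using False a by (simp add: mult.assoc[symmetric] ennreal_times_divide)
      also have "\<dots> \<le> a * ennreal C"
        using le by (rule mult_left_mono) simp
      finally show ?thesis by (simp add: mult.commute)
    qed
    also have "\<dots> \<le> ennreal C * (emeasure dA F)\<^sup>2"
      using aF by (rule mult_left_mono) simp
    finally show ?thesis .
  qed
  with C show ?thesis using that by blast
qed

lemma finite_measure_\<mu>: "finite_measure \<mu>"
proof
  have "emeasure \<mu> (space \<mu>) = (\<integral>\<^sup>+z. ennreal (u z) \<partial>dA)"
  proof -
    have "unit_disc \<in> sets dA" using sets.top[of dA] by simp
    then show ?thesis
      by (simp add: \<mu>_def emeasure_density) (rule nn_integral_cong, simp)
  qed
  also have "\<dots> \<le> (\<integral>\<^sup>+z. ennreal (norm (u z)) \<partial>dA)"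
    by (intro nn_integral_mono) (auto intro!: ennreal_leI)
  also have "\<dots> < \<infinity>"
    using weight by (simp add: weight_def integrable_iff_bounded)
  finally show "emeasure \<mu> (space \<mu>) \<noteq> \<infinity>" by simp
qed

lemma emeasure_\<mu>_pos: 
  assumes [measurable]: "E \<in> sets dA" and "emeasure dA E \<noteq> 0"
  shows "emeasure \<mu> E \<noteq> 0"
proof
  assume "emeasure \<mu> E = 0"
  then have "AE z in dA. ennreal (u z) * indicator E z = 0"
    by (simp add: \<mu>_def emeasure_density nn_integral_0_iff_AE)
  with AE_u_pos have "AE z in dA. z \<notin> E"
    by eventually_elim (auto simp: indicator_def split: if_splits)
  then show False
    using assms(2) sets.sets_into_space[OF assms(1)] by (subst (asm) AE_iff_measurable[OF assms(1)]) auto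
qed

text \<open>The full arc has the whole disc as its box, and \<mu> has nonzero mass, so B2 leaves no
  room for \<sigma> to be infinite.\<close>

lemma finite_measure_\<sigma>: "finite_measure \<sigma>"
proof
  obtain C where C: "C > 0"
    "\<And>t0 s E F. \<lbrakk>0 < s; s \<le> 1; E \<in> sets dA; F \<in> sets dA;
        E \<subseteq> carleson_box (cis ` {t0 - pi * s..t0 + pi * s}) (2 * pi * s);
        carleson_box (cis ` {t0 - pi * s..t0 + pi * s}) (2 * pi * s) \<subseteq> F\<rbrakk>
      \<Longrightarrow> emeasure \<mu> E * emeasure \<sigma> E \<le> ennreal C * (emeasure dA F)\<^sup>2"
    using B2_between by blast
  have D: "unit_disc \<in> sets dA" using sets.top[of dA] by simp
  have "emeasure \<mu> unit_disc * emeasure \<sigma> unit_disc \<le> ennreal C"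
    using C(2)[of 1 unit_disc unit_disc 0] D carleson_box_full[of 0] by (simp add: emeasure_dA_disc)
  moreover have "emeasure \<mu> unit_disc \<noteq> 0"
    using emeasure_\<mu>_pos[OF D] by (simp add: emeasure_dA_disc)
  ultimately show "emeasure \<sigma> (space \<sigma>) \<noteq> \<infinity>"
    by (auto simp: ennreal_mult_top top_unique)
qed

sublocale M: finite_measure \<mu> by (rule finite_measure_\<mu>)
sublocale S: finite_measure \<sigma> by (rule finite_measure_\<sigma>)

lemma ball_sets [measurable]: "ball z r \<inter> unit_disc \<in> sets dA"
  by simp

lemma ball_sets_subset: "ball z r \<subseteq> unit_disc \<Longrightarrow> ball z r \<in> sets dA"
  using ball_sets[of z r] by (simp add: Int_absorb2)

text \<open>For \<open>s \<le> 1 / 4\<close> the box with parameter \<open>4 * s\<close> lies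
  between the discs of radius \<open>s\<close> and \<open>20 * s\<close>, and
  \<open>20 ^ 4 = 160000\<close>. For larger \<open>s\<close> the bound for the whole disc suffices,
  as \<open>s ^ 4\<close> is then bounded below.\<close>

lemma B2_ball:
  obtains C where "C \<ge> 1"
    "\<And>\<zeta> s. \<lbrakk>cmod \<zeta> = 1; s > 0\<rbrakk> \<Longrightarrow>
       measure \<mu> (ball \<zeta> s \<inter> unit_disc) * measure \<sigma> (ball \<zeta> s \<inter> unit_disc) \<le> C * s ^ 4"
proof -
  obtain C where C: "C > 0"
    "\<And>t0 s E F. \<lbrakk>0 < s; s \<le> 1; E \<in> sets dA; F \<in> sets dA;
        E \<subseteq> carleson_box (cis ` {t0 - pi * s..t0 + pi * s}) (2 * pi * s);
        carleson_box (cis ` {t0 - pi * s..t0 + pi * s}) (2 * pi * s) \<subseteq> F\<rbrakk>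
      \<Longrightarrow> emeasure \<mu> E * emeasure \<sigma> E \<le> ennreal C * (emeasure dA F)\<^sup>2"
    using B2_between by blast
  have D: "unit_disc \<in> sets dA" using sets.top[of dA] by simp
  have "measure \<mu> (ball \<zeta> s \<inter> unit_disc) * measure \<sigma> (ball \<zeta> s \<inter> unit_disc)
        \<le> (1 + 160000 * C) * s ^ 4" if \<zeta>: "cmod \<zeta> = 1" and s: "s > 0" for \<zeta> s
  proof -
    let ?E = "ball \<zeta> s \<inter> unit_disc"
    have "\<zeta> = cis (Arg \<zeta>)"
    proof -
      have "\<zeta> \<noteq> 0" using \<zeta> by auto
      then show ?thesis using cis_Arg[of \<zeta>] \<zeta> by (simp add: sgn_eq)
    qed
    then obtain t0 where t0: "\<zeta> = cis t0" ..
    have "emeasure \<mu> ?E * emeasure \<sigma> ?E \<le> ennreal (160000 * C * s ^ 4)"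
    proof (cases "s \<le> 1 / 4")
      case True
      let ?s = "4 * s"
      have "emeasure \<mu> ?E * emeasure \<sigma> ?E \<le> ennreal C * (emeasure dA (ball \<zeta> (20 * s) \<inter> unit_disc))\<^sup>2"
        using ball_subset_carleson_box[of ?s t0] carleson_box_subset_ball[of ?s t0] s True
        by (intro C(2)[of ?s _ _ t0]) (auto simp: t0)
      also have "\<dots> \<le> ennreal C * (ennreal ((20 * s)\<^sup>2))\<^sup>2"
        using s by (intro mult_left_mono power_mono emeasure_dA_ball_le) auto
      also have "\<dots> = ennreal (160000 * C * s ^ 4)"
        using C(1) s by (simp add: ennreal_power ennreal_mult[symmetric] power_mult_distrib mult_ac)
      finally show ?thesis .
    next
      case False
      have "emeasure \<mu> ?E * emeasure \<sigma> ?E \<le> emeasure \<mu> unit_disc * emeasure \<sigma> unit_disc"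
        using D by (intro mult_mono emeasure_mono) (auto simp: sets_\<mu> sets_\<sigma>)
      also have "\<dots> \<le> ennreal C"
        using C(2)[of 1 unit_disc unit_disc 0] D carleson_box_full[of 0] by (simp add: emeasure_dA_disc)
      also have "\<dots> \<le> ennreal (160000 * C * s ^ 4)"
      proof (rule ennreal_leI)
        have "(1 / 4) ^ 4 \<le> s ^ 4" using False by (intro power_mono) auto
        then show "C \<le> 160000 * C * s ^ 4" using C(1) by (simp add: power_divide)
      qed
      finally show ?thesis .
    qed
    then have "measure \<mu> ?E * measure \<sigma> ?E \<le> 160000 * C * s ^ 4"
      using C(1) s by (simp add: M.emeasure_eq_measure S.emeasure_eq_measure ennreal_mult[symmetric])
    also have "\<dots> \<le> (1 + 160000 * C) * s ^ 4"
      using s by (simp add: algebra_simps)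
    finally show ?thesis .
  qed
  then show ?thesis using that[of "1 + 160000 * C"] C(1) by simp
qed

end

section \<open>Upper bound for the norm of the test functions\<close>

lemma norm_one_minus_cnj_mult:
  assumes "cmod \<zeta> = 1" "a = of_real (cmod a) * \<zeta>"
  shows "cmod (1 - cnj a * z) = cmod (\<zeta> - of_real (cmod a) * z)"
proof -
  have "1 - cnj a * z = cnj \<zeta> * (\<zeta> - of_real (cmod a) * z)"
  proof -
    have 1: "cnj \<zeta> * \<zeta> = 1"
      using complex_norm_square[of \<zeta>] assms(1) by (simp add: mult.commute)
    have "cnj \<zeta> * (\<zeta> - of_real (cmod a) * z) = cnj \<zeta> * \<zeta> - of_real (cmod a) * cnj \<zeta> * z"
      by (simp add: algebra_simps)
    moreover have "cnj a = of_real (cmod a) * cnj \<zeta>"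
      by (subst assms(2)) simp
    ultimately show ?thesis by (simp add: 1)
  qed
  then show ?thesis using assms(1) by (simp add: norm_mult)
qed

lemma norm_one_minus_cnj_mult_ge: "cmod z \<le> 1 \<Longrightarrow> 1 - cmod a \<le> cmod (1 - cnj a * z)"
  using norm_triangle_ineq2[of 1 "cnj a * z"] mult_left_mono[of "cmod z" 1 "cmod a"]
  by (simp add: norm_mult)

lemma norm_B_fun: "(cmod (B_fun a z))\<^sup>2 = 1 / cmod (1 - cnj a * z) ^ 4"
  by (simp add: B_fun_def norm_divide norm_power power_divide flip: power_mult)

lemma B_fun_holomorphic: "cmod a < 1 \<Longrightarrow> B_fun a holomorphic_on unit_disc"
proof -
  assume "cmod a < 1"
  then have "1 - cnj a * z \<noteq> 0" if "z \<in> unit_disc" for z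
    using norm_one_minus_cnj_mult_ge[of z a] that by auto
  then show ?thesis
    unfolding B_fun_def[abs_def] by (intro holomorphic_intros) auto
qed

context B2_weight
begin

text \<open>A named bound, so that the constants derived from it can be tracked explicitly.\<close>

definition ball_bound :: "real \<Rightarrow> bool" where
  "ball_bound C \<longleftrightarrow> C \<ge> 1 \<and> (\<forall>\<zeta> s. cmod \<zeta> = 1 \<longrightarrow> s > 0 \<longrightarrow>
     measure \<mu> (ball \<zeta> s \<inter> unit_disc) * measure \<sigma> (ball \<zeta> s \<inter> unit_disc) \<le> C * s ^ 4)"

lemma ball_bound_exists: "\<exists>C. ball_bound C"
  unfolding ball_bound_def using B2_ball by metis

lemma ball_bound_ge_1: "ball_bound C \<Longrightarrow> C \<ge> 1"
  by (simp add: ball_bound_def)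

lemma ball_boundD:
  "\<lbrakk>ball_bound C; cmod \<zeta> = 1; s > 0\<rbrakk> \<Longrightarrow>
    measure \<mu> (ball \<zeta> s \<inter> unit_disc) * measure \<sigma> (ball \<zeta> s \<inter> unit_disc) \<le> C * s ^ 4"
  by (simp add: ball_bound_def)

text \<open>Between the discs of radius \<open>s\<close> and \<open>2 * s\<close> sits a disc of
  radius \<open>s / 2\<close> inside the unit disc. By \<open>area_Cauchy_Schwarz\<close> the
  product of its masses is at least \<open>s ^ 4 / 16\<close>, whereas the product for the large
  disc is at most \<open>16 * C * s ^ 4\<close>; the \<sigma>-mass of the inserted disc is thus at
  least the fraction \<open>1 / (256 * C)\<close> of that of the large one.\<close>

lemma reverse_doubling:
  assumes C: "ball_bound C" and \<zeta>: "cmod \<zeta> = 1" and s: "0 < s" "s \<le> 1"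
  shows "measure \<sigma> (ball \<zeta> s \<inter> unit_disc)
    \<le> (1 - 1 / (256 * C)) * measure \<sigma> (ball \<zeta> (2 * s) \<inter> unit_disc)"
proof -
  define c where "c = of_real (1 - 3 / 2 * s) * \<zeta>"
  define m where "m = measure \<mu> (ball \<zeta> (2 * s) \<inter> unit_disc)"
  define x where "x = measure \<sigma> (ball \<zeta> (2 * s) \<inter> unit_disc)"
  define y where "y = measure \<sigma> (ball \<zeta> s \<inter> unit_disc)"
  have "\<zeta> - c = of_real (3 / 2 * s) * \<zeta>"
    by (simp add: c_def algebra_simps)
  then have d: "dist \<zeta> c = 3 / 2 * s"
    using s \<zeta> unfolding dist_norm by (simp only: norm_mult norm_of_real)
  have "cmod c = \<bar>1 - 3 / 2 * s\<bar>"
    unfolding c_def norm_mult \<zeta> norm_of_real by simp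
  \<comment> \<open>For \<open>s > 2 / 3\<close> the centre lies beyond the origin as seen from
    \<open>\<zeta>\<close>; then \<open>s \<le> 1\<close> is exactly what keeps the disc
    inside.\<close>
  then have nc: "cmod c + s / 2 \<le> 1"
    using s by (simp add: abs_if)
  have sub1: "ball c (s / 2) \<subseteq> unit_disc"
    using nc by (rule ball_subset_unit_disc)
  have sub2: "ball c (s / 2) \<subseteq> ball \<zeta> (2 * s)"
  proof
    fix z assume "z \<in> ball c (s / 2)"
    then show "z \<in> ball \<zeta> (2 * s)" using d dist_triangle[of \<zeta> z c] by simp
  qed
  have sub3: "ball c (s / 2) \<inter> ball \<zeta> s = {}"
  proof (intro equalityI subsetI)
    fix z assume "z \<in> ball c (s / 2) \<inter> ball \<zeta> s"
    then show "z \<in> {}" using d dist_triangle[of \<zeta> c z] by (simp add: dist_commute)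
  qed simp
  have [measurable]: "ball c (s / 2) \<in> sets dA"
    by (rule ball_sets_subset[OF sub1])
  have mle: "measure \<mu> (ball c (s / 2)) \<le> m"
    unfolding m_def using sub1 sub2 by (intro M.finite_measure_mono) (auto simp: sets_\<mu>)
  have "y + measure \<sigma> (ball c (s / 2)) = measure \<sigma> ((ball \<zeta> s \<inter> unit_disc) \<union> ball c (s / 2))"
    unfolding y_def using sub3
    by (intro S.finite_measure_Union[symmetric]) (auto simp: sets_\<sigma>)
  also have "\<dots> \<le> x"
    unfolding x_def using sub1 sub2 s by (intro S.finite_measure_mono) (auto simp: sets_\<sigma>)
  finally have yle: "measure \<sigma> (ball c (s / 2)) \<le> x - y" by simp
  have "ennreal ((s\<^sup>2 / 4)\<^sup>2) \<le> ennreal (measure \<mu> (ball c (s / 2)) * measure \<sigma> (ball c (s / 2)))"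
    using area_Cauchy_Schwarz[of "ball c (s / 2)"] emeasure_dA_ball[OF sub1] s
    by (simp add: M.emeasure_eq_measure S.emeasure_eq_measure ennreal_mult[symmetric] ennreal_power
        power_divide)
  then have "(s\<^sup>2 / 4)\<^sup>2 \<le> measure \<mu> (ball c (s / 2)) * measure \<sigma> (ball c (s / 2))"
    by (simp add: ennreal_le_iff)
  also have "\<dots> \<le> m * (x - y)"
    using mle yle by (intro mult_mono) (auto simp: m_def)
  finally have low: "s ^ 4 \<le> 16 * (m * (x - y))"
    by (simp add: power_divide flip: power_mult)
  have C1: "C \<ge> 1" using C by (rule ball_bound_ge_1)
  have "m * x \<le> C * (2 * s) ^ 4"
    unfolding m_def x_def using ball_boundD[OF C \<zeta>, of "2 * s"] s by simp
  also have "\<dots> = 16 * C * s ^ 4" by (simp add: power_mult_distrib)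
  also have "\<dots> \<le> 16 * C * (16 * (m * (x - y)))"
    using low C1 by (intro mult_left_mono) auto
  finally have "m * x \<le> m * (256 * C * (x - y))" by (simp add: algebra_simps)
  moreover have "m > 0"
  proof -
    have "0 < s ^ 4" using s by simp
    then have "m \<noteq> 0" using low by auto
    then show ?thesis by (simp add: m_def measure_nonneg less_le)
  qed
  ultimately have "x \<le> 256 * C * (x - y)" by simp
  then show ?thesis
    unfolding x_def[symmetric] y_def[symmetric] using C1 by (simp add: field_simps)
qed

text \<open>Iterating the reverse doubling property towards larger radii makes the dyadic
  decomposition of the integral below a convergent geometric series.\<close>

lemma tail_integral_bound:
  assumes C: "ball_bound C" and \<zeta>: "cmod \<zeta> = 1" and s: "0 < s"
  shows "ennreal (measure \<sigma> (ball \<zeta> s \<inter> unit_disc))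
      * (\<integral>\<^sup>+z\<in>- ball \<zeta> s. ennreal (1 / cmod (z - \<zeta>) ^ 4) \<partial>\<mu>) \<le> ennreal (4096 * C\<^sup>2)"
proof -
  let ?x = "\<lambda>s. measure \<sigma> (ball \<zeta> s \<inter> unit_disc)"
  let ?m = "\<lambda>s. measure \<mu> (ball \<zeta> s \<inter> unit_disc)"
  let ?F = "\<lambda>s. \<integral>\<^sup>+z\<in>- ball \<zeta> s. ennreal (1 / cmod (z - \<zeta>) ^ 4) \<partial>\<mu>"
  have C1: "C \<ge> 1" using C by (rule ball_bound_ge_1)
  have meas [measurable]: "(\<lambda>z. ennreal (1 / cmod (z - \<zeta>) ^ 4)) \<in> borel_measurable \<mu>"
    by (simp add: measurable_cong_sets[OF sets_\<mu> refl] borel_measurable_dA)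
  have inv_le: "1 / cmod (z - \<zeta>) ^ 4 \<le> 1 / s ^ 4" if "z \<notin> ball \<zeta> s" "s > 0" for z s
  proof -
    have "s \<le> cmod (z - \<zeta>)" using that by (simp add: dist_norm norm_minus_commute)
    moreover from this have "0 < cmod (z - \<zeta>)" using that by linarith
    ultimately show ?thesis
      using that by (intro divide_left_mono power_mono mult_pos_pos zero_less_power) auto
  qed
  \<comment> \<open>Here the integrand is at most 1 and the disc of radius 3 around
    \<open>\<zeta>\<close> covers the unit disc, so B2 at the scale 3 suffices.\<close>
  have large: "ennreal (?x s) * ?F s \<le> ennreal (4096 * C\<^sup>2)" if s: "s \<ge> 1" for s
  proof -
    have disc: "ball \<zeta> 3 \<inter> unit_disc = unit_disc"
    proof -
      have "z \<in> ball \<zeta> 3" if "z \<in> unit_disc" for z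
        using that norm_triangle_ineq4[of \<zeta> z] \<zeta> by (simp add: dist_norm)
      then show ?thesis by auto
    qed
    have "?F s \<le> (\<integral>\<^sup>+z. 1 \<partial>\<mu>)"
    proof (intro nn_integral_mono)
      fix z
      have "1 / cmod (z - \<zeta>) ^ 4 \<le> 1" if "z \<notin> ball \<zeta> s"
      proof -
        have "1 / s ^ 4 \<le> 1" using s by simp
        then show ?thesis using inv_le[OF that] s by linarith
      qed
      then show "ennreal (1 / cmod (z - \<zeta>) ^ 4) * indicator (- ball \<zeta> s) z \<le> 1"
        by (auto simp: indicator_def)
    qed
    also have "\<dots> = ennreal (?m 3)"
      unfolding disc using M.emeasure_eq_measure[of "space \<mu>"] by simp
    finally have F: "?F s \<le> ennreal (?m 3)" .
    have "?x s \<le> ?x 3"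
      unfolding disc using sets.top[of dA] by (intro S.finite_measure_mono) (auto simp: sets_\<sigma>)
    then have "ennreal (?x s) * ?F s \<le> ennreal (?x 3) * ennreal (?m 3)"
      using F by (intro mult_mono ennreal_leI) auto
    also have "\<dots> = ennreal (?m 3 * ?x 3)" by (simp add: ennreal_mult[symmetric] mult.commute)
    also have "\<dots> \<le> ennreal (C * 3 ^ 4)"
      by (intro ennreal_leI ball_boundD[OF C \<zeta>]) simp
    also have "\<dots> \<le> ennreal (4096 * C\<^sup>2)"
    proof (intro ennreal_leI)
      have "C * 1 \<le> C * C" using C1 by (intro mult_left_mono) auto
      then show "C * 3 ^ 4 \<le> 4096 * C\<^sup>2" using C1 by (simp add: power2_eq_square)
    qed
    finally show ?thesis .
  qed
  \<comment> \<open>Induction on the number of doublings that bring \<open>s\<close> up to 1. After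
    multiplication by \<open>?x (2 * s)\<close> the annulus between \<open>s\<close> and
    \<open>2 * s\<close> contributes at most \<open>16 * C\<close>, and the rest is the claim at
    \<open>2 * s\<close>; both are reduced by the factor \<open>\<theta>\<close>.\<close>
  have "ennreal (?x s) * ?F s \<le> ennreal (4096 * C\<^sup>2)" if "s > 0" "2 ^ n * s \<ge> 1" for n s
    using that
  proof (induction n arbitrary: s)
    case 0
    then show ?case using large by simp
  next
    case (Suc n)
    show ?case
    proof (cases "s \<ge> 1")
      case True
      then show ?thesis by (rule large)
    next
      case False
      define \<theta> where "\<theta> = 1 - 1 / (256 * C)"
      have \<theta>: "0 \<le> \<theta>" "\<theta> \<le> 1" using C1 by (simp_all add: \<theta>_def field_simps)
      have IH: "ennreal (?x (2 * s)) * ?F (2 * s) \<le> ennreal (4096 * C\<^sup>2)"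
        using Suc by (intro Suc.IH) (auto simp: mult_ac)
      have "?F s \<le> (\<integral>\<^sup>+z. ennreal (1 / s ^ 4) * indicator (ball \<zeta> (2 * s) \<inter> unit_disc) z
          + ennreal (1 / cmod (z - \<zeta>) ^ 4) * indicator (- ball \<zeta> (2 * s)) z \<partial>\<mu>)"
      proof (intro nn_integral_mono)
        fix z assume z: "z \<in> space \<mu>"
        show "ennreal (1 / cmod (z - \<zeta>) ^ 4) * indicator (- ball \<zeta> s) z
          \<le> ennreal (1 / s ^ 4) * indicator (ball \<zeta> (2 * s) \<inter> unit_disc) z
          + ennreal (1 / cmod (z - \<zeta>) ^ 4) * indicator (- ball \<zeta> (2 * s)) z"
        proof (cases "z \<in> ball \<zeta> (2 * s)")
          case True
          then have "z \<in> ball \<zeta> (2 * s) \<inter> unit_disc" using z by simp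
          then show ?thesis
            using inv_le[of z s] \<open>s > 0\<close> by (auto simp: indicator_def intro: ennreal_leI)
        next
          case False
          then show ?thesis by (auto simp: indicator_def)
        qed
      qed
      also have "\<dots> = ennreal (1 / s ^ 4) * emeasure \<mu> (ball \<zeta> (2 * s) \<inter> unit_disc) + ?F (2 * s)"
      proof (subst nn_integral_add)
        have [measurable]: "- ball \<zeta> (2 * s) \<in> sets borel" by simp
        have "(\<lambda>z. ennreal (1 / cmod (z - \<zeta>) ^ 4) * indicator (- ball \<zeta> (2 * s)) z) \<in> borel_measurable borel"
          by simp
        then show "(\<lambda>z. ennreal (1 / cmod (z - \<zeta>) ^ 4) * indicator (- ball \<zeta> (2 * s)) z) \<in> borel_measurable \<mu>"
          by (simp only: measurable_cong_sets[OF sets_\<mu> refl] borel_measurable_dA)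
      qed (simp_all add: nn_integral_cmult_indicator sets_\<mu>)
      also have "\<dots> = ennreal (1 / s ^ 4 * ?m (2 * s)) + ?F (2 * s)"
        unfolding M.emeasure_eq_measure using \<open>s > 0\<close> by (subst ennreal_mult) auto
      finally have F: "?F s \<le> ennreal (1 / s ^ 4 * ?m (2 * s)) + ?F (2 * s)" .
      have "?x s \<le> \<theta> * ?x (2 * s)"
        unfolding \<theta>_def using False \<open>s > 0\<close> by (intro reverse_doubling[OF C \<zeta>]) auto
      then have "ennreal (?x s) * ?F s
          \<le> ennreal (\<theta> * ?x (2 * s)) * (ennreal (1 / s ^ 4 * ?m (2 * s)) + ?F (2 * s))"
        using F by (intro mult_mono ennreal_leI) auto
      also have "\<dots> = ennreal \<theta> * (ennreal (?m (2 * s) * ?x (2 * s) / s ^ 4) + ennreal (?x (2 * s)) * ?F (2 * s))"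
        using \<theta> \<open>s > 0\<close> by (simp add: ennreal_mult distrib_left mult.assoc)
          (simp add: ennreal_mult[symmetric] mult_ac)
      also have "\<dots> \<le> ennreal \<theta> * (ennreal (16 * C) + ennreal (4096 * C\<^sup>2))"
      proof (intro mult_left_mono add_mono ennreal_leI IH)
        have "?m (2 * s) * ?x (2 * s) \<le> C * (2 * s) ^ 4"
          using \<open>s > 0\<close> by (intro ball_boundD[OF C \<zeta>]) simp
        then show "?m (2 * s) * ?x (2 * s) / s ^ 4 \<le> 16 * C"
          using \<open>s > 0\<close> by (simp add: divide_le_eq power_mult_distrib mult_ac)
      qed simp
      also have "\<dots> = ennreal (\<theta> * (16 * C + 4096 * C\<^sup>2))"
        using C1 \<theta> by (simp add: ennreal_mult)
      \<comment> \<open>The bound reproduces itself: the fraction \<open>1 / (256 * C)\<close> of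
        \<open>4096 * C\<^sup>2\<close> is \<open>16 * C\<close>, just the contribution of the
        annulus.\<close>
      also have "\<dots> \<le> ennreal (4096 * C\<^sup>2)"
        using C1 by (intro ennreal_leI) (simp add: \<theta>_def field_simps power2_eq_square)
      finally show ?thesis .
    qed
  qed
  moreover obtain n where "2 ^ n > 1 / s"
    using real_arch_pow[of 2 "1 / s"] by auto
  then have "2 ^ n * s \<ge> 1" using s by (simp add: field_simps)
  ultimately show ?thesis using s by blast
qed

text \<open>Let \<open>\<zeta>\<close> be the boundary point in the direction of \<open>a\<close>.
  The denominator \<open>1 - cnj a * z\<close> is everywhere at least \<open>h\<close> in modulus,
  and outside the disc of radius \<open>2 * h\<close> around \<open>\<zeta>\<close> at least half of
  the distance to \<open>\<zeta>\<close>, so \<open>tail_integral_bound\<close> applies with a loss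
  of \<open>2 ^ 4\<close>. Hence \<open>65536 = 16 * 4096\<close>, while the first \<open>16\<close>
  is \<open>(2 * h) ^ 4 / h ^ 4\<close>.\<close>

lemma B_fun_norm_bound:
  assumes C: "ball_bound C" and a: "cmod a < 1"
  shows "ennreal (measure \<sigma> (ball a (1 - cmod a))) * (\<integral>\<^sup>+z. ennreal ((cmod (B_fun a z))\<^sup>2) \<partial>\<mu>)
      \<le> ennreal (16 * C + 65536 * C\<^sup>2)"
proof -
  define h where "h = 1 - cmod a"
  have h: "h > 0" using a by (simp add: h_def)
  obtain \<zeta> where \<zeta>: "cmod \<zeta> = 1" and a_eq: "a = of_real (cmod a) * \<zeta>"
  proof (cases "a = 0")
    case True
    then show ?thesis using that[of 1] by simp
  next
    case False
    then show ?thesis using that[of "sgn a"] by (simp add: sgn_eq norm_divide)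
  qed
  have C1: "C \<ge> 1" using C by (rule ball_bound_ge_1)
  let ?E = "ball \<zeta> (2 * h) \<inter> unit_disc"
  let ?m = "measure \<mu> ?E" and ?x = "measure \<sigma> ?E"
  let ?F = "\<integral>\<^sup>+z\<in>- ball \<zeta> (2 * h). ennreal (1 / cmod (z - \<zeta>) ^ 4) \<partial>\<mu>"
  have d: "dist \<zeta> a = h"
  proof -
    have "\<zeta> - a = of_real h * \<zeta>" by (subst a_eq) (simp add: h_def algebra_simps)
    then show ?thesis using h \<zeta> by (simp add: dist_norm norm_mult)
  qed
  have "ball a h \<subseteq> ?E"
  proof
    fix z assume z: "z \<in> ball a h"
    then have "z \<in> ball \<zeta> (2 * h)" using d dist_triangle[of \<zeta> z a] by simp
    moreover have "cmod z < 1"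
      using z norm_triangle_ineq[of "z - a" a] by (simp add: h_def dist_norm norm_minus_commute)
    ultimately show "z \<in> ?E" by simp
  qed
  then have xle: "measure \<sigma> (ball a h) \<le> ?x"
    by (intro S.finite_measure_mono) (auto simp: sets_\<sigma>)
  have "(\<integral>\<^sup>+z. ennreal ((cmod (B_fun a z))\<^sup>2) \<partial>\<mu>)
      \<le> (\<integral>\<^sup>+z. ennreal (1 / h ^ 4) * indicator ?E z
          + 16 * (ennreal (1 / cmod (z - \<zeta>) ^ 4) * indicator (- ball \<zeta> (2 * h)) z) \<partial>\<mu>)"
  proof (intro nn_integral_mono)
    fix z assume "z \<in> space \<mu>"
    then have z: "cmod z < 1" by simp
    have ge_h: "h \<le> cmod (1 - cnj a * z)"
      unfolding h_def using z by (intro norm_one_minus_cnj_mult_ge) simp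
    show "ennreal ((cmod (B_fun a z))\<^sup>2) \<le> ennreal (1 / h ^ 4) * indicator ?E z
          + 16 * (ennreal (1 / cmod (z - \<zeta>) ^ 4) * indicator (- ball \<zeta> (2 * h)) z)"
    proof (cases "z \<in> ball \<zeta> (2 * h)")
      case True
      have "(cmod (B_fun a z))\<^sup>2 \<le> 1 / h ^ 4"
        unfolding norm_B_fun using ge_h h less_le_trans[OF h ge_h]
        by (intro divide_left_mono power_mono mult_pos_pos zero_less_power) auto
      then show ?thesis using True z by (auto simp: indicator_def intro: ennreal_leI)
    next
      case False
      have "z - \<zeta> = of_real h * z - (\<zeta> - of_real (cmod a) * z)"
        by (simp add: h_def algebra_simps)
      then have "cmod (z - \<zeta>) \<le> cmod (of_real h * z) + cmod (\<zeta> - of_real (cmod a) * z)"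
        using norm_triangle_ineq4 by metis
      also have "\<dots> \<le> h + cmod (1 - cnj a * z)"
        using z h by (simp add: norm_one_minus_cnj_mult[OF \<zeta> a_eq] norm_mult mult_left_le)
      finally have le: "cmod (z - \<zeta>) \<le> 2 * cmod (1 - cnj a * z)" using ge_h by simp
      have pos': "0 < cmod (1 - cnj a * z)" using ge_h h by linarith
      have pos: "0 < cmod (z - \<zeta>)"
        using False h by auto
      have "(cmod (B_fun a z))\<^sup>2 = 16 / (2 * cmod (1 - cnj a * z)) ^ 4"
        by (simp add: norm_B_fun power_mult_distrib)
      also have "\<dots> \<le> 16 / cmod (z - \<zeta>) ^ 4"
        using le pos pos' by (intro divide_left_mono power_mono mult_pos_pos zero_less_power) auto
      finally have "ennreal ((cmod (B_fun a z))\<^sup>2) \<le> ennreal (16 * (1 / cmod (z - \<zeta>) ^ 4))"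
        by (intro ennreal_leI) simp
      then show ?thesis using False
        by (subst (asm) ennreal_mult) (auto simp: indicator_def)
    qed
  qed
  also have "\<dots> = ennreal (1 / h ^ 4) * emeasure \<mu> ?E + 16 * ?F"
  proof -
    have "(\<lambda>z. ennreal (1 / cmod (z - \<zeta>) ^ 4) * indicator (- ball \<zeta> (2 * h)) z) \<in> borel_measurable borel"
      by simp
    then have [measurable]: "(\<lambda>z. ennreal (1 / cmod (z - \<zeta>) ^ 4) * indicator (- ball \<zeta> (2 * h)) z) \<in> borel_measurable \<mu>"
      by (simp only: measurable_cong_sets[OF sets_\<mu> refl] borel_measurable_dA)
    show ?thesis
      by (subst nn_integral_add) (simp_all add: nn_integral_cmult nn_integral_cmult_indicator sets_\<mu>)
  qed
  also have "\<dots> = ennreal (1 / h ^ 4 * ?m) + 16 * ?F"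
    unfolding M.emeasure_eq_measure using h by (subst ennreal_mult) auto
  finally have "ennreal (measure \<sigma> (ball a h)) * (\<integral>\<^sup>+z. ennreal ((cmod (B_fun a z))\<^sup>2) \<partial>\<mu>)
      \<le> ennreal ?x * (ennreal (1 / h ^ 4 * ?m) + 16 * ?F)"
    using xle by (intro mult_mono ennreal_leI) auto
  also have "\<dots> = ennreal (?m * ?x / h ^ 4) + 16 * (ennreal ?x * ?F)"
    using h by (simp add: distrib_left mult.left_commute) (simp add: ennreal_mult[symmetric] mult_ac)
  also have "\<dots> \<le> ennreal (16 * C) + 16 * ennreal (4096 * C\<^sup>2)"
  proof (intro add_mono ennreal_leI mult_left_mono)
    have "?m * ?x \<le> C * (2 * h) ^ 4"
      using h by (intro ball_boundD[OF C \<zeta>]) simp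
    then show "?m * ?x / h ^ 4 \<le> 16 * C"
      using h by (simp add: divide_le_eq power_mult_distrib mult_ac)
    show "ennreal ?x * ?F \<le> ennreal (4096 * C\<^sup>2)"
      using h by (intro tail_integral_bound[OF C \<zeta>]) simp
  qed simp
  also have "16 * ennreal (4096 * C\<^sup>2) = ennreal (65536 * C\<^sup>2)"
    using ennreal_mult[of 16 "4096 * C\<^sup>2"] by simp
  also have "ennreal (16 * C) + \<dots> = ennreal (16 * C + 65536 * C\<^sup>2)"
    using C1 by simp
  finally show ?thesis by (simp add: h_def)
qed

end

section \<open>Square integrable functions\<close>

definition L2_inner :: "complex measure \<Rightarrow> (complex \<Rightarrow> complex) \<Rightarrow> (complex \<Rightarrow> complex) \<Rightarrow> complex" where
  "L2_inner M f g = (\<integral>z. f z * cnj (g z) \<partial>M)"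

lemma L2_iff:
  "f \<in> L2 M \<longleftrightarrow> f \<in> borel_measurable M \<and> (\<integral>\<^sup>+z. ennreal ((cmod (f z))\<^sup>2) \<partial>M) < \<infinity>"
  by (auto simp: L2_def integrable_iff_bounded)

lemma L2_measurable: "f \<in> L2 M \<Longrightarrow> f \<in> borel_measurable M"
  by (simp add: L2_def)

lemma L2_norm_nonneg [simp]: "L2_norm M f \<ge> 0"
  by (simp add: L2_norm_def)

lemma L2_norm_power2: "(L2_norm M f)\<^sup>2 = (\<integral>z. (cmod (f z))\<^sup>2 \<partial>M)"
  by (simp add: L2_norm_def)

lemma nn_integral_L2:
  "f \<in> L2 M \<Longrightarrow> (\<integral>\<^sup>+z. ennreal ((cmod (f z))\<^sup>2) \<partial>M) = ennreal ((L2_norm M f)\<^sup>2)"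
  unfolding L2_norm_power2 by (rule nn_integral_eq_integral) (auto simp: L2_def)

lemma L2_norm_le:
  assumes "f \<in> borel_measurable M" "(\<integral>\<^sup>+z. ennreal ((cmod (f z))\<^sup>2) \<partial>M) \<le> ennreal (b\<^sup>2)" "b \<ge> 0"
  shows "f \<in> L2 M" "L2_norm M f \<le> b"
proof -
  show L: "f \<in> L2 M"
    unfolding L2_iff using assms by (auto elim: le_less_trans)
  have "(L2_norm M f)\<^sup>2 \<le> b\<^sup>2"
    using assms(2) unfolding nn_integral_L2[OF L] by (simp add: ennreal_le_iff)
  then show "L2_norm M f \<le> b" using assms(3) by (rule power2_le_imp_le)
qed

lemma L2_cong:
  assumes "\<And>z. z \<in> space M \<Longrightarrow> f z = g z"
  shows "f \<in> L2 M \<longleftrightarrow> g \<in> L2 M" "L2_norm M f = L2_norm M g"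
  unfolding L2_iff L2_norm_def using assms
  by (auto cong: measurable_cong nn_integral_cong Bochner_Integration.integral_cong)

lemma L2_inner_cong:
  assumes "\<And>z. z \<in> space M \<Longrightarrow> f z = f' z" "\<And>z. z \<in> space M \<Longrightarrow> g z = g' z"
  shows "L2_inner M f g = L2_inner M f' g'"
  unfolding L2_inner_def using assms by (auto cong: Bochner_Integration.integral_cong)

lemma L2_zero [simp]: "(\<lambda>_. 0) \<in> L2 M"
  by (simp add: L2_def)

lemma L2_cmult: "f \<in> L2 M \<Longrightarrow> (\<lambda>z. c * f z) \<in> L2 M"
  by (auto simp: L2_def norm_mult power_mult_distrib)

lemma L2_norm_cmult: "L2_norm M (\<lambda>z. c * f z) = cmod c * L2_norm M f"
  by (simp add: L2_norm_def norm_mult power_mult_distrib real_sqrt_mult)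

lemma L2_add:
  assumes "f \<in> L2 M" "g \<in> L2 M"
  shows "(\<lambda>z. f z + g z) \<in> L2 M"
proof -
  have [measurable]: "f \<in> borel_measurable M" "g \<in> borel_measurable M"
    using assms by (simp_all add: L2_def)
  have "integrable M (\<lambda>z. 2 * ((cmod (f z))\<^sup>2 + (cmod (g z))\<^sup>2))"
    using assms by (simp add: L2_def)
  then have "integrable M (\<lambda>z. (cmod (f z + g z))\<^sup>2)"
  proof (rule Bochner_Integration.integrable_bound)
    have "(cmod (f z + g z))\<^sup>2 \<le> 2 * ((cmod (f z))\<^sup>2 + (cmod (g z))\<^sup>2)" for z
    proof -
      have "(cmod (f z + g z))\<^sup>2 \<le> (cmod (f z) + cmod (g z))\<^sup>2"
        by (intro power_mono norm_triangle_ineq) simp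
      also have "\<dots> \<le> 2 * ((cmod (f z))\<^sup>2 + (cmod (g z))\<^sup>2)"
        using sum_squares_bound[of "cmod (f z)" "cmod (g z)"] by (simp add: power2_sum)
      finally show ?thesis .
    qed
    then show "AE z in M. norm ((cmod (f z + g z))\<^sup>2) \<le> norm (2 * ((cmod (f z))\<^sup>2 + (cmod (g z))\<^sup>2))"
      by simp
  qed simp
  then show ?thesis by (simp add: L2_def)
qed

lemma L2_diff: "f \<in> L2 M \<Longrightarrow> g \<in> L2 M \<Longrightarrow> (\<lambda>z. f z - g z) \<in> L2 M"
  using L2_add[of f M "\<lambda>z. - 1 * g z"] L2_cmult[of g M "- 1"] by simp

lemma borel_measurable_cnj [measurable (raw)]:
  "f \<in> borel_measurable M \<Longrightarrow> (\<lambda>z. cnj (f z)) \<in> borel_measurable M"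
  by (rule measurable_compose[where N = borel])
    (auto intro: borel_measurable_continuous_onI continuous_on_cnj continuous_on_id)

lemma L2_integrable_mult:
  assumes "f \<in> L2 M" "g \<in> L2 M"
  shows "integrable M (\<lambda>z. f z * cnj (g z))"
proof -
  have [measurable]: "f \<in> borel_measurable M" "g \<in> borel_measurable M"
    using assms by (simp_all add: L2_def)
  have "integrable M (\<lambda>z. (cmod (f z))\<^sup>2 + (cmod (g z))\<^sup>2)"
    using assms by (simp add: L2_def)
  then show ?thesis
  proof (rule Bochner_Integration.integrable_bound)
    show "AE z in M. norm (f z * cnj (g z)) \<le> norm ((cmod (f z))\<^sup>2 + (cmod (g z))\<^sup>2)"
    proof (intro AE_I2)
      fix z
      have "0 \<le> cmod (f z) * cmod (g z)" by simp
      moreover have "2 * (cmod (f z) * cmod (g z)) \<le> (cmod (f z))\<^sup>2 + (cmod (g z))\<^sup>2"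
        using sum_squares_bound[of "cmod (f z)" "cmod (g z)"] by (simp add: mult.assoc)
      ultimately have "cmod (f z) * cmod (g z) \<le> (cmod (f z))\<^sup>2 + (cmod (g z))\<^sup>2"
        by linarith
      then show "norm (f z * cnj (g z)) \<le> norm ((cmod (f z))\<^sup>2 + (cmod (g z))\<^sup>2)"
        by (simp add: norm_mult)
    qed
  qed simp
qed

lemma L2_inner_commute: "L2_inner M g f = cnj (L2_inner M f g)"
  unfolding L2_inner_def by (subst Bochner_Integration.integral_cnj[symmetric]) (simp add: mult.commute)

lemma L2_inner_self: "L2_inner M f f = of_real ((L2_norm M f)\<^sup>2)"
  unfolding L2_inner_def L2_norm_power2
  by (subst integral_complex_of_real[symmetric]) (simp only: complex_norm_square)

lemma L2_inner_add_left:
  "\<lbrakk>f \<in> L2 M; g \<in> L2 M; h \<in> L2 M\<rbrakk> \<Longrightarrow> L2_inner M (\<lambda>z. f z + g z) h = L2_inner M f h + L2_inner M g h"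
  by (simp add: L2_inner_def distrib_right L2_integrable_mult)

lemma L2_inner_diff_left:
  "\<lbrakk>f \<in> L2 M; g \<in> L2 M; h \<in> L2 M\<rbrakk> \<Longrightarrow> L2_inner M (\<lambda>z. f z - g z) h = L2_inner M f h - L2_inner M g h"
  by (simp add: L2_inner_def left_diff_distrib L2_integrable_mult)

lemma L2_inner_cmult_left: "L2_inner M (\<lambda>z. c * f z) h = c * L2_inner M f h"
  by (simp add: L2_inner_def mult.assoc)

lemma L2_inner_cmult_right: "L2_inner M h (\<lambda>z. c * f z) = cnj c * L2_inner M h f"
  by (simp add: L2_inner_def mult.left_commute)

lemma L2_inner_add_right:
  "\<lbrakk>f \<in> L2 M; g \<in> L2 M; h \<in> L2 M\<rbrakk> \<Longrightarrow> L2_inner M h (\<lambda>z. f z + g z) = L2_inner M h f + L2_inner M h g"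
  by (simp add: L2_inner_def distrib_left L2_integrable_mult)

lemma L2_inner_diff_right:
  "\<lbrakk>f \<in> L2 M; g \<in> L2 M; h \<in> L2 M\<rbrakk> \<Longrightarrow> L2_inner M h (\<lambda>z. f z - g z) = L2_inner M h f - L2_inner M h g"
  by (simp add: L2_inner_def right_diff_distrib L2_integrable_mult)

lemma L2_Cauchy_Schwarz:
  assumes "f \<in> L2 M" "g \<in> L2 M"
  shows "cmod (L2_inner M f g) \<le> L2_norm M f * L2_norm M g"
proof -
  have [measurable]: "f \<in> borel_measurable M" "g \<in> borel_measurable M"
    using assms by (simp_all add: L2_def)
  have "(ennreal (cmod (L2_inner M f g)))\<^sup>2 \<le> (\<integral>\<^sup>+z. ennreal (cmod (f z)) * ennreal (cmod (g z)) \<partial>M)\<^sup>2"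
    unfolding L2_inner_def
    using integral_norm_bound_ennreal[OF L2_integrable_mult[OF assms]]
    by (intro power_mono) (simp_all add: norm_mult ennreal_mult)
  also have "\<dots> \<le> (\<integral>\<^sup>+z. (ennreal (cmod (f z)))\<^sup>2 \<partial>M) * (\<integral>\<^sup>+z. (ennreal (cmod (g z)))\<^sup>2 \<partial>M)"
    by (rule Cauchy_Schwarz_nn_integral) simp_all
  also have "\<dots> = ennreal ((L2_norm M f * L2_norm M g)\<^sup>2)"
    by (simp add: ennreal_power nn_integral_L2 assms ennreal_mult[symmetric] power_mult_distrib)
  finally have "(cmod (L2_inner M f g))\<^sup>2 \<le> (L2_norm M f * L2_norm M g)\<^sup>2"
    by (simp add: ennreal_power ennreal_le_iff)
  then show ?thesis by (rule power2_le_imp_le) simp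
qed

lemma L2_norm_add_power2:
  assumes "f \<in> L2 M" "g \<in> L2 M"
  shows "(L2_norm M (\<lambda>z. f z + g z))\<^sup>2 = (L2_norm M f)\<^sup>2 + 2 * Re (L2_inner M f g) + (L2_norm M g)\<^sup>2"
proof -
  have "of_real ((L2_norm M (\<lambda>z. f z + g z))\<^sup>2)
      = of_real ((L2_norm M f)\<^sup>2) + (L2_inner M f g + cnj (L2_inner M f g)) + of_real ((L2_norm M g)\<^sup>2)"
    unfolding L2_inner_self[symmetric] L2_inner_commute[of M g f, symmetric]
    using assms by (simp add: L2_inner_add_left L2_inner_add_right L2_add)
  also have "\<dots> = of_real ((L2_norm M f)\<^sup>2 + 2 * Re (L2_inner M f g) + (L2_norm M g)\<^sup>2)"
    by (simp add: complex_add_cnj)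
  finally show ?thesis by (simp only: of_real_eq_iff)
qed

lemma L2_norm_triangle:
  assumes "f \<in> L2 M" "g \<in> L2 M"
  shows "L2_norm M (\<lambda>z. f z + g z) \<le> L2_norm M f + L2_norm M g"
proof (rule power2_le_imp_le)
  have "Re (L2_inner M f g) \<le> L2_norm M f * L2_norm M g"
    using complex_Re_le_cmod L2_Cauchy_Schwarz[OF assms] by (rule order.trans)
  then show "(L2_norm M (\<lambda>z. f z + g z))\<^sup>2 \<le> (L2_norm M f + L2_norm M g)\<^sup>2"
    unfolding L2_norm_add_power2[OF assms] by (simp add: power2_sum)
qed simp

lemma L2_norm_triangle_diff:
  "f \<in> L2 M \<Longrightarrow> g \<in> L2 M \<Longrightarrow> L2_norm M (\<lambda>z. f z - g z) \<le> L2_norm M f + L2_norm M g"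
  using L2_norm_triangle[of f M "\<lambda>z. - 1 * g z"] L2_cmult[of g M "- 1"] L2_norm_cmult[of M "- 1" g]
  by simp

section \<open>Locally uniform convergence and finite measures on the disc\<close>

definition loc_uniform_limit :: "(nat \<Rightarrow> complex \<Rightarrow> complex) \<Rightarrow> (complex \<Rightarrow> complex) \<Rightarrow> bool" where
  "loc_uniform_limit f g \<longleftrightarrow> (\<forall>r<1. uniform_limit (cball 0 r) f g sequentially)"

lemma loc_uniform_limit_pointwise:
  assumes "loc_uniform_limit f g" "z \<in> unit_disc"
  shows "(\<lambda>n. f n z) \<longlonglongrightarrow> g z"
  using assms tendsto_uniform_limitI[where S = "cball 0 (cmod z)" and x = z]
  by (auto simp: loc_uniform_limit_def)

lemma loc_uniform_limit_subseq:
  "loc_uniform_limit f g \<Longrightarrow> strict_mono r \<Longrightarrow> loc_uniform_limit (\<lambda>n. f (r n)) g"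
  unfolding loc_uniform_limit_def
  by (auto intro: filterlim_compose filterlim_subseq)

lemma loc_uniform_limit_diff_zero:
  "loc_uniform_limit f g \<Longrightarrow> loc_uniform_limit (\<lambda>n z. f n z - g z) (\<lambda>_. 0)"
  unfolding loc_uniform_limit_def uniform_limit_iff by (simp add: dist_norm)

text \<open>Covers \<open>\<mu>\<close>, \<open>\<sigma>\<close> and \<open>\<nu>\<close> together:
  the first two live on Lebesgue sets and the last on Borel sets, so only measurability of the
  identity is asked for.\<close>

locale disc_measure = finite_measure M for M :: "complex measure" +
  assumes space_M [simp]: "space M = unit_disc"
    and ident_measurable: "(\<lambda>z. z) \<in> measurable M borel"
begin

lemma borel_measurable_M: "f \<in> measurable borel N \<Longrightarrow> f \<in> measurable M N"
  using measurable_compose[OF ident_measurable] .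

lemma borel_sets: "B \<in> sets borel \<Longrightarrow> B \<inter> unit_disc \<in> sets M"
  using measurable_sets[OF ident_measurable, of B] by simp

text \<open>The sets \<open>- cball 0 (r k)\<close> shrink to a set disjoint from the unit disc, so
  this is dominated convergence.\<close>

lemma L2_tail:
  assumes "h \<in> L2 M" "\<epsilon> > 0"
  obtains r where "r < 1" "(\<integral>z\<in>- cball 0 r. (cmod (h z))\<^sup>2 \<partial>M) < \<epsilon>"
proof -
  define r where "r k = 1 + - inverse (real (Suc k))" for k
  have [measurable]: "h \<in> borel_measurable M" using assms by (simp add: L2_def)
  have [measurable]: "(\<lambda>z. indicator (- cball 0 r) z :: real) \<in> borel_measurable M" for r
    by (rule borel_measurable_M) simp
  have lim: "(\<lambda>k. \<integral>z\<in>- cball 0 (r k). (cmod (h z))\<^sup>2 \<partial>M) \<longlonglongrightarrow> (\<integral>z. 0 \<partial>M)"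
    unfolding set_lebesgue_integral_def
  proof (rule integral_dominated_convergence)
    show "integrable M (\<lambda>z. (cmod (h z))\<^sup>2)" using assms by (simp add: L2_def)
    show "AE z in M. (\<lambda>k. indicator (- cball 0 (r k)) z *\<^sub>R (cmod (h z))\<^sup>2) \<longlonglongrightarrow> 0"
    proof (rule AE_I2)
      fix z assume "z \<in> space M"
      then have "cmod z < 1" by simp
      moreover have "r \<longlonglongrightarrow> 1" unfolding r_def by (rule LIMSEQ_inverse_real_of_nat_add_minus)
      ultimately have "\<forall>\<^sub>F k in sequentially. cmod z < r k"
        using order_tendstoD(1) by blast
      then have "\<forall>\<^sub>F k in sequentially. indicator (- cball 0 (r k)) z *\<^sub>R (cmod (h z))\<^sup>2 = 0"
        by eventually_elim auto
      then show "(\<lambda>k. indicator (- cball 0 (r k)) z *\<^sub>R (cmod (h z))\<^sup>2) \<longlonglongrightarrow> 0"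
        by (rule tendsto_eventually)
    qed
    show "AE z in M. norm (indicator (- cball 0 (r k)) z *\<^sub>R (cmod (h z))\<^sup>2) \<le> (cmod (h z))\<^sup>2" for k
      by (intro AE_I2) (simp add: indicator_def)
  qed simp_all
  then have "\<forall>\<^sub>F k in sequentially. (\<integral>z\<in>- cball 0 (r k). (cmod (h z))\<^sup>2 \<partial>M) < \<epsilon>"
    using assms(2) order_tendstoD(2)[OF lim] by simp
  then obtain k where "(\<integral>z\<in>- cball 0 (r k). (cmod (h z))\<^sup>2 \<partial>M) < \<epsilon>"
    by (auto simp: eventually_sequentially)
  then show ?thesis using that[of "r k"] by (simp add: r_def)
qed

lemma L2_indicator:
  assumes "h \<in> L2 M" "B \<in> sets borel"
  shows "(\<lambda>z. indicator B z * h z) \<in> L2 M"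
proof -
  have [measurable]: "h \<in> borel_measurable M" using assms by (simp add: L2_def)
  have [measurable]: "(\<lambda>z. indicator B z :: complex) \<in> borel_measurable M"
    by (rule borel_measurable_M) (use assms in simp)
  have "integrable M (\<lambda>z. (cmod (h z))\<^sup>2)" using assms by (simp add: L2_def)
  then have "integrable M (\<lambda>z. (cmod (indicator B z * h z))\<^sup>2)"
  proof (rule Bochner_Integration.integrable_bound)
    show "(\<lambda>z. (cmod (indicator B z * h z))\<^sup>2) \<in> borel_measurable M" by measurable
  qed (simp add: indicator_def)
  then show ?thesis by (simp add: L2_def)
qed

text \<open>Near the boundary the fixed \<open>h\<close> has small norm; on the remaining closed
  disc \<open>f n\<close> is uniformly small and the measure is finite. It serves for
  \<open>\<mu>\<close> and for \<open>\<nu>\<close>.\<close>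

lemma weak_convergence:
  assumes f: "\<And>n. f n \<in> L2 M" "\<And>n. L2_norm M (f n) \<le> b" "loc_uniform_limit f (\<lambda>_. 0)"
    and h: "h \<in> L2 M"
  shows "(\<lambda>n. L2_inner M (f n) h) \<longlonglongrightarrow> 0"
proof (rule LIMSEQ_I)
  fix \<epsilon> :: real assume \<epsilon>: "\<epsilon> > 0"
  have b: "b \<ge> 0" using f(2)[of 0] L2_norm_nonneg[of M "f 0"] by linarith
  define \<delta> where "\<delta> = \<epsilon> / (2 * (b + 1))"
  have \<delta>: "\<delta> > 0" using \<epsilon> b by (simp add: \<delta>_def)
  obtain r where r: "r < 1" "(\<integral>z\<in>- cball 0 r. (cmod (h z))\<^sup>2 \<partial>M) < \<delta>\<^sup>2"
    using L2_tail[OF h] \<delta> by (metis zero_less_power)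
  define h1 where "h1 z = indicator (- cball 0 r) z * h z" for z
  define \<eta> where "\<eta> = \<epsilon> / (2 * (sqrt (measure M unit_disc) * L2_norm M h + 1))"
  have den: "sqrt (measure M unit_disc) * L2_norm M h + 1 > 0"
    by (simp add: add_nonneg_pos)
  then have \<eta>: "\<eta> > 0" using \<epsilon> by (simp add: \<eta>_def)
  have h1: "h1 \<in> L2 M" unfolding h1_def by (intro L2_indicator h) simp
  have "(L2_norm M h1)\<^sup>2 < \<delta>\<^sup>2"
  proof -
    have "(cmod (h1 z))\<^sup>2 = indicator (- cball 0 r) z *\<^sub>R (cmod (h z))\<^sup>2" for z
      by (simp add: h1_def indicator_def)
    then show ?thesis
      using r(2) unfolding L2_norm_power2 set_lebesgue_integral_def by simp
  qed
  then have N1: "L2_norm M h1 < \<delta>" using \<delta> by (simp add: power2_less_imp_less)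
  have "\<forall>\<^sub>F n in sequentially. \<forall>z\<in>cball 0 r. dist (f n z) 0 < \<eta>"
    using f(3) r(1) \<eta> unfolding loc_uniform_limit_def uniform_limit_iff by blast
  then obtain N where N: "\<forall>n\<ge>N. \<forall>z\<in>cball 0 r. dist (f n z) 0 < \<eta>"
    unfolding eventually_sequentially by blast
  have "norm (L2_inner M (f n) h - 0) < \<epsilon>" if n: "n \<ge> N" for n
  proof -
    define f1 where "f1 z = indicator (cball 0 r) z * f n z" for z
    have f1: "f1 \<in> L2 M" unfolding f1_def by (intro L2_indicator f) simp
    have "f n z * cnj (h z) = f1 z * cnj (h z) + f n z * cnj (h1 z)" for z
      by (simp add: f1_def h1_def indicator_def)
    then have eq: "L2_inner M (f n) h = L2_inner M f1 h + L2_inner M (f n) h1"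
      unfolding L2_inner_def using L2_integrable_mult[OF f1 h] L2_integrable_mult[OF f(1) h1]
      by simp
    have "(\<integral>\<^sup>+z. ennreal ((cmod (f1 z))\<^sup>2) \<partial>M) \<le> (\<integral>\<^sup>+z. ennreal (\<eta>\<^sup>2) \<partial>M)"
    proof (intro nn_integral_mono ennreal_leI)
      fix z
      have "cmod (f1 z) \<le> \<eta>"
        using N n \<eta> by (auto simp: f1_def indicator_def less_imp_le)
      then show "(cmod (f1 z))\<^sup>2 \<le> \<eta>\<^sup>2" by (intro power_mono) auto
    qed
    also have "\<dots> = ennreal ((\<eta> * sqrt (measure M unit_disc))\<^sup>2)"
      using \<eta> by (simp add: emeasure_eq_measure power_mult_distrib ennreal_mult)
    finally have Nf1: "L2_norm M f1 \<le> \<eta> * sqrt (measure M unit_disc)"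
      using \<eta> L2_measurable[OF f1] by (intro L2_norm_le) auto
    have "cmod (L2_inner M f1 h) \<le> L2_norm M f1 * L2_norm M h"
      by (rule L2_Cauchy_Schwarz[OF f1 h])
    also have "\<dots> \<le> \<eta> * sqrt (measure M unit_disc) * L2_norm M h"
      using Nf1 by (intro mult_right_mono) auto
    also have "\<dots> < \<epsilon> / 2"
      using \<epsilon> den by (simp add: \<eta>_def field_simps)
    finally have 1: "cmod (L2_inner M f1 h) < \<epsilon> / 2" .
    have "cmod (L2_inner M (f n) h1) \<le> L2_norm M (f n) * L2_norm M h1"
      by (rule L2_Cauchy_Schwarz[OF f(1) h1])
    also have "\<dots> \<le> b * \<delta>"
      using f(2)[of n] N1 b by (intro mult_mono) auto
    also have "\<dots> \<le> \<epsilon> / 2"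
      using \<epsilon> b by (simp add: \<delta>_def field_simps)
    finally show ?thesis
      using 1 norm_triangle_ineq[of "L2_inner M f1 h" "L2_inner M (f n) h1"] by (simp add: eq)
  qed
  then show "\<exists>N. \<forall>n\<ge>N. norm (L2_inner M (f n) h - 0) < \<epsilon>" by blast
qed

text \<open>Fatou's lemma for the squared moduli. It puts limits into L2 when only pointwise
  convergence is at hand.\<close>

lemma L2_limit:
  assumes f: "\<And>n. f n \<in> L2 M" "\<And>n. L2_norm M (f n) \<le> b"
    and g: "g \<in> borel_measurable M" "\<And>z. z \<in> unit_disc \<Longrightarrow> (\<lambda>n. f n z) \<longlonglongrightarrow> g z"
  shows "g \<in> L2 M" "L2_norm M g \<le> b"
proof -
  have b: "b \<ge> 0" using f(2)[of 0] L2_norm_nonneg[of M "f 0"] by linarith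
  have [measurable]: "f n \<in> borel_measurable M" for n using f(1) by (rule L2_measurable)
  have "(\<integral>\<^sup>+z. ennreal ((cmod (g z))\<^sup>2) \<partial>M) = (\<integral>\<^sup>+z. liminf (\<lambda>n. ennreal ((cmod (f n z))\<^sup>2)) \<partial>M)"
  proof (intro nn_integral_cong)
    fix z assume "z \<in> space M"
    then have "(\<lambda>n. ennreal ((cmod (f n z))\<^sup>2)) \<longlonglongrightarrow> ennreal ((cmod (g z))\<^sup>2)"
      by (intro tendsto_ennrealI tendsto_intros g) simp
    then show "ennreal ((cmod (g z))\<^sup>2) = liminf (\<lambda>n. ennreal ((cmod (f n z))\<^sup>2))"
      by (rule lim_imp_Liminf[OF trivial_limit_sequentially, symmetric])
  qed
  also have "\<dots> \<le> liminf (\<lambda>n. \<integral>\<^sup>+z. ennreal ((cmod (f n z))\<^sup>2) \<partial>M)"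
    by (rule nn_integral_liminf) simp
  also have "\<dots> \<le> ennreal (b\<^sup>2)"
  proof (rule Liminf_le)
    show "\<forall>\<^sub>F n in sequentially. (\<integral>\<^sup>+z. ennreal ((cmod (f n z))\<^sup>2) \<partial>M) \<le> ennreal (b\<^sup>2)"
      using f by (intro always_eventually allI) (simp add: nn_integral_L2 ennreal_leI power_mono)
  qed simp
  finally show "g \<in> L2 M" "L2_norm M g \<le> b"
    using b g(1) by (auto intro: L2_norm_le)
qed

lemma L2_bounded:
  assumes f: "f \<in> borel_measurable M" "\<And>z. z \<in> unit_disc \<Longrightarrow> cmod (f z) \<le> b"
  shows "f \<in> L2 M"
proof -
  have "integrable M (\<lambda>z. (cmod (f z))\<^sup>2)"
    using f by (intro integrable_const_bound[where B = "b\<^sup>2"] AE_I2) (auto intro: power_mono)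
  then show ?thesis using f by (simp add: L2_def)
qed

end

section \<open>The weighted Bergman space\<close>

context B2_weight
begin

lemma pointwise_bound:
  assumes f: "f holomorphic_on unit_disc" and r: "cball z r \<subseteq> unit_disc" "r > 0"
  shows "ennreal ((cmod (f z))\<^sup>2) * ennreal (r ^ 4)
    \<le> (\<integral>\<^sup>+w\<in>ball z r. ennreal ((cmod (f w))\<^sup>2) \<partial>\<mu>) * emeasure \<sigma> (ball z r)"
proof -
  have [measurable]: "f \<in> borel_measurable dA" by (rule holomorphic_measurable_dA[OF f])
  have [measurable]: "ball z r \<in> sets dA"
    using r by (intro ball_sets_subset) (meson ball_subset_cball order.trans)
  have "ennreal ((cmod (f z))\<^sup>2) * ennreal (r ^ 4) = (ennreal (cmod (f z)) * ennreal (r\<^sup>2))\<^sup>2"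
    using r by (simp add: ennreal_mult[symmetric] ennreal_power power_mult_distrib flip: power_mult)
  also have "\<dots> \<le> (\<integral>\<^sup>+w\<in>ball z r. ennreal (cmod (f w)) \<partial>dA)\<^sup>2"
    by (intro power_mono sub_mean_value_dA assms) simp
  also have "\<dots> \<le> (\<integral>\<^sup>+w\<in>ball z r. ennreal ((cmod (f w))\<^sup>2) \<partial>\<mu>) * emeasure \<sigma> (ball z r)"
    by (rule weighted_Cauchy_Schwarz) simp_all
  finally show ?thesis .
qed

lemma disc_measure_\<mu>: "disc_measure \<mu>"
  by (intro disc_measure.intro disc_measure_axioms.intro finite_measure_\<mu>)
    (simp_all add: measurable_cong_sets[OF sets_\<mu> refl])

sublocale M: disc_measure \<mu> by (rule disc_measure_\<mu>)

lemma holomorphic_measurable_\<mu>: "f holomorphic_on unit_disc \<Longrightarrow> f \<in> borel_measurable \<mu>"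
  by (simp add: measurable_cong_sets[OF sets_\<mu> refl] holomorphic_measurable_dA)

lemma A2_iff: "f \<in> A2 u \<longleftrightarrow> f holomorphic_on unit_disc \<and> f \<in> L2 \<mu>"
proof -
  have "integrable dA (\<lambda>z. (cmod (f z))\<^sup>2 * u z) \<longleftrightarrow> integrable \<mu> (\<lambda>z. (cmod (f z))\<^sup>2)"
    if "f holomorphic_on unit_disc"
  proof -
    have [measurable]: "f \<in> borel_measurable dA" by (rule holomorphic_measurable_dA[OF that])
    have "AE z in dA. 0 \<le> u z" using AE_u_pos by eventually_elim simp
    then show ?thesis
      unfolding \<mu>_def by (subst integrable_density) (simp_all add: mult.commute)
  qed
  then show ?thesis
    unfolding A2_def L2_def using holomorphic_measurable_\<mu> by auto
qed

lemma A2_holomorphic: "f \<in> A2 u \<Longrightarrow> f holomorphic_on unit_disc"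
  and A2_L2: "f \<in> A2 u \<Longrightarrow> f \<in> L2 \<mu>"
  by (simp_all add: A2_iff)

lemma A2_norm_eq:
  assumes "f holomorphic_on unit_disc"
  shows "A2_norm u f = L2_norm \<mu> f"
proof -
  have [measurable]: "f \<in> borel_measurable dA" by (rule holomorphic_measurable_dA[OF assms])
  have "AE z in dA. 0 \<le> u z" using AE_u_pos by eventually_elim simp
  then show ?thesis
    unfolding A2_norm_def L2_norm_def \<mu>_def by (subst integral_density) (simp_all add: mult.commute)
qed

lemma A2_inner_eq:
  assumes "f holomorphic_on unit_disc" "g holomorphic_on unit_disc"
  shows "A2_inner u f g = L2_inner \<mu> f g"
proof -
  have [measurable]: "f \<in> borel_measurable dA" "g \<in> borel_measurable dA"
    using assms by (auto intro: holomorphic_measurable_dA)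
  have "AE z in dA. 0 \<le> u z" using AE_u_pos by eventually_elim simp
  then show ?thesis
    unfolding A2_inner_def L2_inner_def \<mu>_def
    by (subst integral_density) (simp_all add: mult.commute scaleR_conv_of_real)
qed

lemma A2_zero: "(\<lambda>_. 0) \<in> A2 u"
  by (simp add: A2_iff)

lemma A2_cmult: "f \<in> A2 u \<Longrightarrow> (\<lambda>z. c * f z) \<in> A2 u"
  by (auto simp: A2_iff intro: holomorphic_intros L2_cmult)

lemma A2_add: "f \<in> A2 u \<Longrightarrow> g \<in> A2 u \<Longrightarrow> (\<lambda>z. f z + g z) \<in> A2 u"
  by (auto simp: A2_iff intro: holomorphic_intros L2_add)

lemma A2_diff: "f \<in> A2 u \<Longrightarrow> g \<in> A2 u \<Longrightarrow> (\<lambda>z. f z - g z) \<in> A2 u"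
  by (auto simp: A2_iff intro: holomorphic_intros L2_diff)

text \<open>Discs of the common radius \<open>(1 - \<rho>) / 2\<close> fit around all these points,
  and \<sigma> has finite total mass: integrability of \<open>1 / u\<close> is what makes point
  evaluations bounded.\<close>

lemma A2_pointwise_bound:
  assumes "\<rho> < 1"
  obtains B where "B > 0" "\<And>f z. f \<in> A2 u \<Longrightarrow> cmod z \<le> \<rho> \<Longrightarrow> cmod (f z) \<le> B * L2_norm \<mu> f"
proof -
  define r where "r = (1 - \<rho>) / 2"
  have r: "r > 0" using assms by (simp add: r_def)
  define B where "B = sqrt (measure \<sigma> unit_disc / r ^ 4)"
  have "cmod (f z) \<le> (B + 1) * L2_norm \<mu> f" if f: "f \<in> A2 u" and z: "cmod z \<le> \<rho>" for f z
  proof -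
    have sub: "cball z r \<subseteq> unit_disc"
      using z assms by (intro cball_subset_unit_disc) (simp add: r_def field_simps)
    have "ennreal ((cmod (f z))\<^sup>2) * ennreal (r ^ 4)
        \<le> (\<integral>\<^sup>+w\<in>ball z r. ennreal ((cmod (f w))\<^sup>2) \<partial>\<mu>) * emeasure \<sigma> (ball z r)"
      by (rule pointwise_bound[OF A2_holomorphic[OF f] sub r])
    also have "\<dots> \<le> ennreal ((L2_norm \<mu> f)\<^sup>2) * ennreal (measure \<sigma> unit_disc)"
    proof (rule mult_mono)
      show "(\<integral>\<^sup>+w\<in>ball z r. ennreal ((cmod (f w))\<^sup>2) \<partial>\<mu>) \<le> ennreal ((L2_norm \<mu> f)\<^sup>2)"
        unfolding nn_integral_L2[OF A2_L2[OF f], symmetric]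
        by (intro nn_integral_mono) (auto simp: indicator_def)
      show "emeasure \<sigma> (ball z r) \<le> ennreal (measure \<sigma> unit_disc)"
        using emeasure_space[of \<sigma> "ball z r"] by (simp add: S.emeasure_eq_measure)
    qed simp_all
    finally have "(cmod (f z))\<^sup>2 * r ^ 4 \<le> (L2_norm \<mu> f)\<^sup>2 * measure \<sigma> unit_disc"
      using r by (simp add: ennreal_mult[symmetric] ennreal_le_iff)
    then have "(cmod (f z))\<^sup>2 \<le> (B * L2_norm \<mu> f)\<^sup>2"
      using r by (simp add: B_def power_mult_distrib field_simps)
    then have "cmod (f z) \<le> B * L2_norm \<mu> f"
      by (rule power2_le_imp_le) (simp add: B_def)
    then show ?thesis by (simp add: distrib_right add_increasing2)
  qed
  moreover have "B + 1 > 0" by (simp add: B_def add_nonneg_pos)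
  ultimately show ?thesis using that by blast
qed

lemma A2_limit:
  assumes f: "\<And>n. f n \<in> A2 u" "\<And>n. L2_norm \<mu> (f n) \<le> b"
    and g: "g holomorphic_on unit_disc" "\<And>z. z \<in> unit_disc \<Longrightarrow> (\<lambda>n. f n z) \<longlonglongrightarrow> g z"
  shows "g \<in> A2 u" "L2_norm \<mu> g \<le> b"
proof -
  have "g \<in> L2 \<mu>" "L2_norm \<mu> g \<le> b"
    using M.L2_limit[OF A2_L2[OF f(1)] f(2) holomorphic_measurable_\<mu>[OF g(1)] g(2)] by blast+
  then show "g \<in> A2 u" "L2_norm \<mu> g \<le> b" using g by (simp_all add: A2_iff)
qed

text \<open>Norm bounds become locally uniform bounds by \<open>A2_pointwise_bound\<close>, and
  Fatou's lemma keeps the limit in the ball. This takes the role of weak sequential compactness of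
  balls.\<close>

lemma A2_Montel:
  assumes f: "\<And>n. f n \<in> A2 u" "\<And>n. L2_norm \<mu> (f n) \<le> b"
  obtains g r where "g \<in> A2 u" "L2_norm \<mu> g \<le> b" "strict_mono (r :: nat \<Rightarrow> nat)"
    "loc_uniform_limit (\<lambda>n. f (r n)) g"
proof -
  have b: "b \<ge> 0" using f(2)[of 0] L2_norm_nonneg[of \<mu> "f 0"] by linarith
  have loc: "\<exists>B. \<forall>h\<in>range f. \<forall>z\<in>K. cmod (h z) \<le> B" if K: "compact K" "K \<subseteq> unit_disc" for K
  proof (cases "K = {}")
    case False
    obtain w where w: "w \<in> K" "\<And>z. z \<in> K \<Longrightarrow> cmod z \<le> cmod w"
      using continuous_attains_sup[OF K(1) False, of cmod] by (auto intro: continuous_intros)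
    then have "cmod w < 1" using K by auto
    then obtain B where B: "B > 0" "\<And>f z. f \<in> A2 u \<Longrightarrow> cmod z \<le> cmod w \<Longrightarrow> cmod (f z) \<le> B * L2_norm \<mu> f"
      using A2_pointwise_bound by blast
    have "cmod (f n z) \<le> B * b" if "z \<in> K" for n z
      using B(2)[OF f(1) w(2)[OF that], of n] f(2)[of n] B(1)
      by (meson less_imp_le mult_left_mono order.trans)
    then show ?thesis by blast
  qed simp
  obtain g r where g: "g holomorphic_on unit_disc" "strict_mono (r :: nat \<Rightarrow> nat)"
      "\<And>z. z \<in> unit_disc \<Longrightarrow> (\<lambda>n. f (r n) z) \<longlonglongrightarrow> g z"
      "\<And>K. \<lbrakk>compact K; K \<subseteq> unit_disc\<rbrakk> \<Longrightarrow> uniform_limit K (f \<circ> r) g sequentially"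
  proof (rule Montel[of unit_disc "range f" f])
    show "\<And>h. h \<in> range f \<Longrightarrow> h holomorphic_on unit_disc"
      using A2_holomorphic f(1) by auto
    show "\<exists>B. \<forall>h\<in>range f. \<forall>z\<in>K. cmod (h z) \<le> B" if "compact K" "K \<subseteq> unit_disc" for K
      by (rule loc[OF that])
  qed auto
  have lim: "loc_uniform_limit (\<lambda>n. f (r n)) g"
    unfolding loc_uniform_limit_def
  proof (intro allI impI)
    fix \<rho> :: real assume "\<rho> < 1"
    then have "cball 0 \<rho> \<subseteq> unit_disc" by auto
    then show "uniform_limit (cball 0 \<rho>) (\<lambda>n. f (r n)) g sequentially"
      using g(4)[OF compact_cball] by (simp add: o_def)
  qed
  have "g \<in> A2 u" "L2_norm \<mu> g \<le> b"
    using A2_limit[of "\<lambda>n. f (r n)" b g] f g by auto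
  then show ?thesis using that g(2) lim by blast
qed

text \<open>Minimising sequences converge locally uniformly along a subsequence, so the functional has to be
  continuous only for that mode of convergence, and completeness of \<open>A2 u\<close> is not needed.\<close>

lemma A2_Riesz:
  fixes L :: "(complex \<Rightarrow> complex) \<Rightarrow> complex"
  assumes add: "\<And>f g. f \<in> A2 u \<Longrightarrow> g \<in> A2 u \<Longrightarrow> L (\<lambda>z. f z + g z) = L f + L g"
    and cmult: "\<And>c f. f \<in> A2 u \<Longrightarrow> L (\<lambda>z. c * f z) = c * L f"
    and bounded: "\<And>f. f \<in> A2 u \<Longrightarrow> cmod (L f) \<le> B * L2_norm \<mu> f"
    and cont: "\<And>f g b. \<lbrakk>\<And>n. f n \<in> A2 u; \<And>n. L2_norm \<mu> (f n) \<le> b; g \<in> A2 u; loc_uniform_limit f g\<rbrakk>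
      \<Longrightarrow> (\<lambda>n. L (f n)) \<longlonglongrightarrow> L g"
  obtains k where "k \<in> A2 u" "\<And>f. f \<in> A2 u \<Longrightarrow> L f = L2_inner \<mu> f k"
proof (cases "\<forall>f\<in>A2 u. L f = 0")
  case True
  then show ?thesis using that[of "\<lambda>_. 0"] A2_zero by (simp add: L2_inner_def)
next
  case False
  then obtain f0 where f0: "f0 \<in> A2 u" "L f0 \<noteq> 0" by blast
  \<comment> \<open>An element of minimal norm on the affine hyperplane \<open>L f = 1\<close> is
    orthogonal to the kernel of \<open>L\<close>.\<close>
  define X where "X = {L2_norm \<mu> f |f. f \<in> A2 u \<and> L f = 1}"
  have "L (\<lambda>z. 1 / L f0 * f0 z) = 1" using f0 cmult[of f0 "1 / L f0"] by simp
  then have "L2_norm \<mu> (\<lambda>z. 1 / L f0 * f0 z) \<in> X"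
    unfolding X_def using A2_cmult[OF f0(1), of "1 / L f0"] by blast
  then have X: "X \<noteq> {}" by auto
  have bdd: "bdd_below X" unfolding X_def by (auto intro!: bdd_belowI[of _ 0])
  define d where "d = Inf X"
  have "\<exists>f. f \<in> A2 u \<and> L f = 1 \<and> L2_norm \<mu> f < d + inverse (real (Suc n))" for n
    using cInf_lessD[OF X, of "d + inverse (real (Suc n))"] by (auto simp: X_def d_def)
  then obtain f where f: "\<And>n. f n \<in> A2 u" "\<And>n. L (f n) = 1"
      "\<And>n. L2_norm \<mu> (f n) < d + inverse (real (Suc n))"
    by metis
  have fb: "L2_norm \<mu> (f n) \<le> d + 1" for n
  proof -
    have "inverse (real (Suc n)) \<le> 1" by (simp add: field_simps)
    then show ?thesis using f(3)[of n] by linarith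
  qed
  obtain h r where h: "h \<in> A2 u" "strict_mono r" "loc_uniform_limit (\<lambda>n. f (r n)) h"
    by (rule A2_Montel[of f "d + 1", OF f(1) fb]) (blast intro: that)
  have "(\<lambda>n. L (f (r n))) \<longlonglongrightarrow> L h"
    by (rule cont[OF f(1) fb h(1,3)])
  then have Lh: "L h = 1" using f(2) by (simp add: LIMSEQ_const_iff)
  \<comment> \<open>Fatou's lemma for the subsequence from the index \<open>k\<close> on, where all
    norms are within \<open>inverse (real (Suc k))\<close> of the infimum.\<close>
  have hN: "L2_norm \<mu> h \<le> d + inverse (real (Suc k))" for k
  proof (rule A2_limit(2)[of "\<lambda>n. f (r (n + k))"])
    fix n
    have "k \<le> r (n + k)" using seq_suble[OF h(2), of "n + k"] by linarith
    then have "inverse (real (Suc (r (n + k)))) \<le> inverse (real (Suc k))"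
      by (intro le_imp_inverse_le) auto
    then show "L2_norm \<mu> (f (r (n + k))) \<le> d + inverse (real (Suc k))"
      using f(3)[of "r (n + k)"] by linarith
  next
    fix z assume "z \<in> unit_disc"
    then show "(\<lambda>n. f (r (n + k)) z) \<longlonglongrightarrow> h z"
      using LIMSEQ_ignore_initial_segment[OF loc_uniform_limit_pointwise[OF h(3)]] by blast
  qed (use f h A2_holomorphic in auto)
  have "L2_norm \<mu> h \<le> d + 0"
    by (rule LIMSEQ_le_const[OF tendsto_add[OF tendsto_const LIMSEQ_inverse_real_of_nat]]) (use hN in auto)
  then have min: "L2_norm \<mu> h \<le> L2_norm \<mu> g" if "g \<in> A2 u" "L g = 1" for g
    using cInf_lower[OF _ bdd, of "L2_norm \<mu> g"] that unfolding d_def X_def by fastforce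
  have pos: "L2_norm \<mu> h > 0"
  proof -
    have "1 \<le> B * L2_norm \<mu> h" using bounded[OF h(1)] Lh by simp
    then have "L2_norm \<mu> h \<noteq> 0" by auto
    then show ?thesis using L2_norm_nonneg[of \<mu> h] by linarith
  qed
  have orth: "L2_inner \<mu> g h = 0" if g: "g \<in> A2 u" "L g = 0" for g
  proof (cases "L2_norm \<mu> g = 0")
    case True
    then show ?thesis using L2_Cauchy_Schwarz[OF A2_L2 A2_L2, OF g(1) h(1)] by simp
  next
    case False
    define N where "N = (L2_norm \<mu> g)\<^sup>2"
    define p where "p = L2_inner \<mu> g h"
    \<comment> \<open>The coefficient that minimises the norm of \<open>h z + t * g z\<close>. It
      lowers the squared norm of \<open>h\<close> by \<open>(cmod p)\<^sup>2 / N\<close>, which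
      minimality forces to be 0.\<close>
    define t where "t = - cnj p / of_real N"
    have N: "N > 0" using False by (simp add: N_def)
    let ?g = "\<lambda>z. h z + t * g z"
    have "?g \<in> A2 u" by (intro A2_add A2_cmult h g)
    moreover have "L ?g = 1" using add[OF h(1) A2_cmult[OF g(1), of t]] cmult[OF g(1), of t] Lh g(2) by simp
    ultimately have "L2_norm \<mu> h \<le> L2_norm \<mu> ?g" by (rule min)
    then have "(L2_norm \<mu> h)\<^sup>2 \<le> (L2_norm \<mu> ?g)\<^sup>2" by (intro power_mono) auto
    also have "\<dots> = (L2_norm \<mu> h)\<^sup>2 + 2 * Re (cnj t * cnj p) + (cmod t)\<^sup>2 * N"
      using L2_norm_add_power2[OF A2_L2[OF h(1)] L2_cmult[OF A2_L2[OF g(1)], of t]]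
      by (simp add: L2_inner_cmult_right L2_norm_cmult power_mult_distrib N_def p_def
          L2_inner_commute[of \<mu> h g])
    also have "cnj t * cnj p = - of_real ((cmod p)\<^sup>2 / N)"
    proof -
      have "cnj t * cnj p = - (p * cnj p) / of_real N" by (simp add: t_def)
      then show ?thesis by (simp add: complex_norm_square[symmetric])
    qed
    also have "(cmod t)\<^sup>2 * N = (cmod p)\<^sup>2 / N"
    proof -
      have "cmod t = cmod p / N" using N by (simp add: t_def norm_divide)
      then have "(cmod t)\<^sup>2 * N = (cmod p)\<^sup>2 / (N * N) * N" by (simp only: power2_eq_square) simp
      then show ?thesis using N by simp
    qed
    finally have "(cmod p)\<^sup>2 / N \<le> 0" by simp
    then show ?thesis using N by (simp add: p_def divide_le_0_iff)
  qed
  show ?thesis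
  proof (rule that)
    \<comment> \<open>\<open>g - L g * h\<close> lies in the kernel of \<open>L\<close> and is thus
      orthogonal to \<open>h\<close>, so the inner product of \<open>g\<close> with \<open>h\<close>
      is \<open>L g\<close> times the squared norm of \<open>h\<close>.\<close>
    show "(\<lambda>z. of_real (1 / (L2_norm \<mu> h)\<^sup>2) * h z) \<in> A2 u" by (intro A2_cmult h)
    fix g assume g: "g \<in> A2 u"
    have "L2_inner \<mu> (\<lambda>z. g z + (- L g) * h z) h = 0"
    proof (rule orth)
      show "(\<lambda>z. g z + (- L g) * h z) \<in> A2 u" by (intro A2_add A2_cmult g h)
      show "L (\<lambda>z. g z + (- L g) * h z) = 0"
        using add[OF g A2_cmult[OF h(1), of "- L g"]] cmult[OF h(1), of "- L g"] Lh by simp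
    qed
    then have "L2_inner \<mu> g h + (- L g) * L2_inner \<mu> h h = 0"
      using L2_inner_add_left[OF A2_L2[OF g] L2_cmult[OF A2_L2[OF h(1)], of "- L g"] A2_L2[OF h(1)]]
        L2_inner_cmult_left[of \<mu> "- L g" h h] by simp
    then have "L g * of_real ((L2_norm \<mu> h)\<^sup>2) = L2_inner \<mu> g h"
      by (simp only: L2_inner_self) (simp add: algebra_simps)
    then show "L g = L2_inner \<mu> g (\<lambda>z. of_real (1 / (L2_norm \<mu> h)\<^sup>2) * h z)"
      using pos by (simp only: L2_inner_cmult_right) (simp add: field_simps)
  qed
qed

section \<open>Reproducing kernels\<close>

definition kern :: "complex \<Rightarrow> complex \<Rightarrow> complex" where
  "kern a z = repr_kernel u z a"

text \<open>Point evaluation meets the hypotheses of \<open>A2_Riesz\<close>, so the choice behind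
  \<open>repr_kernel\<close> has a witness.\<close>

lemma kern:
  assumes a: "a \<in> unit_disc"
  shows "kern a \<in> A2 u" "\<And>f. f \<in> A2 u \<Longrightarrow> f a = L2_inner \<mu> f (kern a)"
proof -
  have "cmod a < 1" using a by simp
  then obtain B where B: "\<And>f z. f \<in> A2 u \<Longrightarrow> cmod z \<le> cmod a \<Longrightarrow> cmod (f z) \<le> B * L2_norm \<mu> f"
    using A2_pointwise_bound by blast
  obtain k where "k \<in> A2 u" "\<And>f. f \<in> A2 u \<Longrightarrow> f a = L2_inner \<mu> f k"
    by (rule A2_Riesz[of "\<lambda>f. f a" B]) (use B a loc_uniform_limit_pointwise in auto)
  then have "\<exists>k. k \<in> A2 u \<and> (\<forall>f\<in>A2 u. f a = A2_inner u f k)"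
    using A2_inner_eq A2_holomorphic by metis
  from someI_ex[OF this]
  have k: "kern a \<in> A2 u" "\<forall>f\<in>A2 u. f a = A2_inner u f (kern a)"
    unfolding kern_def[abs_def] repr_kernel_def by auto
  then show "kern a \<in> A2 u" by blast
  show "f a = L2_inner \<mu> f (kern a)" if "f \<in> A2 u" for f
    using k that A2_inner_eq A2_holomorphic by metis
qed

text \<open>The Toeplitz integral runs over the second argument of the kernel; this symmetry turns
  it into an inner product with an element of A2.\<close>

lemma kern_commute:
  assumes "a \<in> unit_disc" "b \<in> unit_disc"
  shows "kern a b = cnj (kern b a)"
  using kern(2)[OF assms(2) kern(1)[OF assms(1)]] kern(2)[OF assms(1) kern(1)[OF assms(2)]]
    L2_inner_commute by metis

end

section \<open>Carleson embeddings\<close>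

locale B2_weight_measure = B2_weight u for u +
  fixes \<nu> :: "complex measure"
  assumes prob_\<nu>: "prob_space \<nu>" and sets_\<nu>: "sets \<nu> = sets (restrict_space borel unit_disc)"
begin

lemma disc_measure_\<nu>: "disc_measure \<nu>"
proof (intro disc_measure.intro disc_measure_axioms.intro)
  show "finite_measure \<nu>" using prob_\<nu> by (rule prob_space.finite_measure)
  show sp: "space \<nu> = unit_disc"
    using sets_eq_imp_space_eq[OF sets_\<nu>] by (simp add: space_restrict_space)
  show "(\<lambda>z. z) \<in> measurable \<nu> borel"
    by (simp add: measurable_cong_sets[OF sets_\<nu> refl] measurable_restrict_space1)
qed

sublocale N: disc_measure \<nu> by (rule disc_measure_\<nu>)

lemma holomorphic_measurable_\<nu>: "f holomorphic_on unit_disc \<Longrightarrow> f \<in> borel_measurable \<nu>"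
  by (simp add: measurable_cong_sets[OF sets_\<nu> refl] borel_measurable_continuous_on_restrict
      holomorphic_on_imp_continuous_on)

text \<open>Since \<open>f\<close> is dominated at \<open>z\<close> by its mean over the disc of radius \<open>(1 - \<bar>z\<bar>) / 4\<close> around \<open>z\<close>, Tonelli's theorem
  reduces the claim to an estimate of the \<open>\<nu>\<close>-measure of the set of \<open>z\<close> whose disc contains a given \<open>w\<close>.\<close>

lemma Carleson_estimate:
  assumes C: "ball_bound C" and f: "f holomorphic_on unit_disc" and \<epsilon>: "\<epsilon> \<ge> 0"
    and ber: "\<And>w. \<lbrakk>\<rho> < cmod w; cmod w < 1\<rbrakk> \<Longrightarrow>
      (\<integral>\<^sup>+z. ennreal ((cmod (B_fun w z))\<^sup>2) \<partial>\<nu>) \<le> ennreal \<epsilon> * (\<integral>\<^sup>+z. ennreal ((cmod (B_fun w z))\<^sup>2) \<partial>\<mu>)"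
  shows "(\<integral>\<^sup>+z\<in>- cball 0 ((4 * \<rho> + 1) / 5). ennreal ((cmod (f z))\<^sup>2) \<partial>\<nu>)
    \<le> ennreal (50625 * \<epsilon> * (16 * C + 65536 * C\<^sup>2)) * (\<integral>\<^sup>+w. ennreal ((cmod (f w))\<^sup>2) \<partial>\<mu>)"
proof -
  define K where "K = 16 * C + 65536 * C\<^sup>2"
  have K: "K \<ge> 0" using ball_bound_ge_1[OF C] by (simp add: K_def)
  \<comment> \<open>\<open>1 - R = 4 / 5 * (1 - \<rho>)\<close> offsets the factor
    \<open>5 / 4\<close> in \<open>geom\<close>: the disc belonging to a point beyond
    \<open>R\<close> contains only points beyond \<open>\<rho>\<close>.\<close>
  define R where "R = (4 * \<rho> + 1) / 5"
  \<comment> \<open>The \<sigma>-mass of the disc around \<open>w\<close> of radius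
    \<open>1 - cmod w\<close>, written as an integral over a section of a product set so that its
    measurability in \<open>w\<close> falls under Tonelli's theorem.\<close>
  define H where "H w = (\<integral>\<^sup>+x. indicator {p. dist (fst p) (snd p) < 1 - cmod (fst p)} (w, x) \<partial>\<sigma>)" for w
  define A where "A = {p :: complex \<times> complex. R < cmod (snd p) \<and> dist (snd p) (fst p) < (1 - cmod (snd p)) / 4}"
  have [measurable]: "fst \<in> borel_measurable (\<mu> \<Otimes>\<^sub>M N)" "snd \<in> borel_measurable (N' \<Otimes>\<^sub>M \<nu>)"
    "snd \<in> borel_measurable (N' \<Otimes>\<^sub>M \<sigma>)" for N N' :: "complex measure"
    using measurable_compose[OF measurable_fst M.ident_measurable]
      measurable_compose[OF measurable_snd N.ident_measurable]
      measurable_compose[OF measurable_snd measurable_dA_ident[folded measurable_cong_sets[OF sets_\<sigma> refl]]]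
    by simp_all
  have f\<mu> [measurable]: "f \<in> borel_measurable \<mu>" by (rule holomorphic_measurable_\<mu>[OF f])
  have H_meas [measurable]: "H \<in> borel_measurable \<mu>"
  proof -
    have *: "(\<lambda>p. indicator {p. dist (fst p) (snd p) < 1 - cmod (fst p)} p :: ennreal) \<in> borel_measurable (\<mu> \<Otimes>\<^sub>M \<sigma>)"
      by simp
    show ?thesis
      unfolding H_def by (rule S.borel_measurable_nn_integral) (use * in \<open>simp add: case_prod_beta'\<close>)
  qed
  have H_eq: "H w = emeasure \<sigma> (ball w (1 - cmod w))" if "cmod w < 1" for w
  proof -
    have sub: "ball w (1 - cmod w) \<subseteq> unit_disc"
      by (rule ball_subset_unit_disc) simp
    have "H w = (\<integral>\<^sup>+x. indicator (ball w (1 - cmod w)) x \<partial>\<sigma>)"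
      unfolding H_def by (intro nn_integral_cong) (simp add: indicator_def)
    then show ?thesis using ball_sets_subset[OF sub] by (simp add: sets_\<sigma>)
  qed
  \<comment> \<open>Two points this close have comparable distances to the circle, which allows
    \<open>z\<close> and \<open>w\<close> to be exchanged in the estimates.\<close>
  have geom: "1 - cmod w \<le> 5 / 4 * (1 - cmod z)" "1 - cmod z \<le> 4 / 3 * (1 - cmod w)"
    "dist z w < (1 - cmod w) / 3"
    if "dist z w < (1 - cmod z) / 4" for z w
    using that norm_triangle_ineq2[of z w] norm_triangle_ineq2[of w z]
    by (simp_all add: dist_norm norm_minus_commute)
  have pt: "ennreal ((cmod (f z))\<^sup>2) * indicator (- cball 0 R) z
      \<le> (\<integral>\<^sup>+w. indicator A (w, z) * (ennreal (625 / (1 - cmod w) ^ 4) * H w * ennreal ((cmod (f w))\<^sup>2)) \<partial>\<mu>)"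
    if z: "z \<in> space \<nu>" for z
  proof (cases "z \<in> cball 0 R")
    case False
    have z1: "cmod z < 1" using z by simp
    define r where "r = (1 - cmod z) / 4"
    have r: "r > 0" using z1 by (simp add: r_def)
    have sub: "cball z r \<subseteq> unit_disc"
      using z1 by (intro cball_subset_unit_disc) (simp add: r_def field_simps)
    have "ennreal ((cmod (f z))\<^sup>2) = ennreal (1 / r ^ 4) * (ennreal ((cmod (f z))\<^sup>2) * ennreal (r ^ 4))"
      using r by (simp add: ennreal_mult[symmetric])
    also have "\<dots> \<le> ennreal (1 / r ^ 4) *
        ((\<integral>\<^sup>+w\<in>ball z r. ennreal ((cmod (f w))\<^sup>2) \<partial>\<mu>) * emeasure \<sigma> (ball z r))"
      by (intro mult_left_mono pointwise_bound[OF f sub r]) simp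
    also have "\<dots> = (\<integral>\<^sup>+w. (ennreal (1 / r ^ 4) * emeasure \<sigma> (ball z r))
        * (ennreal ((cmod (f w))\<^sup>2) * indicator (ball z r) w) \<partial>\<mu>)"
    proof -
      have [measurable]: "ball z r \<in> sets \<mu>"
        using sub by (auto simp: sets_\<mu> intro!: ball_sets_subset dest: less_imp_le)
      show ?thesis by (subst nn_integral_cmult) (simp_all add: mult_ac)
    qed
    also have "\<dots> \<le> (\<integral>\<^sup>+w. indicator A (w, z) * (ennreal (625 / (1 - cmod w) ^ 4) * H w * ennreal ((cmod (f w))\<^sup>2)) \<partial>\<mu>)"
    proof (intro nn_integral_mono)
      fix w assume "w \<in> space \<mu>"
      then have w1: "cmod w < 1" by simp
      show "(ennreal (1 / r ^ 4) * emeasure \<sigma> (ball z r)) * (ennreal ((cmod (f w))\<^sup>2) * indicator (ball z r) w)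
        \<le> indicator A (w, z) * (ennreal (625 / (1 - cmod w) ^ 4) * H w * ennreal ((cmod (f w))\<^sup>2))"
      proof (cases "w \<in> ball z r")
        case True
        then have d: "dist z w < (1 - cmod z) / 4" by (simp add: r_def)
        have A: "(w, z) \<in> A" using d False by (simp add: A_def)
        \<comment> \<open>The first part of \<open>geom\<close> reads
          \<open>1 - cmod w \<le> 5 * r\<close>, and \<open>5 ^ 4 = 625\<close>.\<close>
        have "(1 - cmod w) ^ 4 \<le> (5 * r) ^ 4"
          using geom(1)[OF d] w1 by (intro power_mono) (auto simp: r_def)
        then have "1 / r ^ 4 \<le> 625 / (1 - cmod w) ^ 4"
          using r w1 by (simp add: field_simps power_mult_distrib)
        moreover have "emeasure \<sigma> (ball z r) \<le> H w"
          unfolding H_eq[OF w1]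
        proof (rule emeasure_mono)
          show "ball z r \<subseteq> ball w (1 - cmod w)"
          proof
            fix x assume "x \<in> ball z r"
            then have "dist z x < (1 - cmod z) / 4" by (simp add: r_def)
            \<comment> \<open>The two terms add up to at most
              \<open>1 / 3 + 1 / 4 * 4 / 3 = 2 / 3\<close> of \<open>1 - cmod w\<close>.\<close>
            then have "dist w x < (1 - cmod w) / 3 + (1 - cmod z) / 4"
              using geom(3)[OF d] dist_triangle[of w x z] unfolding dist_commute[of w z] by linarith
            then have "dist w x < 1 - cmod w" using geom(2)[OF d] w1 by argo
            then show "x \<in> ball w (1 - cmod w)" by simp
          qed
          have "ball w (1 - cmod w) \<subseteq> unit_disc"
            by (rule ball_subset_unit_disc) simp
          then show "ball w (1 - cmod w) \<in> sets \<sigma>" by (simp add: sets_\<sigma> ball_sets_subset)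
        qed
        ultimately have "ennreal (1 / r ^ 4) * emeasure \<sigma> (ball z r) \<le> ennreal (625 / (1 - cmod w) ^ 4) * H w"
          by (intro mult_mono ennreal_leI) auto
        then show ?thesis using A True by (simp add: mult_right_mono)
      qed simp
    qed
    finally show ?thesis using False by simp
  qed simp
  \<comment> \<open>If \<open>cmod w \<le> \<rho>\<close>, the section of \<open>A\<close> is empty.
    Otherwise the denominator of \<open>B_fun w\<close> is at most \<open>3 * h\<close> on the
    section, so \<open>81 * h ^ 4\<close> times its squared modulus majorises the indicator. The
    powers of \<open>h\<close> cancel, \<open>625 * 81 = 50625\<close>, and
    \<open>B_fun_norm_bound\<close> absorbs \<open>H w\<close>.\<close>
  have inner: "ennreal (625 / (1 - cmod w) ^ 4) * H w * (\<integral>\<^sup>+z. indicator A (w, z) \<partial>\<nu>)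
      \<le> ennreal (50625 * \<epsilon> * K)" if w: "w \<in> space \<mu>" for w
  proof -
    have w1: "cmod w < 1" using w by simp
    define h where "h = 1 - cmod w"
    have h: "h > 0" using w1 by (simp add: h_def)
    show ?thesis
    proof (cases "\<rho> < cmod w")
      case False
      have "(w, z) \<notin> A" for z
      proof
        assume A: "(w, z) \<in> A"
        then have "R < cmod z" "1 - cmod w \<le> 5 / 4 * (1 - cmod z)"
          using geom(1)[of z w] by (auto simp: A_def)
        then show False using False by (simp add: R_def)
      qed
      then show ?thesis by simp
    next
      case True
      have "(\<integral>\<^sup>+z. indicator A (w, z) \<partial>\<nu>) \<le> (\<integral>\<^sup>+z. ennreal (81 * h ^ 4) * ennreal ((cmod (B_fun w z))\<^sup>2) \<partial>\<nu>)"
      proof (intro nn_integral_mono)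
        fix z assume "z \<in> space \<nu>"
        then have z1: "cmod z < 1" by simp
        show "indicator A (w, z) \<le> ennreal (81 * h ^ 4) * ennreal ((cmod (B_fun w z))\<^sup>2)"
        proof (cases "(w, z) \<in> A")
          case True
          then have d: "dist z w < h / 3" using geom(3)[of z w] by (simp add: A_def h_def)
          have "1 - cnj w * z = of_real (1 - (cmod w)\<^sup>2) + cnj w * (w - z)"
            by (simp add: algebra_simps complex_norm_square del: of_real_power)
          then have "cmod (1 - cnj w * z) \<le> \<bar>1 - (cmod w)\<^sup>2\<bar> + cmod w * cmod (w - z)"
            using norm_triangle_ineq[of "of_real (1 - (cmod w)\<^sup>2)" "cnj w * (w - z)"]
            by (simp add: norm_mult del: of_real_diff of_real_power)
          moreover have "\<bar>1 - (cmod w)\<^sup>2\<bar> \<le> 2 * h"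
          proof -
            have "1 - (cmod w)\<^sup>2 = h * (1 + cmod w)"
              by (simp add: h_def power2_eq_square algebra_simps)
            moreover have "h * (1 + cmod w) \<le> h * 2" using w1 h by (intro mult_left_mono) auto
            moreover have "0 \<le> h * (1 + cmod w)" using h by simp
            ultimately show ?thesis by simp
          qed
          moreover have "cmod w * cmod (w - z) \<le> 1 * (h / 3)"
            using w1 d by (intro mult_mono) (auto simp: dist_norm norm_minus_commute)
          ultimately have le: "cmod (1 - cnj w * z) \<le> 3 * h" using h by simp
          have pos: "0 < cmod (1 - cnj w * z)"
            using norm_one_minus_cnj_mult_ge[of z w] z1 w1 by linarith
          have "cmod (1 - cnj w * z) ^ 4 \<le> (3 * h) ^ 4" using le by (intro power_mono) auto
          then have "1 \<le> 81 * h ^ 4 * (cmod (B_fun w z))\<^sup>2"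
            using pos by (simp add: norm_B_fun power_mult_distrib)
          then have "1 \<le> ennreal (81 * h ^ 4 * (cmod (B_fun w z))\<^sup>2)" by (simp add: ennreal_leI[of 1, simplified])
          then show ?thesis using True h by (subst (asm) ennreal_mult) auto
        qed simp
      qed
      also have "\<dots> = ennreal (81 * h ^ 4) * (\<integral>\<^sup>+z. ennreal ((cmod (B_fun w z))\<^sup>2) \<partial>\<nu>)"
        using holomorphic_measurable_\<nu>[OF B_fun_holomorphic[OF w1]] by (intro nn_integral_cmult) simp
      also have "\<dots> \<le> ennreal (81 * h ^ 4) * (ennreal \<epsilon> * (\<integral>\<^sup>+z. ennreal ((cmod (B_fun w z))\<^sup>2) \<partial>\<mu>))"
        by (intro mult_left_mono ber True w1) simp
      finally have "ennreal (625 / (1 - cmod w) ^ 4) * H w * (\<integral>\<^sup>+z. indicator A (w, z) \<partial>\<nu>)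
        \<le> ennreal (625 / h ^ 4) * H w
          * (ennreal (81 * h ^ 4) * (ennreal \<epsilon> * (\<integral>\<^sup>+z. ennreal ((cmod (B_fun w z))\<^sup>2) \<partial>\<mu>)))"
        unfolding h_def by (rule mult_left_mono) simp
      also have "\<dots> = (ennreal (625 / h ^ 4) * ennreal (81 * h ^ 4) * ennreal \<epsilon>)
          * (H w * (\<integral>\<^sup>+z. ennreal ((cmod (B_fun w z))\<^sup>2) \<partial>\<mu>))"
        by (simp only: mult_ac)
      also have "\<dots> \<le> (ennreal (625 / h ^ 4) * ennreal (81 * h ^ 4) * ennreal \<epsilon>) * ennreal K"
        using B_fun_norm_bound[OF C w1] unfolding H_eq[OF w1] S.emeasure_eq_measure K_def
        by (rule mult_left_mono) simp
      also have "\<dots> = ennreal (625 / h ^ 4 * (81 * h ^ 4) * \<epsilon> * K)"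
      proof -
        have "0 \<le> 625 / h ^ 4" "0 \<le> 81 * h ^ 4" "0 \<le> 625 / h ^ 4 * (81 * h ^ 4)"
          "0 \<le> 625 / h ^ 4 * (81 * h ^ 4) * \<epsilon>"
          using \<epsilon> h by auto
        then show ?thesis using \<epsilon> K by (simp only: ennreal_mult)
      qed
      also have "625 / h ^ 4 * (81 * h ^ 4) * \<epsilon> * K = 50625 * \<epsilon> * K"
        using h by simp
      finally show ?thesis .
    qed
  qed
  have A_sets [measurable]: "(\<lambda>p. indicator A p :: ennreal) \<in> borel_measurable (\<mu> \<Otimes>\<^sub>M \<nu>)"
    unfolding A_def by simp
  have "(\<integral>\<^sup>+z\<in>- cball 0 R. ennreal ((cmod (f z))\<^sup>2) \<partial>\<nu>)
      \<le> (\<integral>\<^sup>+z. (\<integral>\<^sup>+w. indicator A (w, z) * (ennreal (625 / (1 - cmod w) ^ 4) * H w * ennreal ((cmod (f w))\<^sup>2)) \<partial>\<mu>) \<partial>\<nu>)"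
    by (intro nn_integral_mono pt)
  also have "\<dots> = (\<integral>\<^sup>+w. (\<integral>\<^sup>+z. indicator A (w, z) * (ennreal (625 / (1 - cmod w) ^ 4) * H w * ennreal ((cmod (f w))\<^sup>2)) \<partial>\<nu>) \<partial>\<mu>)"
  proof (rule pair_sigma_finite.Fubini')
    show "pair_sigma_finite \<mu> \<nu>"
      by (intro pair_sigma_finite.intro M.sigma_finite_measure_axioms N.sigma_finite_measure_axioms)
    have "(\<lambda>p. indicator A p * (ennreal (625 / (1 - cmod (fst p)) ^ 4) * H (fst p) * ennreal ((cmod (f (fst p)))\<^sup>2)))
        \<in> borel_measurable (\<mu> \<Otimes>\<^sub>M \<nu>)"
      by measurable
    then show "(\<lambda>(w, z). indicator A (w, z) * (ennreal (625 / (1 - cmod w) ^ 4) * H w * ennreal ((cmod (f w))\<^sup>2)))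
        \<in> borel_measurable (\<mu> \<Otimes>\<^sub>M \<nu>)"
      by (simp add: case_prod_beta')
  qed
  also have "\<dots> = (\<integral>\<^sup>+w. ennreal (625 / (1 - cmod w) ^ 4) * H w * (\<integral>\<^sup>+z. indicator A (w, z) \<partial>\<nu>)
        * ennreal ((cmod (f w))\<^sup>2) \<partial>\<mu>)"
  proof (intro nn_integral_cong)
    fix w assume "w \<in> space \<mu>"
    then have "(\<lambda>z. indicator A (w, z) :: ennreal) \<in> borel_measurable \<nu>"
      using measurable_compose[OF measurable_Pair1' A_sets] by simp
    then show "(\<integral>\<^sup>+z. indicator A (w, z) * (ennreal (625 / (1 - cmod w) ^ 4) * H w * ennreal ((cmod (f w))\<^sup>2)) \<partial>\<nu>)
      = ennreal (625 / (1 - cmod w) ^ 4) * H w * (\<integral>\<^sup>+z. indicator A (w, z) \<partial>\<nu>) * ennreal ((cmod (f w))\<^sup>2)"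
      by (subst nn_integral_multc) (simp_all add: mult_ac)
  qed
  also have "\<dots> \<le> (\<integral>\<^sup>+w. ennreal (50625 * \<epsilon> * K) * ennreal ((cmod (f w))\<^sup>2) \<partial>\<mu>)"
    by (intro nn_integral_mono mult_right_mono inner) simp_all
  also have "\<dots> = ennreal (50625 * \<epsilon> * K) * (\<integral>\<^sup>+w. ennreal ((cmod (f w))\<^sup>2) \<partial>\<mu>)"
    by (rule nn_integral_cmult) simp
  finally show ?thesis unfolding R_def K_def .
qed

end

section \<open>The test functions near the boundary\<close>

lemma tendsto_boundary_iff:
  fixes f :: "complex \<Rightarrow> real"
  shows "(f \<longlongrightarrow> 0) (filtercomap norm (at_left 1))
    \<longleftrightarrow> (\<forall>\<epsilon>>0. \<exists>\<rho><1. \<forall>a. \<rho> < cmod a \<and> cmod a < 1 \<longrightarrow> \<bar>f a\<bar> < \<epsilon>)"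
proof -
  have "(\<forall>\<^sub>F a in filtercomap norm (at_left 1). P a) \<longleftrightarrow> (\<exists>\<rho><1. \<forall>a. \<rho> < cmod a \<and> cmod a < 1 \<longrightarrow> P a)"
    for P :: "complex \<Rightarrow> bool"
  proof
    assume "\<forall>\<^sub>F a in filtercomap norm (at_left 1). P a"
    then show "\<exists>\<rho><1. \<forall>a. \<rho> < cmod a \<and> cmod a < 1 \<longrightarrow> P a"
      unfolding eventually_filtercomap eventually_at_left[OF zero_less_one] by blast
  next
    assume "\<exists>\<rho><1. \<forall>a. \<rho> < cmod a \<and> cmod a < 1 \<longrightarrow> P a"
    then obtain \<rho> where "\<rho> < 1" "\<forall>a. \<rho> < cmod a \<and> cmod a < 1 \<longrightarrow> P a" by blast
    then show "\<forall>\<^sub>F a in filtercomap norm (at_left 1). P a"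
      unfolding eventually_filtercomap eventually_at_left[OF zero_less_one]
      by (intro exI[of _ "\<lambda>x. \<rho> < x \<and> x < 1"]) auto
  qed
  then show ?thesis by (simp add: tendsto_iff)
qed

context B2_weight
begin

lemma disc_measure_\<sigma>: "disc_measure \<sigma>"
  by (intro disc_measure.intro disc_measure_axioms.intro finite_measure_\<sigma>)
    (simp_all add: measurable_cong_sets[OF sets_\<sigma> refl])

text \<open>The first bound puts \<open>B_fun a\<close> into L2 of \<mu> and \<nu>. The second is
  uniform in \<open>a\<close>, which after normalisation gives convergence to 0 at each
  point.\<close>

lemma norm_B_fun_le:
  assumes "cmod a < 1" "cmod z < 1"
  shows "cmod (B_fun a z) \<le> 1 / (1 - cmod a)\<^sup>2" "cmod (B_fun a z) \<le> 1 / (1 - cmod z)\<^sup>2"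
proof -
  have "1 - cmod a \<le> cmod (1 - cnj a * z)"
    using assms by (intro norm_one_minus_cnj_mult_ge) simp
  then show "cmod (B_fun a z) \<le> 1 / (1 - cmod a)\<^sup>2"
    unfolding B_fun_def norm_divide norm_power norm_one using assms
    by (intro divide_left_mono power_mono mult_pos_pos zero_less_power) auto
  have "1 - cmod z \<le> cmod (1 - cnj a * z)"
    using norm_triangle_ineq2[of 1 "cnj a * z"] mult_right_mono[of "cmod a" 1 "cmod z"] assms
    by (simp add: norm_mult)
  then show "cmod (B_fun a z) \<le> 1 / (1 - cmod z)\<^sup>2"
    unfolding B_fun_def norm_divide norm_power norm_one using assms
    by (intro divide_left_mono power_mono mult_pos_pos zero_less_power) auto
qed

lemma B_fun_A2: "cmod a < 1 \<Longrightarrow> B_fun a \<in> A2 u"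
  unfolding A2_iff using norm_B_fun_le(1)[of a]
  by (auto intro!: B_fun_holomorphic M.L2_bounded holomorphic_measurable_\<mu>)

text \<open>The pointwise bound for \<open>B_fun a\<close> at \<open>a\<close> itself with radius
  \<open>h / 4\<close>. The modulus there is at least \<open>1 / (2 * h)\<^sup>2\<close>, and the
  quotient of \<open>2 * h\<close> and \<open>h / 4\<close> is 8, with
  \<open>8 ^ 4 = 4096\<close>.\<close>

lemma B_fun_norm_lower:
  assumes a: "cmod a < 1"
  shows "1 \<le> 4096 * measure \<sigma> (ball a ((1 - cmod a) / 4)) * (L2_norm \<mu> (B_fun a))\<^sup>2"
proof -
  define h where "h = 1 - cmod a"
  have h: "h > 0" using a by (simp add: h_def)
  have sub: "cball a (h / 4) \<subseteq> unit_disc"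
    using a by (intro cball_subset_unit_disc) (simp add: h_def field_simps)
  have "ennreal ((cmod (B_fun a a))\<^sup>2) * ennreal ((h / 4) ^ 4)
      \<le> (\<integral>\<^sup>+w\<in>ball a (h / 4). ennreal ((cmod (B_fun a w))\<^sup>2) \<partial>\<mu>) * emeasure \<sigma> (ball a (h / 4))"
    using h by (intro pointwise_bound B_fun_holomorphic a sub) simp
  also have "\<dots> \<le> ennreal ((L2_norm \<mu> (B_fun a))\<^sup>2) * emeasure \<sigma> (ball a (h / 4))"
    unfolding nn_integral_L2[OF A2_L2[OF B_fun_A2[OF a]], symmetric]
    by (intro mult_right_mono nn_integral_mono) (auto simp: indicator_def)
  finally have "(cmod (B_fun a a))\<^sup>2 * (h / 4) ^ 4 \<le> (L2_norm \<mu> (B_fun a))\<^sup>2 * measure \<sigma> (ball a (h / 4))"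
    unfolding S.emeasure_eq_measure using h by (simp add: ennreal_mult[symmetric] ennreal_le_iff)
  moreover have "1 / 4096 \<le> (cmod (B_fun a a))\<^sup>2 * (h / 4) ^ 4"
  proof -
    have "1 - cnj a * a = of_real (h * (1 + cmod a))"
      using complex_norm_square[of a] by (simp add: h_def mult.commute[of "cnj a"] algebra_simps power2_eq_square)
    then have eq: "cmod (1 - cnj a * a) = h * (1 + cmod a)"
      using h by (simp only: norm_of_real) simp
    have "0 < 1 + cmod a" by (simp add: add_pos_nonneg)
    have "h * (1 + cmod a) \<le> 2 * h" "0 < h * (1 + cmod a)"
      using a h mult_left_mono[of "1 + cmod a" 2 h] mult_pos_pos[OF h add_pos_nonneg[OF zero_less_one norm_ge_zero[of a]]]
      by auto
    then have "1 / (2 * h) ^ 4 \<le> 1 / (h * (1 + cmod a)) ^ 4"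
      using h \<open>0 < 1 + cmod a\<close> by (intro divide_left_mono power_mono mult_pos_pos zero_less_power) auto
    then have "1 / (2 * h) ^ 4 * (h / 4) ^ 4 \<le> (cmod (B_fun a a))\<^sup>2 * (h / 4) ^ 4"
      unfolding norm_B_fun eq by (intro mult_right_mono) auto
    then show ?thesis using h by (simp add: power_mult_distrib power_divide)
  qed
  ultimately show ?thesis by (simp add: h_def mult_ac)
qed

lemma B_fun_norm_pos: "cmod a < 1 \<Longrightarrow> L2_norm \<mu> (B_fun a) > 0"
proof -
  assume "cmod a < 1"
  then have "L2_norm \<mu> (B_fun a) \<noteq> 0" using B_fun_norm_lower[of a] by auto
  then show ?thesis by (simp add: less_le)
qed

text \<open>As \<sigma> is finite, outer annuli have small \<sigma>-mass; they contain the discs of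
  \<open>B_fun_norm_lower\<close>, whose bound then forces the norms up. Once \<open>cmod a\<close>
  exceeds \<open>(4 * r + 1) / 5\<close>, these discs avoid \<open>cball 0 r\<close>.\<close>

lemma B_fun_norm_large:
  assumes "K > 0"
  obtains \<rho> where "\<rho> < 1" "\<And>a. \<lbrakk>\<rho> < cmod a; cmod a < 1\<rbrakk> \<Longrightarrow> K < L2_norm \<mu> (B_fun a)"
proof -
  interpret S': disc_measure \<sigma> by (rule disc_measure_\<sigma>)
  have "(\<lambda>_. 1) \<in> L2 \<sigma>" by (rule S'.L2_bounded[where b = 1]) simp_all
  then obtain r where r: "r < 1" "(\<integral>z\<in>- cball 0 r. (cmod 1)\<^sup>2 \<partial>\<sigma>) < 1 / (4096 * K\<^sup>2)"
    using S'.L2_tail[of "\<lambda>_. 1" "1 / (4096 * K\<^sup>2)"] assms by auto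
  have "K < L2_norm \<mu> (B_fun a)" if a: "(4 * r + 1) / 5 < cmod a" "cmod a < 1" for a
  proof -
    let ?E = "- cball 0 r \<inter> unit_disc"
    have E: "?E \<in> sets \<sigma>" by (rule S'.borel_sets) simp
    have "(\<integral>z\<in>- cball 0 r. (cmod 1)\<^sup>2 \<partial>\<sigma>) = (\<integral>z. indicator ?E z \<partial>\<sigma>)"
      unfolding set_lebesgue_integral_def by (intro Bochner_Integration.integral_cong) (auto simp: indicator_def)
    then have small: "measure \<sigma> ?E < 1 / (4096 * K\<^sup>2)"
      using r(2) E by simp
    have "ball a ((1 - cmod a) / 4) \<subseteq> ?E"
    proof
      fix x assume "x \<in> ball a ((1 - cmod a) / 4)"
      then have "cmod (x - a) < (1 - cmod a) / 4" by (simp add: dist_norm norm_minus_commute)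
      then show "x \<in> ?E"
        using norm_triangle_ineq[of "x - a" a] norm_triangle_ineq2[of a x] a
        by (simp add: norm_minus_commute)
    qed
    then have "measure \<sigma> (ball a ((1 - cmod a) / 4)) \<le> measure \<sigma> ?E"
      by (intro S.finite_measure_mono E)
    with small have "4096 * measure \<sigma> (ball a ((1 - cmod a) / 4)) < 4096 * (1 / (4096 * K\<^sup>2))"
      by simp
    then have "4096 * measure \<sigma> (ball a ((1 - cmod a) / 4)) * (L2_norm \<mu> (B_fun a))\<^sup>2
        < 4096 * (1 / (4096 * K\<^sup>2)) * (L2_norm \<mu> (B_fun a))\<^sup>2"
      using B_fun_norm_pos[OF a(2)] by (intro mult_strict_right_mono) auto
    then have "1 < 1 / K\<^sup>2 * (L2_norm \<mu> (B_fun a))\<^sup>2"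
      using B_fun_norm_lower[OF a(2)] by simp
    then have "K\<^sup>2 < (L2_norm \<mu> (B_fun a))\<^sup>2" using assms by (simp add: field_simps)
    then show ?thesis by (rule power2_less_imp_less) simp
  qed
  then show ?thesis using that[of "(4 * r + 1) / 5"] r(1) by simp
qed

end

section \<open>The embedding into L2(\<nu>) and the Berezin transform\<close>

context B2_weight_measure
begin

lemma B_fun_L2_\<nu>: "cmod a < 1 \<Longrightarrow> B_fun a \<in> L2 \<nu>"
  using norm_B_fun_le(1)[of a]
  by (auto intro!: B_fun_holomorphic N.L2_bounded holomorphic_measurable_\<nu>)

lemma berezin_eq:
  "cmod a < 1 \<Longrightarrow> berezin u \<nu> a = (L2_norm \<nu> (B_fun a))\<^sup>2 / (L2_norm \<mu> (B_fun a))\<^sup>2"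
  unfolding berezin_def by (simp add: A2_norm_eq B_fun_holomorphic L2_norm_power2)

text \<open>A form of compactness of the inclusion that is free of subsequences. It follows from a
  vanishing Berezin transform and yields both operator statements.\<close>

definition compactly_embedded :: bool where
  "compactly_embedded \<longleftrightarrow>
     (\<exists>c\<ge>0. \<forall>f\<in>A2 u. f \<in> L2 \<nu> \<and> L2_norm \<nu> f \<le> c * L2_norm \<mu> f) \<and>
     (\<forall>f b. (\<forall>n. f n \<in> A2 u) \<longrightarrow> (\<forall>n. L2_norm \<mu> (f n) \<le> b) \<longrightarrow> loc_uniform_limit f (\<lambda>_. 0)
       \<longrightarrow> (\<lambda>n. L2_norm \<nu> (f n)) \<longlonglongrightarrow> 0)"

lemma compactly_embedded_tendsto:
  assumes "compactly_embedded" "\<And>n. f n \<in> A2 u" "\<And>n. L2_norm \<mu> (f n) \<le> b"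
    "loc_uniform_limit f (\<lambda>_. 0)"
  shows "(\<lambda>n. L2_norm \<nu> (f n)) \<longlonglongrightarrow> 0"
  using assms unfolding compactly_embedded_def by blast

text \<open>Asking the Berezin transform to be below \<open>\<epsilon> / K\<close> cancels the
  constant \<open>K\<close> of \<open>Carleson_estimate\<close>. The point is that one
  \<open>R\<close> serves all \<open>f\<close>.\<close>

lemma berezin_vanishing_tail:
  assumes "(berezin u \<nu> \<longlongrightarrow> 0) (filtercomap norm (at_left 1))" "\<epsilon> > 0"
  obtains R where "R < 1"
    "\<And>f. f \<in> A2 u \<Longrightarrow> (\<integral>\<^sup>+z\<in>- cball 0 R. ennreal ((cmod (f z))\<^sup>2) \<partial>\<nu>) \<le> ennreal (\<epsilon> * (L2_norm \<mu> f)\<^sup>2)"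
proof -
  obtain C where C: "ball_bound C" using ball_bound_exists by blast
  define K where "K = 50625 * (16 * C + 65536 * C\<^sup>2)"
  have K: "K > 0" using ball_bound_ge_1[OF C] by (simp add: K_def add_pos_nonneg)
  then have \<delta>: "\<epsilon> / K > 0" using assms by simp
  then obtain \<rho> where \<rho>: "\<rho> < 1" "\<And>a. \<lbrakk>\<rho> < cmod a; cmod a < 1\<rbrakk> \<Longrightarrow> \<bar>berezin u \<nu> a\<bar> < \<epsilon> / K"
    using assms(1) unfolding tendsto_boundary_iff by blast
  have "(\<integral>\<^sup>+z\<in>- cball 0 ((4 * \<rho> + 1) / 5). ennreal ((cmod (f z))\<^sup>2) \<partial>\<nu>) \<le> ennreal (\<epsilon> * (L2_norm \<mu> f)\<^sup>2)"
    if f: "f \<in> A2 u" for f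
  proof -
    have "(\<integral>\<^sup>+z\<in>- cball 0 ((4 * \<rho> + 1) / 5). ennreal ((cmod (f z))\<^sup>2) \<partial>\<nu>)
        \<le> ennreal (50625 * (\<epsilon> / K) * (16 * C + 65536 * C\<^sup>2)) * (\<integral>\<^sup>+w. ennreal ((cmod (f w))\<^sup>2) \<partial>\<mu>)"
    proof (rule Carleson_estimate[OF C A2_holomorphic[OF f]])
      fix w assume w: "\<rho> < cmod w" "cmod w < 1"
      have "(L2_norm \<nu> (B_fun w))\<^sup>2 \<le> \<epsilon> / K * (L2_norm \<mu> (B_fun w))\<^sup>2"
        using \<rho>(2)[OF w] B_fun_norm_pos[OF w(2)] by (simp add: berezin_eq w(2) divide_less_eq)
      then show "(\<integral>\<^sup>+z. ennreal ((cmod (B_fun w z))\<^sup>2) \<partial>\<nu>)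
          \<le> ennreal (\<epsilon> / K) * (\<integral>\<^sup>+z. ennreal ((cmod (B_fun w z))\<^sup>2) \<partial>\<mu>)"
        unfolding nn_integral_L2[OF B_fun_L2_\<nu>[OF w(2)]] nn_integral_L2[OF A2_L2[OF B_fun_A2[OF w(2)]]]
        using \<delta> by (subst ennreal_mult[symmetric]) (auto intro: ennreal_leI)
    qed (use \<delta> in simp)
    also have "50625 * (\<epsilon> / K) * (16 * C + 65536 * C\<^sup>2) = \<epsilon> / K * K"
      by (simp only: K_def mult_ac)
    also have "\<epsilon> / K * K = \<epsilon>"
      using K by simp
    also have "ennreal \<epsilon> * (\<integral>\<^sup>+w. ennreal ((cmod (f w))\<^sup>2) \<partial>\<mu>) = ennreal (\<epsilon> * (L2_norm \<mu> f)\<^sup>2)"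
      using assms(2) by (simp add: nn_integral_L2 A2_L2 f ennreal_mult)
    finally show ?thesis .
  qed
  then show ?thesis using that[of "(4 * \<rho> + 1) / 5"] \<rho>(1) by simp
qed

text \<open>The inner part costs at most \<open>s\<^sup>2\<close> because \<nu> has total mass
  1.\<close>

lemma \<nu>_split_bound:
  assumes f: "f \<in> borel_measurable \<nu>" and in_b: "\<And>z. z \<in> cball 0 R \<Longrightarrow> cmod (f z) \<le> s"
    and out: "(\<integral>\<^sup>+z\<in>- cball 0 R. ennreal ((cmod (f z))\<^sup>2) \<partial>\<nu>) \<le> ennreal t" and st: "s \<ge> 0" "t \<ge> 0"
  shows "f \<in> L2 \<nu>" "(L2_norm \<nu> f)\<^sup>2 \<le> s\<^sup>2 + t"
proof -
  have "(\<integral>\<^sup>+z. ennreal ((cmod (f z))\<^sup>2) \<partial>\<nu>)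
      \<le> (\<integral>\<^sup>+z. ennreal (s\<^sup>2) + ennreal ((cmod (f z))\<^sup>2) * indicator (- cball 0 R) z \<partial>\<nu>)"
  proof (intro nn_integral_mono)
    fix z
    have "cmod (f z) \<le> s" if "z \<in> cball 0 R" using in_b[OF that] .
    then show "ennreal ((cmod (f z))\<^sup>2) \<le> ennreal (s\<^sup>2) + ennreal ((cmod (f z))\<^sup>2) * indicator (- cball 0 R) z"
      by (cases "z \<in> cball 0 R") (auto intro!: ennreal_leI power_mono)
  qed
  also have "\<dots> = ennreal (s\<^sup>2) + (\<integral>\<^sup>+z\<in>- cball 0 R. ennreal ((cmod (f z))\<^sup>2) \<partial>\<nu>)"
  proof (subst nn_integral_add)
    have [measurable]: "f \<in> borel_measurable \<nu>" by (rule f)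
    have "(\<lambda>z. indicator (- cball 0 R) z :: ennreal) \<in> borel_measurable \<nu>"
      by (rule N.borel_measurable_M) simp
    then show "(\<lambda>z. ennreal ((cmod (f z))\<^sup>2) * indicator (- cball 0 R) z) \<in> borel_measurable \<nu>"
      by measurable
    show "(\<integral>\<^sup>+z. ennreal (s\<^sup>2) \<partial>\<nu>) + (\<integral>\<^sup>+z\<in>- cball 0 R. ennreal ((cmod (f z))\<^sup>2) \<partial>\<nu>)
        = ennreal (s\<^sup>2) + (\<integral>\<^sup>+z\<in>- cball 0 R. ennreal ((cmod (f z))\<^sup>2) \<partial>\<nu>)"
      using prob_space.emeasure_space_1[OF prob_\<nu>] by simp
  qed simp
  also have "\<dots> \<le> ennreal (s\<^sup>2) + ennreal t"
    using out by (rule add_left_mono)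
  also have "\<dots> = ennreal ((sqrt (s\<^sup>2 + t))\<^sup>2)" using st by simp
  finally have le: "(\<integral>\<^sup>+z. ennreal ((cmod (f z))\<^sup>2) \<partial>\<nu>) \<le> ennreal ((sqrt (s\<^sup>2 + t))\<^sup>2)" .
  have st': "sqrt (s\<^sup>2 + t) \<ge> 0" using st by simp
  show "f \<in> L2 \<nu>" by (rule L2_norm_le(1)[OF f le st'])
  have "(L2_norm \<nu> f)\<^sup>2 \<le> (sqrt (s\<^sup>2 + t))\<^sup>2"
    by (intro power_mono L2_norm_le(2)[OF f le st']) simp
  then show "(L2_norm \<nu> f)\<^sup>2 \<le> s\<^sup>2 + t" using st by simp
qed

lemma berezin_vanishing_imp_compactly_embedded:
  assumes van: "(berezin u \<nu> \<longlongrightarrow> 0) (filtercomap norm (at_left 1))"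
  shows compactly_embedded
  unfolding compactly_embedded_def
proof (intro conjI allI impI)
  \<comment> \<open>For the norm bound a tail estimate at level 1 is enough;
    \<open>B\<^sup>2 + 1 \<le> (B + 1)\<^sup>2\<close> merges it with the pointwise bound.\<close>
  obtain R where R: "R < 1"
    "\<And>f. f \<in> A2 u \<Longrightarrow> (\<integral>\<^sup>+z\<in>- cball 0 R. ennreal ((cmod (f z))\<^sup>2) \<partial>\<nu>) \<le> ennreal (1 * (L2_norm \<mu> f)\<^sup>2)"
    by (rule berezin_vanishing_tail[OF van zero_less_one]) blast
  obtain B where B: "B > 0" "\<And>f z. f \<in> A2 u \<Longrightarrow> cmod z \<le> R \<Longrightarrow> cmod (f z) \<le> B * L2_norm \<mu> f"
    using A2_pointwise_bound[OF R(1)] by blast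
  have "f \<in> L2 \<nu> \<and> L2_norm \<nu> f \<le> (B + 1) * L2_norm \<mu> f" if f: "f \<in> A2 u" for f
  proof -
    have *: "f \<in> L2 \<nu>" "(L2_norm \<nu> f)\<^sup>2 \<le> (B * L2_norm \<mu> f)\<^sup>2 + 1 * (L2_norm \<mu> f)\<^sup>2"
      using \<nu>_split_bound[of f R "B * L2_norm \<mu> f" "1 * (L2_norm \<mu> f)\<^sup>2"] R(2)[OF f] B f
        holomorphic_measurable_\<nu>[OF A2_holomorphic[OF f]] by auto
    note *(2)
    also have "(B * L2_norm \<mu> f)\<^sup>2 + 1 * (L2_norm \<mu> f)\<^sup>2 \<le> ((B + 1) * L2_norm \<mu> f)\<^sup>2"
      using B(1) by (simp add: power2_eq_square algebra_simps)
    finally show ?thesis using *(1) B(1) by (auto intro: power2_le_imp_le)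
  qed
  then show "\<exists>c\<ge>0. \<forall>f\<in>A2 u. f \<in> L2 \<nu> \<and> L2_norm \<nu> f \<le> c * L2_norm \<mu> f"
    using B(1) by (intro exI[of _ "B + 1"]) auto
next
  fix f b
  assume f: "\<forall>n. f n \<in> A2 u" "\<forall>n. L2_norm \<mu> (f n) \<le> b" "loc_uniform_limit f (\<lambda>_. 0)"
  show "(\<lambda>n. L2_norm \<nu> (f n)) \<longlonglongrightarrow> 0"
  proof (rule LIMSEQ_I)
    fix \<epsilon> :: real assume \<epsilon>: "\<epsilon> > 0"
    \<comment> \<open>Makes the tail contribute less than \<open>\<epsilon>\<^sup>2 / 2\<close>,
      while the inner disc adds \<open>\<epsilon>\<^sup>2 / 4\<close>. The summand 1 covers
      \<open>b = 0\<close>.\<close>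
    define \<delta> where "\<delta> = \<epsilon>\<^sup>2 / (2 * (b\<^sup>2 + 1))"
    have b1: "b\<^sup>2 + 1 > 0" by (simp add: add_nonneg_pos)
    have \<delta>: "\<delta> > 0" using \<epsilon> b1 by (simp add: \<delta>_def)
    obtain R where R: "R < 1"
      "\<And>f. f \<in> A2 u \<Longrightarrow> (\<integral>\<^sup>+z\<in>- cball 0 R. ennreal ((cmod (f z))\<^sup>2) \<partial>\<nu>) \<le> ennreal (\<delta> * (L2_norm \<mu> f)\<^sup>2)"
      by (rule berezin_vanishing_tail[OF van \<delta>]) blast
    have "\<forall>\<^sub>F n in sequentially. \<forall>z\<in>cball 0 R. dist (f n z) 0 < \<epsilon> / 2"
      using f(3) R(1) \<epsilon> unfolding loc_uniform_limit_def uniform_limit_iff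
      by (meson half_gt_zero)
    then obtain N where N: "\<forall>n\<ge>N. \<forall>z\<in>cball 0 R. dist (f n z) 0 < \<epsilon> / 2"
      unfolding eventually_sequentially by blast
    have "norm (L2_norm \<nu> (f n) - 0) < \<epsilon>" if "n \<ge> N" for n
    proof -
      have "(L2_norm \<nu> (f n))\<^sup>2 \<le> (\<epsilon> / 2)\<^sup>2 + \<delta> * (L2_norm \<mu> (f n))\<^sup>2"
        using \<nu>_split_bound(2)[of "f n" R "\<epsilon> / 2" "\<delta> * (L2_norm \<mu> (f n))\<^sup>2"] R(2) f(1) N that \<delta> \<epsilon>
          holomorphic_measurable_\<nu>[OF A2_holomorphic] by (auto simp: less_imp_le)
      also have "\<dots> \<le> (\<epsilon> / 2)\<^sup>2 + \<delta> * b\<^sup>2"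
        using f(2) \<delta> by (intro add_left_mono mult_left_mono power_mono) auto
      also have "\<dots> < (\<epsilon> / 2)\<^sup>2 + \<delta> * (b\<^sup>2 + 1)"
        using \<delta> by simp
      also have "\<delta> * (b\<^sup>2 + 1) = \<epsilon>\<^sup>2 / 2"
      proof -
        have "\<epsilon>\<^sup>2 / (2 * x) * x = \<epsilon>\<^sup>2 / 2" if "x > 0" for x :: real
          using that by simp
        from this[OF b1] show ?thesis unfolding \<delta>_def .
      qed
      also have "(\<epsilon> / 2)\<^sup>2 + \<epsilon>\<^sup>2 / 2 \<le> \<epsilon>\<^sup>2"
        by (simp add: power_divide)
      finally have "L2_norm \<nu> (f n) < \<epsilon>"
        using \<epsilon> by (simp add: power2_less_imp_less)
      then show ?thesis by simp
    qed
    then show "\<exists>N. \<forall>n\<ge>N. norm (L2_norm \<nu> (f n) - 0) < \<epsilon>" by blast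
  qed
qed

lemma A2_norm_bounded_sequence:
  assumes "\<forall>n. f n \<in> A2 u" "\<exists>M. \<forall>n. A2_norm u (f n) \<le> M"
  shows "\<exists>b. \<forall>n. L2_norm \<mu> (f n) \<le> b"
proof -
  have "A2_norm u (f n) = L2_norm \<mu> (f n)" for n
    by (rule A2_norm_eq[OF A2_holomorphic]) (use assms(1) in blast)
  then show ?thesis using assms(2) by simp
qed

text \<open>Montel's theorem proposes the limit \<open>g\<close>, and the differences from it form a
  bounded sequence to which \<open>compactly_embedded\<close> applies.\<close>

lemma compactly_embedded_imp_vanishing_Carleson:
  assumes emb: compactly_embedded
  shows "vanishing_Carleson u \<nu>"
  unfolding vanishing_Carleson_def compact_operator_def
proof (intro conjI allI impI)
  show "(\<lambda>f. f) ` A2 u \<subseteq> L2 \<nu>"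
    using emb by (auto simp: compactly_embedded_def)
next
  fix f :: "nat \<Rightarrow> complex \<Rightarrow> complex"
  assume f: "(\<forall>n. f n \<in> A2 u) \<and> (\<exists>M. \<forall>n. A2_norm u (f n) \<le> M)"
  then obtain b where b: "\<forall>n. L2_norm \<mu> (f n) \<le> b"
    using A2_norm_bounded_sequence[of f] by blast
  obtain g r where g: "g \<in> A2 u" "L2_norm \<mu> g \<le> b" "strict_mono r" "loc_uniform_limit (\<lambda>n. f (r n)) g"
    by (rule A2_Montel[of f b]) (use f b in auto)
  have "(\<lambda>n. L2_norm \<nu> (\<lambda>z. f (r n) z - g z)) \<longlonglongrightarrow> 0"
  proof -
    have "L2_norm \<mu> (\<lambda>z. f (r n) z - g z) \<le> 2 * b" for n
      using L2_norm_triangle_diff[OF A2_L2 A2_L2, of "f (r n)" g] f g(1,2) b[rule_format, of "r n"] by auto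
    moreover have "(\<lambda>z. f (r n) z - g z) \<in> A2 u" for n
      using f g(1) by (intro A2_diff) auto
    ultimately show ?thesis
      by (intro compactly_embedded_tendsto[OF emb _ _ loc_uniform_limit_diff_zero[OF g(4)]])
  qed
  moreover have "g \<in> L2 \<nu>" using emb g(1) by (auto simp: compactly_embedded_def)
  ultimately show "\<exists>g\<in>L2 \<nu>. \<exists>r. strict_mono r \<and> (\<lambda>n. L2_norm \<nu> (\<lambda>x. f (r n) x - g x)) \<longlonglongrightarrow> 0"
    using g(3) by blast
qed

lemma vanishing_Carleson_imp_berezin_vanishing:
  assumes vC: "vanishing_Carleson u \<nu>"
  shows "(berezin u \<nu> \<longlongrightarrow> 0) (filtercomap norm (at_left 1))"
proof (rule ccontr)
  assume "\<not> ?thesis"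
  then obtain \<epsilon> where \<epsilon>: "\<epsilon> > 0" "\<And>\<rho>. \<rho> < 1 \<Longrightarrow> \<exists>a. \<rho> < cmod a \<and> cmod a < 1 \<and> \<epsilon> \<le> \<bar>berezin u \<nu> a\<bar>"
    unfolding tendsto_boundary_iff by (meson not_less)
  have "\<exists>a. 1 - inverse (real (Suc n)) < cmod a \<and> cmod a < 1 \<and> \<epsilon> \<le> \<bar>berezin u \<nu> a\<bar>" for n
    by (rule \<epsilon>(2)) simp
  then obtain a where a: "\<And>n. 1 - inverse (real (Suc n)) < cmod (a n)" "\<And>n. cmod (a n) < 1"
      "\<And>n. \<epsilon> \<le> \<bar>berezin u \<nu> (a n)\<bar>"
    by metis
  define N where "N n = L2_norm \<mu> (B_fun (a n))" for n
  define b where "b n z = of_real (1 / N n) * B_fun (a n) z" for n z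
  have N: "N n > 0" for n unfolding N_def by (rule B_fun_norm_pos[OF a(2)])
  have bA: "b n \<in> A2 u" for n
    unfolding b_def by (intro A2_cmult B_fun_A2 a)
  have b1: "A2_norm u (b n) \<le> 1" for n
    unfolding A2_norm_eq[OF A2_holomorphic[OF bA]]
    unfolding b_def L2_norm_cmult N_def[symmetric] using N[of n] by (simp add: norm_divide)
  \<comment> \<open>The normalisation makes the squared \<nu>-norm of \<open>b n\<close> the Berezin
    transform at \<open>a n\<close>.\<close>
  have bnu: "\<epsilon> \<le> (L2_norm \<nu> (b n))\<^sup>2" for n
  proof -
    have "(L2_norm \<nu> (b n))\<^sup>2 = berezin u \<nu> (a n)"
      unfolding b_def L2_norm_cmult using N[of n]
      by (simp add: berezin_eq[OF a(2)] N_def[symmetric] norm_divide power_mult_distrib power_divide)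
    moreover have "berezin u \<nu> (a n) \<ge> 0" by (simp add: berezin_eq[OF a(2)])
    ultimately show ?thesis using a(3)[of n] by simp
  qed
  have aone: "(\<lambda>n. cmod (a n)) \<longlonglongrightarrow> 1"
  proof (rule tendsto_sandwich)
    show "(\<lambda>n. 1 + - inverse (real (Suc n))) \<longlonglongrightarrow> 1"
      by (rule LIMSEQ_inverse_real_of_nat_add_minus)
  qed (use a in \<open>auto intro!: always_eventually less_imp_le\<close>)
  \<comment> \<open>For fixed \<open>z\<close> the values \<open>B_fun (a n) z\<close> stay bounded,
    so it is the growth of the norms that drives \<open>b n z\<close> to 0.\<close>
  have binf: "LIM n sequentially. N n :> at_top"
    unfolding filterlim_at_top_dense
  proof
    fix K :: real
    obtain \<rho> where \<rho>: "\<rho> < 1" "\<And>a. \<lbrakk>\<rho> < cmod a; cmod a < 1\<rbrakk> \<Longrightarrow> \<bar>K\<bar> + 1 < L2_norm \<mu> (B_fun a)"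
      by (rule B_fun_norm_large[of "\<bar>K\<bar> + 1"]) (auto simp: add_nonneg_pos)
    have "\<forall>\<^sub>F n in sequentially. \<rho> < cmod (a n)"
      using order_tendstoD(1)[OF aone \<rho>(1)] .
    then show "\<forall>\<^sub>F n in sequentially. K < N n"
      by eventually_elim (use \<rho>(2) a(2) in \<open>fastforce simp: N_def\<close>)
  qed
  have bptw: "(\<lambda>n. b n z) \<longlonglongrightarrow> 0" if z: "cmod z < 1" for z
  proof (rule Lim_null_comparison)
    have "(\<lambda>n. inverse (N n) * (1 / (1 - cmod z)\<^sup>2)) \<longlonglongrightarrow> 0 * (1 / (1 - cmod z)\<^sup>2)"
      by (intro tendsto_mult tendsto_const filterlim_compose[OF tendsto_inverse_0_at_top binf] tendsto_inverse_0_at_top binf)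
    then show "(\<lambda>n. inverse (N n) * (1 / (1 - cmod z)\<^sup>2)) \<longlonglongrightarrow> 0" by simp
    have "cmod (b n z) \<le> inverse (N n) * (1 / (1 - cmod z)\<^sup>2)" for n
    proof -
      have "cmod (b n z) = inverse (N n) * cmod (B_fun (a n) z)"
        using N[of n] by (simp add: b_def norm_mult norm_divide field_simps)
      also have "\<dots> \<le> inverse (N n) * (1 / (1 - cmod z)\<^sup>2)"
        using N[of n] by (intro mult_left_mono norm_B_fun_le(2) a z) simp
      finally show ?thesis .
    qed
    then show "\<forall>\<^sub>F n in sequentially. cmod (b n z) \<le> inverse (N n) * (1 / (1 - cmod z)\<^sup>2)" by simp
  qed
  obtain g r where g: "g \<in> L2 \<nu>" "strict_mono r" "(\<lambda>n. L2_norm \<nu> (\<lambda>z. b (r n) z - g z)) \<longlonglongrightarrow> 0"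
    using vC bA b1 unfolding vanishing_Carleson_def compact_operator_def by blast
  have bL: "b n \<in> L2 \<nu>" for n unfolding b_def by (intro L2_cmult B_fun_L2_\<nu> a)
  \<comment> \<open>\<open>g\<close> is known only as a norm limit. The differences
    \<open>b (r n) z - g z\<close> converge pointwise to \<open>- g z\<close> and are eventually
    below \<open>\<delta>\<close> in norm, so Fatou's lemma bounds the norm of \<open>g\<close> by
    every \<open>\<delta>\<close>.\<close>
  have gsmall: "L2_norm \<nu> g \<le> \<delta>" if \<delta>: "\<delta> > 0" for \<delta>
  proof -
    have "\<forall>\<^sub>F n in sequentially. L2_norm \<nu> (\<lambda>z. b (r n) z - g z) < \<delta>"
      using order_tendstoD(2)[OF g(3) \<delta>] .
    then obtain n0 where n0: "\<forall>n\<ge>n0. L2_norm \<nu> (\<lambda>z. b (r n) z - g z) < \<delta>"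
      unfolding eventually_sequentially by blast
    have "L2_norm \<nu> (\<lambda>z. 0 - g z) \<le> \<delta>"
    proof (rule N.L2_limit(2)[of "\<lambda>n z. b (r (n + n0)) z - g z"])
      show "(\<lambda>z. b (r (n + n0)) z - g z) \<in> L2 \<nu>" for n by (intro L2_diff bL g)
      show "L2_norm \<nu> (\<lambda>z. b (r (n + n0)) z - g z) \<le> \<delta>" for n using n0 by (simp add: less_imp_le)
      show "(\<lambda>z. 0 - g z) \<in> borel_measurable \<nu>" using L2_measurable[OF g(1)] by simp
      fix z :: complex assume "z \<in> unit_disc"
      then have "(\<lambda>n. b (r n) z) \<longlonglongrightarrow> 0"
        using LIMSEQ_subseq_LIMSEQ[OF bptw g(2), of z] by (simp add: o_def)
      then show "(\<lambda>n. b (r (n + n0)) z - g z) \<longlonglongrightarrow> 0 - g z"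
        by (intro tendsto_diff tendsto_const LIMSEQ_ignore_initial_segment)
    qed
    then show ?thesis using L2_norm_cmult[of \<nu> "- 1" g] by simp
  qed
  have g0: "L2_norm \<nu> g \<le> 0" by (rule field_le_epsilon) (use gsmall in simp)
  have "L2_norm \<nu> (b (r n)) \<le> L2_norm \<nu> (\<lambda>z. b (r n) z - g z)" for n
    using L2_norm_triangle[OF L2_diff[OF bL g(1)] g(1), of "r n"] g0 by simp
  then have "(\<lambda>n. L2_norm \<nu> (b (r n))) \<longlonglongrightarrow> 0"
    by (intro tendsto_sandwich[OF _ _ tendsto_const g(3)]) auto
  then have "(\<lambda>n. (L2_norm \<nu> (b (r n)))\<^sup>2) \<longlonglongrightarrow> 0\<^sup>2" by (rule tendsto_power)
  then have "\<epsilon> \<le> 0\<^sup>2" by (rule LIMSEQ_le_const) (use bnu in auto)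
  then show False using \<epsilon>(1) by simp
qed

end

section \<open>Toeplitz operators\<close>

context B2_weight
begin

text \<open>The functions on which the identity of the two forms can be read off from the integral
  formula for T_\<nu>, one kernel at a time.\<close>

inductive_set kern_span :: "(complex \<Rightarrow> complex) set" where
  zero: "(\<lambda>_. 0) \<in> kern_span"
| step: "g \<in> kern_span \<Longrightarrow> a \<in> unit_disc \<Longrightarrow> (\<lambda>z. g z + c * kern a z) \<in> kern_span"

lemma kern_span_A2: "g \<in> kern_span \<Longrightarrow> g \<in> A2 u"
proof (induction rule: kern_span.induct)
  case zero
  show ?case by (rule A2_zero)
next
  case (step g a c)
  show ?case by (intro A2_add A2_cmult kern(1) step)
qed

lemma kern_span_cmult: "g \<in> kern_span \<Longrightarrow> (\<lambda>z. c * g z) \<in> kern_span"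
proof (induction rule: kern_span.induct)
  case zero
  then show ?case using kern_span.zero by simp
next
  case (step g a c')
  then show ?case using kern_span.step[OF step.IH, of a "c * c'"] by (simp add: algebra_simps)
qed

lemma kern_span_add: "h \<in> kern_span \<Longrightarrow> g \<in> kern_span \<Longrightarrow> (\<lambda>z. g z + h z) \<in> kern_span"
proof (induction rule: kern_span.induct)
  case (step h a c)
  then show ?case using kern_span.step[OF step.IH, of a c] by (simp add: add.assoc)
qed simp

lemma kern_in_span: "a \<in> unit_disc \<Longrightarrow> kern a \<in> kern_span"
  using kern_span.step[OF kern_span.zero, of a 1] by simp

text \<open>The function \<open>p\<close> is the orthogonal projection of \<open>f\<close> onto the span of the kernels at the points of \<open>F\<close>,
  constructed by the Gram-Schmidt process.\<close>

lemma kern_span_interpolation: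
  assumes "finite F" "F \<subseteq> unit_disc" "f \<in> A2 u"
  shows "\<exists>p\<in>kern_span. (\<forall>a\<in>F. p a = f a) \<and>
    (\<forall>h\<in>A2 u. (\<forall>a\<in>F. h a = 0) \<longrightarrow> L2_inner \<mu> h p = 0)"
  using assms
proof (induction F arbitrary: f rule: finite_induct)
  case empty
  show ?case by (rule bexI[of _ "\<lambda>_. 0"]) (auto simp: L2_inner_def kern_span.zero)
next
  case (insert b F)
  have b: "b \<in> unit_disc" and F: "F \<subseteq> unit_disc" using insert.prems by auto
  obtain p1 where p1: "p1 \<in> kern_span" "\<And>a. a \<in> F \<Longrightarrow> p1 a = f a"
      "\<And>h. \<lbrakk>h \<in> A2 u; \<forall>a\<in>F. h a = 0\<rbrakk> \<Longrightarrow> L2_inner \<mu> h p1 = 0"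
    using insert.IH[OF F insert.prems(2)] by blast
  obtain q where q: "q \<in> kern_span" "\<And>a. a \<in> F \<Longrightarrow> q a = kern b a"
      "\<And>h. \<lbrakk>h \<in> A2 u; \<forall>a\<in>F. h a = 0\<rbrakk> \<Longrightarrow> L2_inner \<mu> h q = 0"
    using insert.IH[OF F kern(1)[OF b]] by blast
  \<comment> \<open>The Gram-Schmidt remainder of \<open>kern b\<close>: it vanishes on
    \<open>F\<close>, and on functions vanishing on \<open>F\<close> it represents evaluation at
    \<open>b\<close>.\<close>
  define e where "e z = kern b z - q z" for z
  have e_span: "e \<in> kern_span"
    unfolding e_def using kern_span_add[OF kern_span_cmult[OF q(1), of "- 1"] kern_in_span[OF b]] by simp
  note A2s = kern_span_A2[OF p1(1)] kern_span_A2[OF q(1)] kern_span_A2[OF e_span] kern(1)[OF b]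
  have eF: "\<And>a. a \<in> F \<Longrightarrow> e a = 0" using q(2) by (simp add: e_def)
  have e_inner: "L2_inner \<mu> h e = h b" if "h \<in> A2 u" "\<forall>a\<in>F. h a = 0" for h
  proof -
    have "L2_inner \<mu> h e = L2_inner \<mu> h (kern b) - L2_inner \<mu> h q"
      unfolding e_def by (intro L2_inner_diff_right A2_L2 that A2s)
    then show ?thesis using q(3)[OF that] kern(2)[OF b that(1)] by simp
  qed
  show ?case
  proof (cases "e b = 0")
    \<comment> \<open>\<open>e b\<close> is the squared norm of \<open>e\<close>. If it is 0, every
      element of A2 vanishing on \<open>F\<close> vanishes at \<open>b\<close> too, so
      \<open>p1\<close> already interpolates there.\<close>
    case True
    have "of_real ((L2_norm \<mu> e)\<^sup>2) = (0 :: complex)"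
      using e_inner[OF A2s(3)] eF True unfolding L2_inner_self by simp
    then have "L2_norm \<mu> e = 0" by simp
    then have zero: "L2_inner \<mu> h e = 0" if "h \<in> A2 u" for h
      using L2_Cauchy_Schwarz[OF A2_L2[OF that] A2_L2[OF A2s(3)]] by simp
    have hb: "h b = 0" if "h \<in> A2 u" "\<forall>a\<in>F. h a = 0" for h
      using e_inner[OF that] zero[OF that(1)] by simp
    have "f b - p1 b = 0"
      using hb[of "\<lambda>z. f z - p1 z"] p1(2) A2_diff[OF insert.prems(2) A2s(1)] by simp
    then show ?thesis
      using p1 by (intro bexI[of _ p1]) auto
  next
    case False
    define c where "c = (f b - p1 b) / e b"
    define p where "p z = p1 z + c * e z" for z
    have "p \<in> kern_span"
      unfolding p_def by (intro kern_span_add kern_span_cmult e_span p1)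
    moreover have "\<forall>a\<in>insert b F. p a = f a"
      using p1(2) eF False by (auto simp: p_def c_def)
    moreover have "L2_inner \<mu> h p = 0" if h: "h \<in> A2 u" "\<forall>a\<in>insert b F. h a = 0" for h
    proof -
      have "L2_inner \<mu> h p = L2_inner \<mu> h p1 + L2_inner \<mu> h (\<lambda>z. c * e z)"
        unfolding p_def by (intro L2_inner_add_right A2_L2 A2_cmult h A2s)
      then show ?thesis
        using p1(3)[OF h(1)] e_inner[OF h(1)] h(2) by (simp add: L2_inner_cmult_right)
    qed
    ultimately show ?thesis by blast
  qed
qed

text \<open>The projections of \<open>f\<close> onto the spans of kernels at finitely many points
  have norm at most that of \<open>f\<close> by Pythagoras, so Montel's theorem gives a limit. It
  agrees with \<open>f\<close> along a sequence accumulating at 0, hence on the disc by the identity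
  theorem.\<close>

lemma kern_span_dense:
  assumes f: "f \<in> A2 u"
  obtains p where "\<And>n. p n \<in> kern_span" "\<And>n. L2_norm \<mu> (p n) \<le> L2_norm \<mu> f" "loc_uniform_limit p f"
proof -
  \<comment> \<open>The shift by 2 keeps the first point inside the disc; the identity theorem needs
    the accumulation point 0 to be interior.\<close>
  define Z :: "nat \<Rightarrow> complex" where "Z i = of_real (1 / (real i + 2))" for i
  have Z: "Z i \<in> unit_disc" for i unfolding Z_def mem_ball_0 norm_of_real by simp
  have "\<exists>p. p \<in> kern_span \<and> (\<forall>a\<in>Z ` {..<n}. p a = f a) \<and>
      (\<forall>h\<in>A2 u. (\<forall>a\<in>Z ` {..<n}. h a = 0) \<longrightarrow> L2_inner \<mu> h p = 0)" for n
    using kern_span_interpolation[of "Z ` {..<n}" f] Z f by blast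
  then have "\<forall>n. \<exists>p. p \<in> kern_span \<and> (\<forall>a\<in>Z ` {..<n}. p a = f a) \<and>
      (\<forall>h\<in>A2 u. (\<forall>a\<in>Z ` {..<n}. h a = 0) \<longrightarrow> L2_inner \<mu> h p = 0)" ..
  from choice[OF this] obtain q where q0: "\<And>n. q n \<in> kern_span \<and> (\<forall>a\<in>Z ` {..<n}. q n a = f a) \<and>
      (\<forall>h\<in>A2 u. (\<forall>a\<in>Z ` {..<n}. h a = 0) \<longrightarrow> L2_inner \<mu> h (q n) = 0)"
    by blast
  then have q: "\<And>n. q n \<in> kern_span" "\<And>n i. i < n \<Longrightarrow> q n (Z i) = f (Z i)"
      "\<And>n h. \<lbrakk>h \<in> A2 u; \<forall>i<n. h (Z i) = 0\<rbrakk> \<Longrightarrow> L2_inner \<mu> h (q n) = 0"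
    by auto
  have qA: "q n \<in> A2 u" for n by (rule kern_span_A2[OF q(1)])
  have qN: "L2_norm \<mu> (q n) \<le> L2_norm \<mu> f" for n
  proof (rule power2_le_imp_le)
    have "L2_inner \<mu> (\<lambda>z. f z - q n z) (q n) = 0"
      by (rule q(3)) (use q(2) in \<open>auto intro: A2_diff f qA\<close>)
    then have "(L2_norm \<mu> f)\<^sup>2 = (L2_norm \<mu> (\<lambda>z. f z - q n z))\<^sup>2 + (L2_norm \<mu> (q n))\<^sup>2"
      using L2_norm_add_power2[OF A2_L2[OF A2_diff[OF f qA]] A2_L2[OF qA], of n n] by simp
    then show "(L2_norm \<mu> (q n))\<^sup>2 \<le> (L2_norm \<mu> f)\<^sup>2" by simp
  qed simp
  obtain g r where g: "g \<in> A2 u" "strict_mono r" "loc_uniform_limit (\<lambda>n. q (r n)) g"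
    by (rule A2_Montel[of q "L2_norm \<mu> f", OF qA qN]) blast
  have gZ: "g (Z i) - f (Z i) = 0" for i
  proof -
    have "\<forall>\<^sub>F n in sequentially. q (r n) (Z i) = f (Z i)"
      unfolding eventually_sequentially
    proof (intro exI[of _ "Suc i"] allI impI)
      fix n assume "Suc i \<le> n"
      then have "i < r n" using seq_suble[OF g(2), of n] by linarith
      then show "q (r n) (Z i) = f (Z i)" by (rule q(2))
    qed
    then have "(\<lambda>n. q (r n) (Z i)) \<longlonglongrightarrow> f (Z i)" by (rule tendsto_eventually)
    from LIMSEQ_unique[OF loc_uniform_limit_pointwise[OF g(3) Z] this] show ?thesis
      by simp
  qed
  have Zlim: "Z \<longlonglongrightarrow> 0"
  proof -
    have "(\<lambda>i. 1 / (real i + 2)) \<longlonglongrightarrow> 0"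
      using LIMSEQ_ignore_initial_segment[OF lim_1_over_n, of 2] by (simp add: add.commute)
    then have "(\<lambda>i. complex_of_real (1 / (real i + 2))) \<longlonglongrightarrow> of_real 0" by (rule tendsto_of_real)
    then show ?thesis by (simp add: Z_def[abs_def])
  qed
  have isl: "0 islimpt range Z"
    unfolding islimpt_sequential
  proof (intro exI[of _ Z] conjI allI)
    have "Z n \<noteq> 0" for n
      unfolding Z_def of_real_eq_0_iff by (simp add: add_nonneg_eq_0_iff)
    then show "Z n \<in> range Z - {0}" for n by simp
  qed (rule Zlim)
  have "g z - f z = 0" if "z \<in> unit_disc" for z
  proof (rule analytic_continuation[of "\<lambda>z. g z - f z" unit_disc "range Z" 0])
    show "(\<lambda>z. g z - f z) holomorphic_on unit_disc"
      by (intro holomorphic_intros A2_holomorphic f g(1))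
  qed (use that Z gZ isl in auto)
  then have gf: "g z = f z" if "cmod z < 1" for z using that by simp
  have "loc_uniform_limit (\<lambda>n. q (r n)) f"
    unfolding loc_uniform_limit_def
  proof (intro allI impI)
    fix \<rho> :: real assume "\<rho> < 1"
    then have "uniform_limit (cball 0 \<rho>) (\<lambda>n. q (r n)) g sequentially"
      using g(3) by (simp add: loc_uniform_limit_def)
    then show "uniform_limit (cball 0 \<rho>) (\<lambda>n. q (r n)) f sequentially"
      by (rule uniform_limit_cong'[THEN iffD1, rotated -1]) (use gf \<open>\<rho> < 1\<close> in auto)
  qed
  then show ?thesis using that[of "\<lambda>n. q (r n)"] q(1) qN by blast
qed

end

section \<open>The Toeplitz operator and the embedding\<close>

context B2_weight_measure
begin

lemma repr_kernel_eq_cnj: "z \<in> unit_disc \<Longrightarrow> w \<in> unit_disc \<Longrightarrow> repr_kernel u z w = cnj (kern z w)"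
  using kern_commute[of w z] by (simp add: kern_def)

lemma toeplitz_eq: "z \<in> unit_disc \<Longrightarrow> toeplitz u \<nu> f z = L2_inner \<nu> f (kern z)"
  unfolding toeplitz_def L2_inner_def
  by (intro Bochner_Integration.integral_cong) (simp_all add: repr_kernel_eq_cnj mult.commute)

lemma toeplitz_integrable_iff:
  "z \<in> unit_disc \<Longrightarrow> integrable \<nu> (\<lambda>w. repr_kernel u z w * f w) \<longleftrightarrow> integrable \<nu> (\<lambda>w. f w * cnj (kern z w))"
  by (intro Bochner_Integration.integrable_cong) (simp_all add: repr_kernel_eq_cnj mult.commute)

lemma compactly_embedded_L2: "compactly_embedded \<Longrightarrow> f \<in> A2 u \<Longrightarrow> f \<in> L2 \<nu>"
  by (auto simp: compactly_embedded_def)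

text \<open>The Toeplitz operator is \<open>i\<^sup>* i\<close> for the inclusion \<open>i\<close> of \<open>A2 u\<close> into \<open>L2 \<nu>\<close>.\<close>

lemma compactly_embedded_adjoint:
  assumes emb: compactly_embedded and f: "f \<in> A2 u"
  shows "toeplitz u \<nu> f \<in> A2 u"
    "\<And>g. g \<in> A2 u \<Longrightarrow> L2_inner \<mu> g (toeplitz u \<nu> f) = L2_inner \<nu> g f"
proof -
  note L2\<nu> = compactly_embedded_L2[OF emb]
  obtain c where c: "c \<ge> 0" "\<And>g. g \<in> A2 u \<Longrightarrow> L2_norm \<nu> g \<le> c * L2_norm \<mu> g"
    using emb unfolding compactly_embedded_def by blast
  obtain h where h: "h \<in> A2 u" "\<And>g. g \<in> A2 u \<Longrightarrow> L2_inner \<nu> g f = L2_inner \<mu> g h"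
  \<comment> \<open>Continuity of the functional along bounded, locally uniformly convergent
    sequences comes from the second clause of \<open>compactly_embedded\<close>.\<close>
  proof (rule A2_Riesz[of "\<lambda>g. L2_inner \<nu> g f" "c * L2_norm \<nu> f"])
    show "L2_inner \<nu> (\<lambda>z. g1 z + g2 z) f = L2_inner \<nu> g1 f + L2_inner \<nu> g2 f"
      if "g1 \<in> A2 u" "g2 \<in> A2 u" for g1 g2
      using that f by (intro L2_inner_add_left L2\<nu>)
    show "L2_inner \<nu> (\<lambda>z. a * g z) f = a * L2_inner \<nu> g f" for a g
      by (rule L2_inner_cmult_left)
    show "cmod (L2_inner \<nu> g f) \<le> c * L2_norm \<nu> f * L2_norm \<mu> g" if g: "g \<in> A2 u" for g
    proof -
      have "cmod (L2_inner \<nu> g f) \<le> L2_norm \<nu> g * L2_norm \<nu> f"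
        by (intro L2_Cauchy_Schwarz L2\<nu> f g)
      also have "\<dots> \<le> c * L2_norm \<mu> g * L2_norm \<nu> f"
        by (intro mult_right_mono c g) simp
      finally show ?thesis by (simp add: mult_ac)
    qed
    fix gs g b
    assume gs: "\<And>n. gs n \<in> A2 u" "\<And>n. L2_norm \<mu> (gs n) \<le> b" "g \<in> A2 u" "loc_uniform_limit gs g"
    have "(\<lambda>n. L2_norm \<nu> (\<lambda>z. gs n z - g z)) \<longlonglongrightarrow> 0"
    proof (rule compactly_embedded_tendsto[OF emb])
      show "(\<lambda>z. gs n z - g z) \<in> A2 u" for n by (intro A2_diff gs)
      show "L2_norm \<mu> (\<lambda>z. gs n z - g z) \<le> b + L2_norm \<mu> g" for n
        using L2_norm_triangle_diff[OF A2_L2[OF gs(1)] A2_L2[OF gs(3)], of n] gs(2)[of n] by linarith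
      show "loc_uniform_limit (\<lambda>n z. gs n z - g z) (\<lambda>_. 0)"
        by (rule loc_uniform_limit_diff_zero[OF gs(4)])
    qed
    then have *: "(\<lambda>n. L2_norm \<nu> (\<lambda>z. gs n z - g z) * L2_norm \<nu> f) \<longlonglongrightarrow> 0"
      by (rule tendsto_mult_left_zero)
    have "(\<lambda>n. L2_inner \<nu> (gs n) f - L2_inner \<nu> g f) \<longlonglongrightarrow> 0"
    proof (rule Lim_null_comparison[OF _ *], intro always_eventually allI)
      fix n
      have "L2_inner \<nu> (gs n) f - L2_inner \<nu> g f = L2_inner \<nu> (\<lambda>z. gs n z - g z) f"
        by (intro L2_inner_diff_left[symmetric] L2\<nu> gs f)
      then show "cmod (L2_inner \<nu> (gs n) f - L2_inner \<nu> g f) \<le> L2_norm \<nu> (\<lambda>z. gs n z - g z) * L2_norm \<nu> f"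
        using L2_Cauchy_Schwarz[OF L2_diff[OF L2\<nu>[OF gs(1)] L2\<nu>[OF gs(3)]] L2\<nu>[OF f], of n] by simp
    qed
    then show "(\<lambda>n. L2_inner \<nu> (gs n) f) \<longlonglongrightarrow> L2_inner \<nu> g f"
      by (simp add: LIM_zero_iff)
  qed blast
  \<comment> \<open>Testing \<open>h\<close> against \<open>kern z\<close> recovers the integral
    formula. The equality is confined to the disc, which is all that the norms see.\<close>
  have eq: "toeplitz u \<nu> f z = h z" if z: "z \<in> unit_disc" for z
    using toeplitz_eq[OF z, of f] h(2)[OF kern(1)[OF z]] kern(2)[OF z h(1)]
      L2_inner_commute[of \<nu> f "kern z"] L2_inner_commute[of \<mu> h "kern z"] by metis
  have "toeplitz u \<nu> f holomorphic_on unit_disc"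
    using A2_holomorphic[OF h(1)] eq by (metis holomorphic_transform)
  moreover have "toeplitz u \<nu> f \<in> L2 \<mu>"
    using L2_cong(1)[of \<mu> "toeplitz u \<nu> f" h] eq A2_L2[OF h(1)] by simp
  ultimately show "toeplitz u \<nu> f \<in> A2 u" by (simp add: A2_iff)
  show "L2_inner \<mu> g (toeplitz u \<nu> f) = L2_inner \<nu> g f" if "g \<in> A2 u" for g
    unfolding h(2)[OF that] by (rule L2_inner_cong) (use eq in auto)
qed

text \<open>The adjoint identity bounds the A2 norm of the image of \<open>f\<close> by a multiple
  of the \<nu>-norm of \<open>f\<close>, so decay of \<nu>-norms passes to the images.\<close>

lemma compactly_embedded_imp_toeplitz_compact:
  assumes emb: compactly_embedded
  shows "toeplitz_compact u \<nu>"
proof -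
  note L2\<nu> = compactly_embedded_L2[OF emb]
  note TA = compactly_embedded_adjoint(1)[OF emb]
  obtain c where c: "c \<ge> 0" "\<And>g. g \<in> A2 u \<Longrightarrow> L2_norm \<nu> g \<le> c * L2_norm \<mu> g"
    using emb unfolding compactly_embedded_def by blast
  have T_le: "L2_norm \<mu> (toeplitz u \<nu> f) \<le> c * L2_norm \<nu> f" if f: "f \<in> A2 u" for f
  proof -
    let ?t = "L2_norm \<mu> (toeplitz u \<nu> f)"
    have "of_real (?t\<^sup>2) = L2_inner \<nu> (toeplitz u \<nu> f) f"
      using compactly_embedded_adjoint(2)[OF emb f TA[OF f]] L2_inner_self by metis
    then have "?t\<^sup>2 = cmod (L2_inner \<nu> (toeplitz u \<nu> f) f)"
      by (metis norm_of_real abs_of_nonneg zero_le_power2)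
    also have "\<dots> \<le> L2_norm \<nu> (toeplitz u \<nu> f) * L2_norm \<nu> f"
      by (intro L2_Cauchy_Schwarz L2\<nu> TA f)
    also have "\<dots> \<le> c * ?t * L2_norm \<nu> f"
      by (intro mult_right_mono c TA f) simp
    finally have "?t * ?t \<le> ?t * (c * L2_norm \<nu> f)" by (simp add: power2_eq_square mult_ac)
    then show ?thesis
      using c(1) by (cases "?t = 0") (simp_all add: less_le)
  qed
  have bounded: "toeplitz_bounded u \<nu>"
    unfolding toeplitz_bounded_def
  proof (intro conjI ballI exI)
    fix f z assume f: "f \<in> A2 u" and z: "z \<in> unit_disc"
    show "integrable \<nu> (\<lambda>w. repr_kernel u z w * f w)"
      unfolding toeplitz_integrable_iff[OF z] by (intro L2_integrable_mult L2\<nu> f kern z)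
  next
    fix f assume f: "f \<in> A2 u"
    show "toeplitz u \<nu> f \<in> A2 u" by (rule TA[OF f])
    have "L2_norm \<mu> (toeplitz u \<nu> f) \<le> c * (c * L2_norm \<mu> f)"
      using T_le[OF f] mult_left_mono[OF c(2)[OF f] c(1)] by linarith
    then show "A2_norm u (toeplitz u \<nu> f) \<le> (c * c) * A2_norm u f"
      by (simp add: A2_norm_eq A2_holomorphic TA f mult.assoc)
  qed
  have "compact_operator (A2 u) (A2_norm u) (A2 u) (A2_norm u) (toeplitz u \<nu>)"
    unfolding compact_operator_def
  proof (intro conjI allI impI)
    show "toeplitz u \<nu> ` A2 u \<subseteq> A2 u" using TA by auto
  next
    fix f :: "nat \<Rightarrow> complex \<Rightarrow> complex"
    assume f: "(\<forall>n. f n \<in> A2 u) \<and> (\<exists>M. \<forall>n. A2_norm u (f n) \<le> M)"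
    then obtain b where b: "\<forall>n. L2_norm \<mu> (f n) \<le> b"
      using A2_norm_bounded_sequence[of f] by blast
    obtain g r where g: "g \<in> A2 u" "L2_norm \<mu> g \<le> b" "strict_mono r" "loc_uniform_limit (\<lambda>n. f (r n)) g"
      by (rule A2_Montel[of f b]) (use f b in auto)
    have d: "(\<lambda>z. f (r n) z - g z) \<in> A2 u" for n
      using f g(1) by (intro A2_diff) auto
    have lim: "(\<lambda>n. L2_norm \<nu> (\<lambda>z. f (r n) z - g z)) \<longlonglongrightarrow> 0"
    proof (rule compactly_embedded_tendsto[OF emb d _ loc_uniform_limit_diff_zero[OF g(4)]])
      show "L2_norm \<mu> (\<lambda>z. f (r n) z - g z) \<le> 2 * b" for n
        using L2_norm_triangle_diff[OF A2_L2 A2_L2, of "f (r n)" g] f g(1,2) b[rule_format, of "r n"] by auto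
    qed
    have "(\<lambda>n. A2_norm u (\<lambda>z. toeplitz u \<nu> (f (r n)) z - toeplitz u \<nu> g z)) \<longlonglongrightarrow> 0"
    proof (rule tendsto_sandwich[OF _ _ tendsto_const tendsto_mult_right_zero[OF lim, of c]])
      have fr: "f (r n) \<in> A2 u" for n using f by auto
      have "A2_norm u (\<lambda>z. toeplitz u \<nu> (f (r n)) z - toeplitz u \<nu> g z)
          = L2_norm \<mu> (toeplitz u \<nu> (\<lambda>z. f (r n) z - g z))" for n
        unfolding A2_norm_eq[OF A2_holomorphic[OF A2_diff[OF TA[OF fr] TA[OF g(1)]]]]
      proof (rule L2_cong(2))
        fix z assume "z \<in> space \<mu>"
        then have z: "z \<in> unit_disc" by simp
        show "toeplitz u \<nu> (f (r n)) z - toeplitz u \<nu> g z = toeplitz u \<nu> (\<lambda>z. f (r n) z - g z) z"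
          unfolding toeplitz_eq[OF z] by (intro L2_inner_diff_left[symmetric] L2\<nu> fr g kern z)
      qed
      then show "\<forall>\<^sub>F n in sequentially. A2_norm u (\<lambda>z. toeplitz u \<nu> (f (r n)) z - toeplitz u \<nu> g z)
          \<le> c * L2_norm \<nu> (\<lambda>z. f (r n) z - g z)"
        using T_le[OF d] by (intro always_eventually) simp
      show "\<forall>\<^sub>F n in sequentially. 0 \<le> A2_norm u (\<lambda>z. toeplitz u \<nu> (f (r n)) z - toeplitz u \<nu> g z)"
        using A2_norm_eq[OF A2_holomorphic[OF A2_diff[OF TA[OF fr] TA[OF g(1)]]]]
        by (intro always_eventually) simp
    qed
    then show "\<exists>g\<in>A2 u. \<exists>r. strict_mono r \<and>
        (\<lambda>n. A2_norm u (\<lambda>x. toeplitz u \<nu> (f (r n)) x - g x)) \<longlonglongrightarrow> 0"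
      using g(3) TA[OF g(1)] by blast
  qed
  with bounded show ?thesis by (simp add: toeplitz_compact_def)
qed

text \<open>Each kernel contributes a value of \<open>toeplitz u \<nu> f\<close>, computed once by
  the integral formula and once by the reproducing property. Integrability is carried along because
  \<open>f\<close> and \<open>g\<close> are not yet known to be square integrable for \<nu>.\<close>

lemma toeplitz_bounded_kern_span:
  assumes bd: "toeplitz_bounded u \<nu>" and f: "f \<in> A2 u" and g: "g \<in> kern_span"
  shows "integrable \<nu> (\<lambda>z. f z * cnj (g z)) \<and> L2_inner \<nu> f g = L2_inner \<mu> (toeplitz u \<nu> f) g"
  using g
proof (induction rule: kern_span.induct)
  case zero
  then show ?case by (simp add: L2_inner_def)
next
  case (step g a c)
  have Tf: "toeplitz u \<nu> f \<in> A2 u" using bd f by (auto simp: toeplitz_bounded_def)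
  have int: "integrable \<nu> (\<lambda>z. f z * cnj (kern a z))"
    using bd f step.hyps(2) toeplitz_integrable_iff[OF step.hyps(2), of f] by (auto simp: toeplitz_bounded_def)
  have eq: "f z * cnj (g z + c * kern a z) = f z * cnj (g z) + cnj c * (f z * cnj (kern a z))" for z
    by (simp add: algebra_simps)
  have "L2_inner \<nu> f (\<lambda>z. g z + c * kern a z) = L2_inner \<nu> f g + cnj c * L2_inner \<nu> f (kern a)"
    unfolding L2_inner_def eq using int step.IH by (subst Bochner_Integration.integral_add) auto
  also have "\<dots> = L2_inner \<mu> (toeplitz u \<nu> f) g + cnj c * L2_inner \<mu> (toeplitz u \<nu> f) (kern a)"
    using step.IH toeplitz_eq[OF step.hyps(2), of f] kern(2)[OF step.hyps(2) Tf] by simp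
  also have "\<dots> = L2_inner \<mu> (toeplitz u \<nu> f) (\<lambda>z. g z + c * kern a z)"
    using step.hyps Tf
    by (simp add: L2_inner_add_right L2_inner_cmult_right A2_L2 L2_cmult kern kern_span_A2)
  finally show ?case unfolding eq using int step.IH by auto
qed

text \<open>On the span the squared \<nu>-norm of \<open>g\<close> is the inner product of its image
  with \<open>g\<close>, which boundedness controls. Fatou's lemma extends the bound to A2 along the
  approximants of \<open>kern_span_dense\<close>.\<close>

lemma toeplitz_bounded_embedding:
  assumes bd: "toeplitz_bounded u \<nu>"
  obtains c where "c \<ge> 0" "\<And>f. f \<in> A2 u \<Longrightarrow> f \<in> L2 \<nu>" "\<And>f. f \<in> A2 u \<Longrightarrow> L2_norm \<nu> f \<le> c * L2_norm \<mu> f"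
proof -
  obtain C0 where C0: "\<And>f. f \<in> A2 u \<Longrightarrow> A2_norm u (toeplitz u \<nu> f) \<le> C0 * A2_norm u f"
    and TA: "\<And>f. f \<in> A2 u \<Longrightarrow> toeplitz u \<nu> f \<in> A2 u"
    using bd unfolding toeplitz_bounded_def by blast
  \<comment> \<open>\<open>toeplitz_bounded\<close> leaves the sign of its constant open, hence the
    absolute value; the square root appears because the form is quadratic.\<close>
  define c where "c = sqrt \<bar>C0\<bar>"
  have span: "g \<in> L2 \<nu> \<and> L2_norm \<nu> g \<le> c * L2_norm \<mu> g" if g: "g \<in> kern_span" for g
  proof -
    have gA: "g \<in> A2 u" by (rule kern_span_A2[OF g])
    note * = toeplitz_bounded_kern_span[OF bd gA g]
    have "integrable \<nu> (\<lambda>z. complex_of_real ((cmod (g z))\<^sup>2))"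
      using * by (simp only: complex_norm_square)
    then have "integrable \<nu> (\<lambda>z. (cmod (g z))\<^sup>2)"
      using integrable_Re by fastforce
    then have gL: "g \<in> L2 \<nu>"
      using holomorphic_measurable_\<nu>[OF A2_holomorphic[OF gA]] by (simp add: L2_def)
    have "of_real ((L2_norm \<nu> g)\<^sup>2) = L2_inner \<mu> (toeplitz u \<nu> g) g"
      using * L2_inner_self by metis
    then have "(L2_norm \<nu> g)\<^sup>2 = cmod (L2_inner \<mu> (toeplitz u \<nu> g) g)"
      by (metis norm_of_real abs_of_nonneg zero_le_power2)
    also have "\<dots> \<le> L2_norm \<mu> (toeplitz u \<nu> g) * L2_norm \<mu> g"
      by (intro L2_Cauchy_Schwarz A2_L2 TA gA)
    also have "\<dots> \<le> (\<bar>C0\<bar> * L2_norm \<mu> g) * L2_norm \<mu> g"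
    proof (intro mult_right_mono)
      have "L2_norm \<mu> (toeplitz u \<nu> g) \<le> C0 * L2_norm \<mu> g"
        using C0[OF gA] by (simp add: A2_norm_eq A2_holomorphic TA gA)
      also have "\<dots> \<le> \<bar>C0\<bar> * L2_norm \<mu> g" by (intro mult_right_mono) auto
      finally show "L2_norm \<mu> (toeplitz u \<nu> g) \<le> \<bar>C0\<bar> * L2_norm \<mu> g" .
    qed simp
    also have "\<dots> = (c * L2_norm \<mu> g)\<^sup>2"
      by (simp add: c_def power_mult_distrib power2_eq_square[of "L2_norm \<mu> g"])
    finally show ?thesis using gL by (auto simp: c_def intro: power2_le_imp_le)
  qed
  have "f \<in> L2 \<nu> \<and> L2_norm \<nu> f \<le> c * L2_norm \<mu> f" if f: "f \<in> A2 u" for f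
  proof -
    obtain p where p: "\<And>n. p n \<in> kern_span" "\<And>n. L2_norm \<mu> (p n) \<le> L2_norm \<mu> f" "loc_uniform_limit p f"
      by (rule kern_span_dense[OF f]) blast
    have "L2_norm \<nu> (p n) \<le> c * L2_norm \<mu> f" for n
      using span[OF p(1)[of n]] mult_left_mono[OF p(2)[of n], of c] by (simp add: c_def)
    then show ?thesis
      using N.L2_limit[of p "c * L2_norm \<mu> f" f] span[OF p(1)] holomorphic_measurable_\<nu>[OF A2_holomorphic[OF f]]
        loc_uniform_limit_pointwise[OF p(3)] by blast
  qed
  then show ?thesis using that[of c] by (simp add: c_def)
qed

text \<open>The approximants converge to \<open>f\<close> locally uniformly with bounded norms in
  both spaces. By \<open>weak_convergence\<close> both forms pass to the limit in one argument while
  the other is kept fixed.\<close>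

lemma toeplitz_bounded_form:
  assumes bd: "toeplitz_bounded u \<nu>" and f: "f \<in> A2 u"
  shows "L2_inner \<nu> f f = L2_inner \<mu> (toeplitz u \<nu> f) f"
proof -
  obtain c where c: "c \<ge> 0" "\<And>f. f \<in> A2 u \<Longrightarrow> f \<in> L2 \<nu>" "\<And>f. f \<in> A2 u \<Longrightarrow> L2_norm \<nu> f \<le> c * L2_norm \<mu> f"
    by (rule toeplitz_bounded_embedding[OF bd]) blast
  have Tf: "toeplitz u \<nu> f \<in> A2 u" using bd f by (auto simp: toeplitz_bounded_def)
  obtain p where p: "\<And>n. p n \<in> kern_span" "\<And>n. L2_norm \<mu> (p n) \<le> L2_norm \<mu> f" "loc_uniform_limit p f"
    by (rule kern_span_dense[OF f]) blast
  define d where "d n z = p n z - f z" for n z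
  have dA: "d n \<in> A2 u" for n unfolding d_def by (intro A2_diff kern_span_A2 p f)
  have dN: "L2_norm \<mu> (d n) \<le> 2 * L2_norm \<mu> f" for n
    using L2_norm_triangle_diff[OF A2_L2[OF kern_span_A2[OF p(1)]] A2_L2[OF f], of n] p(2)[of n]
    unfolding d_def by linarith
  have d0: "loc_uniform_limit d (\<lambda>_. 0)"
    unfolding d_def by (rule loc_uniform_limit_diff_zero[OF p(3)])
  have "(\<lambda>n. L2_inner \<mu> (d n) (toeplitz u \<nu> f)) \<longlonglongrightarrow> 0"
    by (rule M.weak_convergence[OF A2_L2[OF dA] dN d0 A2_L2[OF Tf]])
  moreover have "(\<lambda>n. L2_inner \<nu> (d n) f) \<longlonglongrightarrow> 0"
  proof (rule N.weak_convergence[OF c(2)[OF dA] _ d0 c(2)[OF f]])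
    show "L2_norm \<nu> (d n) \<le> c * (2 * L2_norm \<mu> f)" for n
      using c(3)[OF dA[of n]] mult_left_mono[OF dN c(1), of n] by linarith
  qed
  ultimately have "(\<lambda>n. L2_inner \<mu> (d n) (toeplitz u \<nu> f) - L2_inner \<nu> (d n) f) \<longlonglongrightarrow> 0 - 0"
    by (rule tendsto_diff)
  \<comment> \<open>The identity on the span cancels the terms with \<open>p n\<close>, so this null
    sequence is constant and hence 0.\<close>
  moreover have "L2_inner \<mu> (d n) (toeplitz u \<nu> f) - L2_inner \<nu> (d n) f
      = L2_inner \<nu> f f - L2_inner \<mu> f (toeplitz u \<nu> f)" for n
  proof -
    have "L2_inner \<nu> (p n) f = L2_inner \<mu> (p n) (toeplitz u \<nu> f)"
      using toeplitz_bounded_kern_span[OF bd f p(1)[of n]] L2_inner_commute by metis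
    moreover have "L2_inner \<mu> (d n) (toeplitz u \<nu> f) = L2_inner \<mu> (p n) (toeplitz u \<nu> f) - L2_inner \<mu> f (toeplitz u \<nu> f)"
      unfolding d_def by (intro L2_inner_diff_left A2_L2 kern_span_A2 p f Tf)
    moreover have "L2_inner \<nu> (d n) f = L2_inner \<nu> (p n) f - L2_inner \<nu> f f"
      unfolding d_def by (intro L2_inner_diff_left c(2) kern_span_A2 p f)
    ultimately show ?thesis by simp
  qed
  ultimately have "L2_inner \<nu> f f = L2_inner \<mu> f (toeplitz u \<nu> f)"
    by (simp add: LIMSEQ_const_iff)
  then show ?thesis
    using L2_inner_commute[of \<mu> "toeplitz u \<nu> f" f] L2_inner_commute[of \<nu> f f] by simp
qed

text \<open>By \<open>toeplitz_bounded_form\<close> the squared \<nu>-norm of \<open>F n\<close> is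
  at most the norm of its image times that of \<open>F n\<close>, so it suffices that the images
  tend to 0 along a subsequence.\<close>

lemma toeplitz_compact_imp_vanishing_Carleson:
  assumes comp: "toeplitz_compact u \<nu>"
  shows "vanishing_Carleson u \<nu>"
  unfolding vanishing_Carleson_def compact_operator_def
proof (intro conjI allI impI)
  have bd: "toeplitz_bounded u \<nu>" using comp by (simp add: toeplitz_compact_def)
  obtain c where c: "c \<ge> 0" "\<And>f. f \<in> A2 u \<Longrightarrow> f \<in> L2 \<nu>" "\<And>f. f \<in> A2 u \<Longrightarrow> L2_norm \<nu> f \<le> c * L2_norm \<mu> f"
    by (rule toeplitz_bounded_embedding[OF bd]) blast
  have TA: "\<And>f. f \<in> A2 u \<Longrightarrow> toeplitz u \<nu> f \<in> A2 u" using bd by (auto simp: toeplitz_bounded_def)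
  show "(\<lambda>f. f) ` A2 u \<subseteq> L2 \<nu>" using c(2) by auto
  fix f :: "nat \<Rightarrow> complex \<Rightarrow> complex"
  assume f: "(\<forall>n. f n \<in> A2 u) \<and> (\<exists>M. \<forall>n. A2_norm u (f n) \<le> M)"
  then obtain b where b: "\<forall>n. L2_norm \<mu> (f n) \<le> b"
    using A2_norm_bounded_sequence[of f] by blast
  obtain g r where g: "g \<in> A2 u" "L2_norm \<mu> g \<le> b" "strict_mono r" "loc_uniform_limit (\<lambda>n. f (r n)) g"
    by (rule A2_Montel[of f b]) (use f b in auto)
  define F where "F n z = f (r n) z - g z" for n z
  have FA: "F n \<in> A2 u" for n unfolding F_def using f g(1) by (intro A2_diff) auto
  have FN: "L2_norm \<mu> (F n) \<le> 2 * b" for n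
    unfolding F_def
    using L2_norm_triangle_diff[OF A2_L2 A2_L2, of "f (r n)" g] f g(1,2) b[rule_format, of "r n"] by auto
  have F0: "loc_uniform_limit F (\<lambda>_. 0)"
    unfolding F_def by (rule loc_uniform_limit_diff_zero[OF g(4)])
  have "\<exists>M. \<forall>n. A2_norm u (F n) \<le> M"
    using FN by (auto simp: A2_norm_eq A2_holomorphic[OF FA])
  then obtain h s where h: "h \<in> A2 u" "strict_mono s"
      "(\<lambda>n. A2_norm u (\<lambda>z. toeplitz u \<nu> (F (s n)) z - h z)) \<longlonglongrightarrow> 0"
    using comp FA unfolding toeplitz_compact_def compact_operator_def by blast
  have dA: "(\<lambda>z. toeplitz u \<nu> (F n) z - h z) \<in> A2 u" for n by (intro A2_diff TA FA h)
  have lim: "(\<lambda>n. L2_norm \<mu> (\<lambda>z. toeplitz u \<nu> (F (s n)) z - h z)) \<longlonglongrightarrow> 0"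
    using h(3) by (simp add: A2_norm_eq[OF A2_holomorphic[OF dA]])
  have Fs0: "loc_uniform_limit (\<lambda>n. F (s n)) (\<lambda>_. 0)"
    by (rule loc_uniform_limit_subseq[OF F0 h(2)])
  \<comment> \<open>Norm convergence of the images to \<open>h\<close> implies pointwise
    convergence, while at each \<open>z\<close> they tend to 0 by weak convergence in L2(\<nu>)
    against \<open>kern z\<close>.\<close>
  have hz: "h z = 0" if z: "z \<in> unit_disc" for z
  proof -
    have "cmod z < 1" using z by simp
    then obtain B where B: "B > 0" "\<And>f w. f \<in> A2 u \<Longrightarrow> cmod w \<le> cmod z \<Longrightarrow> cmod (f w) \<le> B * L2_norm \<mu> f"
      using A2_pointwise_bound by blast
    have "(\<lambda>n. toeplitz u \<nu> (F (s n)) z - h z) \<longlonglongrightarrow> 0"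
      by (rule Lim_null_comparison[OF _ tendsto_mult_right_zero[OF lim, of B]])
        (use B(2)[OF dA, of z] in auto)
    moreover have "(\<lambda>n. toeplitz u \<nu> (F (s n)) z) \<longlonglongrightarrow> 0"
      unfolding toeplitz_eq[OF z]
    proof (rule N.weak_convergence[OF c(2)[OF FA] _ Fs0 c(2)[OF kern(1)[OF z]]])
      show "L2_norm \<nu> (F (s n)) \<le> c * (2 * b)" for n
        using c(3)[OF FA[of "s n"]] mult_left_mono[OF FN c(1), of "s n"] by linarith
    qed
    ultimately have "(\<lambda>n. toeplitz u \<nu> (F (s n)) z - (toeplitz u \<nu> (F (s n)) z - h z)) \<longlonglongrightarrow> 0 - 0"
      by (intro tendsto_diff)
    then show ?thesis by (simp add: LIMSEQ_const_iff)
  qed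
  have "L2_norm \<mu> (\<lambda>z. toeplitz u \<nu> (F n) z - h z) = L2_norm \<mu> (toeplitz u \<nu> (F n))" for n
    by (rule L2_cong(2)) (simp add: hz)
  then have lim': "(\<lambda>n. L2_norm \<mu> (toeplitz u \<nu> (F (s n)))) \<longlonglongrightarrow> 0"
    using lim by simp
  have "(\<lambda>n. (L2_norm \<nu> (F (s n)))\<^sup>2) \<longlonglongrightarrow> 0"
  proof (rule tendsto_sandwich[OF _ _ tendsto_const tendsto_mult_left_zero[OF lim', of "2 * b"]])
    have "(L2_norm \<nu> (F n))\<^sup>2 \<le> L2_norm \<mu> (toeplitz u \<nu> (F n)) * (2 * b)" for n
    proof -
      have "of_real ((L2_norm \<nu> (F n))\<^sup>2) = L2_inner \<mu> (toeplitz u \<nu> (F n)) (F n)"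
        using toeplitz_bounded_form[OF bd FA[of n]] L2_inner_self by metis
      then have "(L2_norm \<nu> (F n))\<^sup>2 = cmod (L2_inner \<mu> (toeplitz u \<nu> (F n)) (F n))"
        by (metis norm_of_real abs_of_nonneg zero_le_power2)
      also have "\<dots> \<le> L2_norm \<mu> (toeplitz u \<nu> (F n)) * L2_norm \<mu> (F n)"
        by (intro L2_Cauchy_Schwarz A2_L2 TA FA)
      also have "\<dots> \<le> L2_norm \<mu> (toeplitz u \<nu> (F n)) * (2 * b)"
        by (intro mult_left_mono FN) simp
      finally show ?thesis .
    qed
    then show "\<forall>\<^sub>F n in sequentially. (L2_norm \<nu> (F (s n)))\<^sup>2 \<le> L2_norm \<mu> (toeplitz u \<nu> (F (s n))) * (2 * b)"
      by simp
  qed simp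
  then have "(\<lambda>n. sqrt ((L2_norm \<nu> (F (s n)))\<^sup>2)) \<longlonglongrightarrow> sqrt 0" by (rule tendsto_real_sqrt)
  then have "(\<lambda>n. L2_norm \<nu> (F (s n))) \<longlonglongrightarrow> 0" by simp
  then have "(\<lambda>n. L2_norm \<nu> (\<lambda>z. f ((r \<circ> s) n) z - g z)) \<longlonglongrightarrow> 0"
    by (simp add: F_def[abs_def])
  then show "\<exists>g\<in>L2 \<nu>. \<exists>r. strict_mono r \<and> (\<lambda>n. L2_norm \<nu> (\<lambda>x. f (r n) x - g x)) \<longlonglongrightarrow> 0"
    using c(2)[OF g(1)] strict_mono_o[OF g(3) h(2)] by blast
qed

end

theorem theorem4p3:
  fixes u :: "complex \<Rightarrow> real" and \<nu> :: "complex measure"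
  assumes "weight u"
    and "B2_condition u"
    and "prob_space (density dA (\<lambda>z. ennreal (u z)))"
    and "prob_space \<nu>"
    and "sets \<nu> = sets (restrict_space borel unit_disc)"
  shows "(toeplitz_compact u \<nu> \<longleftrightarrow> (berezin u \<nu> \<longlongrightarrow> 0) (filtercomap norm (at_left 1)))
       \<and> ((berezin u \<nu> \<longlongrightarrow> 0) (filtercomap norm (at_left 1)) \<longleftrightarrow> vanishing_Carleson u \<nu>)"
proof -
  interpret B2_weight_measure u \<nu>
    using assms by (intro B2_weight_measure.intro B2_weight.intro B2_weight_measure_axioms.intro)
  \<comment> \<open>The circle runs from (a) to (c) to (b) to \<open>compactly_embedded\<close>,
    which gives back both (a) and (c).\<close>
  show ?thesis
    using toeplitz_compact_imp_vanishing_Carleson vanishing_Carleson_imp_berezin_vanishing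
      berezin_vanishing_imp_compactly_embedded compactly_embedded_imp_toeplitz_compact
      compactly_embedded_imp_vanishing_Carleson by blast
qed

end
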